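(* Let $n\geqslant1$ and $\ell\geqslant0$. Let $(u,v)$ be the solution of the Cauchy problem $$\begin{cases} u_{tt}-\Delta u+v=0,& x\in\mathbb{R}^n,\ t>0,\\ v_t-\Delta v-u_t=0,& x\in\mathbb{R}^n,\ t>0,\\ (u,u_t,v)(0,x)=(u_0,u_1,v_0)(x),& x\in\mathbb{R}^n.\end{cases}$$ (i) Suppose $u_0\in H^{\ell}\cap L^1$, $u_1\in H^{\ell-1}\cap L^1$ and $v_0\in H^{\ell-3}\cap L^1$. Then $$\|u(t,\cdot)\|_{L^2}\lesssim (1+t)^{-\frac n8}\|(u_0,u_1,v_0)\|_{L^1\times L^1\times L^1}+(1+t)^{-\frac\ell2}\|(u_0,u_1,v_0)\|_{H^{\ell}\times H^{\ell-1}\times H^{\ell-3}}.$$ (ii) If, in addition, $\ell>\frac n4$ and $|P_{u_0-v_0}|\neq0$, then $$t^{-\frac n8}|P_{u_0-v_0}|\lesssim\|u(t,\cdot)\|_{L^2}\lesssim t^{-\frac n8}\|(u_0,u_1,v_0)\|_{(H^{\ell}\cap L^1)\times(H^{\ell-1}\cap L^1)\times(H^{\ell-3}\cap L^1)}$$ for large time $t\gg1$. (iii) If $u_0\in H^{\ell-1}\cap L^1$ (instead of $u_0\in H^{\ell}\cap L^1$), $u_1\in H^{\ell-1}\cap L^1$ and $v_0\in H^{\ell-3}\cap L^1$, then $$\left\|u(t,\cdot)-\mathcal G^{(s)}(t,|D|)\big(u_0(\cdot)-v_0(\cdot)\big)-\mathcal G^{(l)}(t,|D|)u_0(\cdot)\right\|_{L^2}$$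 $$\lesssim(1+t)^{-\min\left\{\frac n8+\frac12,\frac n4\right\}}\|(u_0,u_1,v_0)\|_{L^1\times L^1\times L^1}+(1+t)^{-\frac\ell2}\|(u_0,u_1,v_0)\|_{H^{\ell-1}\times H^{\ell-1}\times H^{\ell-3}}.$$
   Context: $f\lesssim g$ means $f\leqslant Cg$ for some constant $C>0$, independent of $t$ and of the Cauchy data; "for large time $t\gg1$" means for all $t\geqslant t_0$ for some $t_0$ (which may depend on the data). $H^s$ is the $L^2$-based Bessel potential space for any $s\in\mathbb R$, $\|f\|_{H^s\cap L^1}=\|f\|_{H^s}+\|f\|_{L^1}$. $P_f:=\int_{\mathbb R^n}f(x)\,dx$. Solutions are understood via the partial Fourier transform in $x$. Cut-offs: $0<\varepsilon_0\ll1$ and $N_0\gg1$ are fixed, and $\chi_{\mathrm{int}},\chi_{\mathrm{bdd}},\chi_{\mathrm{ext}}$ are smooth cut-off functions (values in $[0,1]$) of $\xi$ supported in $\{|\xi|\leqslant\varepsilon_0\}$, $\{\varepsilon_0/2\leqslant|\xi|\leqslant2N_0\}$, $\{|\xi|\geqslant N_0\}$ respectively, with $\chi_{\mathrm{bdd}}=1-\chi_{\mathrm{int}}-\chi_{\mathrm{ext}}$. $\mathcal G^{(s)}(t,|D|):=\chi_{\mathrm{int}}(D)\mathrm e^{-\Delta^2t}$ and $\mathcal G^{(l)}(t,|D|):=\chi_{\mathrm{ext}}(D)\cos(|D|t)\mathrm e^{-\frac12(-\Delta)^{-1}t}$, i.e. the Fourier multipliers with symbols $\chi_{\mathrm{int}}(\xi)\mathrm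 e^{-|\xi|^4t}$ and $\chi_{\mathrm{ext}}(\xi)\cos(|\xi|t)\mathrm e^{-\frac12|\xi|^{-2}t}$. *)

theory Defs
  imports "HOL-Analysis.Analysis"
begin

text \<open>Functions are complex valued and integrals are taken against Lebesgue measure; real-valued
  Cauchy data are a special case.\<close>

section \<open>Fourier transform and function spaces\<close>

text \<open>Unitary normalisation, so that \<open>|D|\<close> has symbol \<open>|\<xi>|\<close> and \<open>H\<^sup>0 = L\<^sup>2\<close> with equal norms.\<close>

definition fourier :: "('a::euclidean_space \<Rightarrow> complex) \<Rightarrow> 'a \<Rightarrow> complex" where
  "fourier f \<xi> =
     (2 * pi) powr (- real DIM('a) / 2) *\<^sub>R (LINT x|lborel. cis (- (x \<bullet> \<xi>)) * f x)"

definition inverse_fourier :: "('a::euclidean_space \<Rightarrow> complex) \<Rightarrow> 'a \<Rightarrow> complex" where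
  "inverse_fourier f x =
     (2 * pi) powr (- real DIM('a) / 2) *\<^sub>R (LINT \<xi>|lborel. cis (x \<bullet> \<xi>) * f \<xi>)"

definition L1_norm :: "('a::euclidean_space \<Rightarrow> complex) \<Rightarrow> real" where
  "L1_norm f = (LINT x|lborel. cmod (f x))"

definition square_integrable :: "('a::euclidean_space \<Rightarrow> complex) \<Rightarrow> bool" where
  "square_integrable f \<longleftrightarrow>
     f \<in> borel_measurable lborel \<and> integrable lborel (\<lambda>x. (cmod (f x))\<^sup>2)"

definition L2_norm :: "('a::euclidean_space \<Rightarrow> complex) \<Rightarrow> real" where
  "L2_norm f = sqrt (LINT x|lborel. (cmod (f x))\<^sup>2)"

text \<open>\<open>P_int f\<close> is the integral mean \<open>P\<^sub>f\<close>.\<close>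

definition P_int :: "('a::euclidean_space \<Rightarrow> complex) \<Rightarrow> complex" where
  "P_int f = (LINT x|lborel. f x)"

text \<open>The symbol of the Bessel potential applied to the transform of \<open>f\<close>.  The Sobolev spaces are
  only needed intersected with \<open>L\<^sup>1\<close>, where the distributional Fourier transform is given by the
  integral defining \<^const>\<open>fourier\<close>; this covers negative orders \<open>s\<close> as well.\<close>

definition bessel_hat :: "real \<Rightarrow> ('a::euclidean_space \<Rightarrow> complex) \<Rightarrow> 'a \<Rightarrow> complex" where
  "bessel_hat s f \<xi> = (1 + (norm \<xi>)\<^sup>2) powr (s / 2) *\<^sub>R fourier f \<xi>"

definition H_cap_L1 :: "real \<Rightarrow> ('a::euclidean_space \<Rightarrow> complex) set" where
  "H_cap_L1 s = {f. integrable lborel f \<and> square_integrable (bessel_hat s f)}"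

definition H_norm :: "real \<Rightarrow> ('a::euclidean_space \<Rightarrow> complex) \<Rightarrow> real" where
  "H_norm s f = L2_norm (bessel_hat s f)"

definition H_cap_L1_norm :: "real \<Rightarrow> ('a::euclidean_space \<Rightarrow> complex) \<Rightarrow> real" where
  "H_cap_L1_norm s f = H_norm s f + L1_norm f"

section \<open>Smooth functions, Schwartz space and distributions\<close>

definition partial_deriv ::
    "'a::euclidean_space \<Rightarrow> ('a \<Rightarrow> 'b::real_normed_vector) \<Rightarrow> 'a \<Rightarrow> 'b" where
  "partial_deriv b f x = frechet_derivative f (at x) b"

text \<open>Iterated partial derivatives are indexed by lists of basis vectors.\<close>

definition smooth :: "('a::euclidean_space \<Rightarrow> 'b::real_normed_vector) \<Rightarrow> bool" where
  "smooth f \<longleftrightarrow>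
     (\<forall>bs. set bs \<subseteq> Basis \<longrightarrow> (\<forall>x. fold partial_deriv bs f differentiable (at x)))"

definition schwartz :: "('a::euclidean_space \<Rightarrow> complex) set" where
  "schwartz = {\<psi>. smooth \<psi> \<and>
     (\<forall>bs (k::nat). set bs \<subseteq> Basis \<longrightarrow>
        bounded (range (\<lambda>x. (1 + norm x) ^ k *\<^sub>R fold partial_deriv bs \<psi> x)))}"

text \<open>A tempered distribution is represented by its action on \<^const>\<open>schwartz\<close>; values elsewhere are
  irrelevant.\<close>

type_synonym 'a distr = "('a \<Rightarrow> complex) \<Rightarrow> complex"

text \<open>\<open>T\<close> is the inverse Fourier transform of the function \<open>g\<close>, by the usual duality
  \<open>\<langle>F\<^sup>-\<^sup>1 g, \<psi>\<rangle> = \<langle>g, F\<^sup>-\<^sup>1 \<psi>\<rangle>\<close> for the bilinear pairing.  As \<open>F\<^sup>-\<^sup>1\<close> maps the Schwartz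
  space onto itself, integrability against all test functions forces such a \<open>T\<close> to be linear and (by
  the closed graph theorem) continuous, hence tempered.\<close>

definition has_fourier :: "'a::euclidean_space distr \<Rightarrow> ('a \<Rightarrow> complex) \<Rightarrow> bool" where
  "has_fourier T g \<longleftrightarrow> g \<in> borel_measurable lborel \<and>
     (\<forall>\<psi>\<in>schwartz. integrable lborel (\<lambda>\<xi>. g \<xi> * inverse_fourier \<psi> \<xi>) \<and>
        T \<psi> = (LINT \<xi>|lborel. g \<xi> * inverse_fourier \<psi> \<xi>))"

text \<open>The distribution \<open>m(D) f\<close>, with Fourier transform \<open>m\<close> times that of \<open>f\<close>, for \<open>f \<in> L\<^sup>1\<close>.\<close>

definition fourier_multiplier ::
    "('a::euclidean_space \<Rightarrow> complex) \<Rightarrow> ('a \<Rightarrow> complex) \<Rightarrow> 'a distr" where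
  "fourier_multiplier m f =
     (\<lambda>\<psi>. LINT \<xi>|lborel. m \<xi> * fourier f \<xi> * inverse_fourier \<psi> \<xi>)"

definition represents :: "('a::euclidean_space \<Rightarrow> complex) \<Rightarrow> 'a distr \<Rightarrow> bool" where
  "represents f T \<longleftrightarrow>
     (\<forall>\<psi>\<in>schwartz. integrable lborel (\<lambda>x. f x * \<psi> x) \<and> T \<psi> = (LINT x|lborel. f x * \<psi> x))"

definition in_L2 :: "'a::euclidean_space distr \<Rightarrow> bool" where
  "in_L2 T \<longleftrightarrow> (\<exists>f. square_integrable f \<and> represents f T)"

text \<open>Meaningful only under \<^const>\<open>in_L2\<close>; the representing function is unique up to null sets.\<close>

definition distr_L2_norm :: "'a::euclidean_space distr \<Rightarrow> real" where
  "distr_L2_norm T = L2_norm (SOME f. square_integrable f \<and> represents f T)"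

section \<open>The Cauchy problem\<close>

text \<open>The system in the partial Fourier transform with respect to \<open>x\<close>: \<open>U t\<close>, \<open>U1 t\<close>, \<open>V t\<close> are the
  transforms of \<open>u(t)\<close>, \<open>u\<^sub>t(t)\<close>, \<open>v(t)\<close>, and \<open>-\<Delta>\<close> becomes multiplication by \<open>|\<xi>|\<^sup>2\<close>.
  The transforms of the \<open>L\<^sup>1\<close> data are continuous functions, so the equations are imposed at every
  frequency.\<close>

definition cauchy_solution ::
    "('a::euclidean_space \<Rightarrow> complex) \<Rightarrow> ('a \<Rightarrow> complex) \<Rightarrow> ('a \<Rightarrow> complex) \<Rightarrow>
     (real \<Rightarrow> 'a distr) \<Rightarrow> (real \<Rightarrow> 'a distr) \<Rightarrow> bool" where
  "cauchy_solution u0 u1 v0 u v \<longleftrightarrow> (\<exists>U U1 V :: real \<Rightarrow> 'a \<Rightarrow> complex.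
     (\<forall>t\<ge>0. has_fourier (u t) (U t) \<and> has_fourier (v t) (V t)) \<and>
     (\<forall>\<xi>. U 0 \<xi> = fourier u0 \<xi> \<and> U1 0 \<xi> = fourier u1 \<xi> \<and> V 0 \<xi> = fourier v0 \<xi>) \<and>
     (\<forall>\<xi>. continuous_on {0..} (\<lambda>t. U t \<xi>) \<and> continuous_on {0..} (\<lambda>t. U1 t \<xi>) \<and>
        continuous_on {0..} (\<lambda>t. V t \<xi>)) \<and>
     (\<forall>\<xi>. \<forall>t>0.
        ((\<lambda>t. U t \<xi>) has_vector_derivative U1 t \<xi>) (at t) \<and>
        ((\<lambda>t. U1 t \<xi>) has_vector_derivative (- ((norm \<xi>)\<^sup>2 *\<^sub>R U t \<xi>) - V t \<xi>)) (at t) \<and>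
        ((\<lambda>t. V t \<xi>) has_vector_derivative (- ((norm \<xi>)\<^sup>2 *\<^sub>R V t \<xi>) + U1 t \<xi>)) (at t)))"

section \<open>Cut-offs and the profiles\<close>

text \<open>The bounded-frequency cut-off is \<open>1 - \<chi>\<^sub>i\<^sub>n\<^sub>t - \<chi>\<^sub>e\<^sub>x\<^sub>t\<close>.  The supporting sets are closed, so it suffices
  that the functions vanish off them.\<close>

definition cutoffs ::
    "real \<Rightarrow> real \<Rightarrow> ('a::euclidean_space \<Rightarrow> real) \<Rightarrow> ('a \<Rightarrow> real) \<Rightarrow> bool" where
  "cutoffs \<epsilon>0 N0 \<chi>int \<chi>ext \<longleftrightarrow>
     smooth \<chi>int \<and> smooth \<chi>ext \<and>
     (\<forall>\<xi>. \<chi>int \<xi> \<in> {0..1} \<and> \<chi>ext \<xi> \<in> {0..1} \<and> 1 - \<chi>int \<xi> - \<chi>ext \<xi> \<in> {0..1}) \<and>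
     (\<forall>\<xi>. \<chi>int \<xi> \<noteq> 0 \<longrightarrow> norm \<xi> \<le> \<epsilon>0) \<and>
     (\<forall>\<xi>. \<chi>ext \<xi> \<noteq> 0 \<longrightarrow> N0 \<le> norm \<xi>) \<and>
     (\<forall>\<xi>. 1 - \<chi>int \<xi> - \<chi>ext \<xi> \<noteq> 0 \<longrightarrow> \<epsilon>0 / 2 \<le> norm \<xi> \<and> norm \<xi> \<le> 2 * N0)"

definition G_s :: "('a::euclidean_space \<Rightarrow> real) \<Rightarrow> real \<Rightarrow> ('a \<Rightarrow> complex) \<Rightarrow> 'a distr" where
  "G_s \<chi>int t =
     fourier_multiplier (\<lambda>\<xi>. complex_of_real (\<chi>int \<xi> * exp (- ((norm \<xi>) ^ 4 * t))))"

definition G_l :: "('a::euclidean_space \<Rightarrow> real) \<Rightarrow> real \<Rightarrow> ('a \<Rightarrow> complex) \<Rightarrow> 'a distr" where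
  "G_l \<chi>ext t =
     fourier_multiplier (\<lambda>\<xi>. complex_of_real
       (\<chi>ext \<xi> * cos (norm \<xi> * t) * exp (- (t / (2 * (norm \<xi>)\<^sup>2)))))"

end

theory Submission
  imports Defs "HOL-Probability.Probability"
begin

text \<open>For each frequency \<open>\<xi>\<close> with \<open>r = |\<xi>|\<close>, the transformed system is a linear system of ordinary
  differential equations with constant coefficients, whose characteristic polynomial
  \<open>\<lambda>\<^sup>3 + r\<^sup>2 \<lambda>\<^sup>2 + (1 + r\<^sup>2) \<lambda> + r\<^sup>4\<close> has one real root \<open>-\<mu>\<close> and a pair of complex ones.  Factoring
  out the real root gives an explicit solution (\<open>solution_formula\<close>) with coefficients that can be
  estimated at all frequencies.

  For \<open>r \<le> 1\<close> the real root dominates: it is close to \<open>-r\<^sup>4\<close>, its amplitude is close to the transform of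
  \<open>u\<^sub>0 - v\<^sub>0\<close>, and the complex roots decay at the parabolic rate (\<open>low_frequency_bound\<close>).  For
  \<open>r \<ge> 1\<close> the complex roots dominate: they are close to \<open>\<plusminus>\<i>r - 1/(2r\<^sup>2)\<close>, and the contribution of \<open>u\<^sub>0\<close>
  is a damped wave up to an error with one more negative power of \<open>r\<close> (\<open>high_frequency_bound\<close>).

  The time decay then comes from two sources.  At low frequencies the transforms of the integrable data
  are bounded, and the \<open>L\<^sup>2\<close> norms of the weights are computed by scaling
  (\<open>L2_decay_exp_power4\<close>, \<open>L2_decay_low_frequency_error\<close>): a function of \<open>t\<^sup>1\<^sup>/\<^sup>4 \<xi>\<close> contributes the rate
  \<open>n/8\<close>, a function of \<open>t\<^sup>1\<^sup>/\<^sup>2 \<xi>\<close> the rate \<open>n/4\<close>, and a factor \<open>r\<^sup>2\<close> in the former gains \<open>1/2\<close>.  At high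
  frequencies the damping degenerates, and \<open>l\<close> derivatives of the data are traded for the rate \<open>l/2\<close>
  (\<open>high_frequency_weight\<close>).  The lower bound holds because the leading low-frequency term is of the
  exact order of the mean of \<open>u\<^sub>0 - v\<^sub>0\<close> on a ball of radius \<open>t\<^sup>-\<^sup>1\<^sup>/\<^sup>4\<close>, while the remainder decays faster
  (\<open>solution_L2_lower_bound\<close>).

  These are statements about Fourier transforms.  They carry over to the solution by Plancherel's theorem
  in the form \<open>distr_L2_norm_eq\<close>: a distribution with square-integrable transform is represented by a
  function, unique up to null sets, with the same \<open>L\<^sup>2\<close> norm.  Its proof rests on Gaussian
  regularisation: Gaussians are an approximate identity in \<open>L\<^sup>2\<close> (\<open>gconv_tendsto_L2\<close>), they are Schwartz
  functions, and damping a transform by a Gaussian amounts to regularising the function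
  (\<open>fourier_damped_inverse_fourier\<close>).\<close>

section \<open>Square-integrable functions\<close>

lemma square_integrable_measurable [measurable_dest]:
  "square_integrable f \<Longrightarrow> f \<in> borel_measurable borel"
  by (simp add: square_integrable_def)

lemma square_integrable_dominated:
  assumes [measurable]: "f \<in> borel_measurable borel" and "integrable lborel h"
    and "AE x in lborel. (cmod (f x))\<^sup>2 \<le> h x"
  shows "square_integrable f" "L2_norm f \<le> sqrt (LINT x|lborel. h x)"
proof -
  have i: "integrable lborel (\<lambda>x. (cmod (f x))\<^sup>2)"
    by (rule Bochner_Integration.integrable_bound[OF assms(2)]) (use assms(3) in auto)
  then show "square_integrable f" by (simp add: square_integrable_def)
  show "L2_norm f \<le> sqrt (LINT x|lborel. h x)"
    unfolding L2_norm_def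
    by (intro real_sqrt_le_mono integral_mono_AE i assms)
qed

lemma norm_add_square_le: "(cmod (a + b))\<^sup>2 \<le> 2 * (cmod a)\<^sup>2 + 2 * (cmod b)\<^sup>2"
proof -
  have "(cmod (a + b))\<^sup>2 \<le> (cmod a + cmod b)\<^sup>2"
    by (intro power_mono norm_triangle_ineq) auto
  also have "\<dots> \<le> 2 * (cmod a)\<^sup>2 + 2 * (cmod b)\<^sup>2"
    using sum_squares_bound[of "cmod a" "cmod b"] by (simp add: power2_sum)
  finally show ?thesis .
qed

lemma square_integrable_add:
  assumes "square_integrable f" "square_integrable g"
  shows "square_integrable (\<lambda>x. f x + g x)"
proof (rule square_integrable_dominated(1))
  show "integrable lborel (\<lambda>x. 2 * (cmod (f x))\<^sup>2 + 2 * (cmod (g x))\<^sup>2)"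
    using assms by (auto simp: square_integrable_def)
qed (use assms in \<open>auto intro: norm_add_square_le simp: square_integrable_def\<close>)

lemma square_integrable_cmult:
  "square_integrable f \<Longrightarrow> square_integrable (\<lambda>x. c * f x)"
  by (auto simp: square_integrable_def norm_mult power_mult_distrib)

lemma square_integrable_diff:
  assumes "square_integrable f" "square_integrable g"
  shows "square_integrable (\<lambda>x. f x - g x)"
  using square_integrable_add[OF assms(1) square_integrable_cmult[OF assms(2), of "-1"]] by simp

lemma square_integrable_cnj:
  "square_integrable f \<Longrightarrow> square_integrable (\<lambda>x. cnj (f x))"
  unfolding square_integrable_def by (auto intro: borel_measurable_continuous_onI[THEN measurable_compose[rotated]] continuous_intros)

lemma L2_norm_nonneg: "0 \<le> L2_norm f"
  by (simp add: L2_norm_def)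

lemma L2_norm_power2: "(L2_norm f)\<^sup>2 = (LINT x|lborel. (cmod (f x))\<^sup>2)"
  by (simp add: L2_norm_def)

lemma L2_norm_cmult: "L2_norm (\<lambda>x. c * f x) = cmod c * L2_norm f"
  by (simp add: L2_norm_def norm_mult power_mult_distrib real_sqrt_mult)

lemma L2_norm_cong: "(\<And>x. cmod (f x) = cmod (g x)) \<Longrightarrow> L2_norm f = L2_norm g"
  by (simp add: L2_norm_def)

lemma L2_norm_minus_commute: "L2_norm (\<lambda>x. f x - g x) = L2_norm (\<lambda>x. g x - f x)"
  by (intro L2_norm_cong norm_minus_commute)

lemma Cauchy_Schwarz_integrable:
  assumes f: "square_integrable f" and g: "square_integrable g"
  shows "integrable lborel (\<lambda>x. f x * g x)"
proof (rule Bochner_Integration.integrable_bound)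
  show "integrable lborel (\<lambda>x. (cmod (f x))\<^sup>2 + (cmod (g x))\<^sup>2)"
    using assms by (auto simp: square_integrable_def)
  have "cmod (f x * g x) \<le> (cmod (f x))\<^sup>2 + (cmod (g x))\<^sup>2" for x
    using sum_squares_bound[of "cmod (f x)" "cmod (g x)"] mult_nonneg_nonneg[OF norm_ge_zero[of "f x"] norm_ge_zero[of "g x"]]
    unfolding norm_mult by linarith
  then show "AE x in lborel. cmod (f x * g x) \<le> norm ((cmod (f x))\<^sup>2 + (cmod (g x))\<^sup>2)"
    by (smt (verit) AE_I2 real_norm_def)
qed (use assms in measurable)

lemma Cauchy_Schwarz_integral:
  assumes f: "square_integrable f" and g: "square_integrable g"
  shows "(LINT x|lborel. cmod (f x * g x)) \<le> L2_norm f * L2_norm g"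
proof -
  define I where "I = (LINT x|lborel. cmod (f x * g x))"
  have i: "integrable lborel (\<lambda>x. cmod (f x * g x))"
    using Cauchy_Schwarz_integrable[OF assms] by auto
  have fg: "integrable lborel (\<lambda>x. (cmod (f x))\<^sup>2)" "integrable lborel (\<lambda>x. (cmod (g x))\<^sup>2)"
    using assms by (auto simp: square_integrable_def)
  \<comment> \<open>the quadratic polynomial \<open>\<parallel>s |f| - |g|\<parallel>\<^sup>2\<close> in \<open>s\<close> is nonnegative\<close>
  have q: "0 \<le> s\<^sup>2 * (L2_norm f)\<^sup>2 - 2 * s * I + (L2_norm g)\<^sup>2" for s
  proof -
    have "0 \<le> (LINT x|lborel. (s * cmod (f x) - cmod (g x))\<^sup>2)" by simp
    also have "\<dots> = (LINT x|lborel. s\<^sup>2 * (cmod (f x))\<^sup>2 - 2 * s * cmod (f x * g x) + (cmod (g x))\<^sup>2)"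
      by (intro Bochner_Integration.integral_cong) (auto simp: power2_diff power_mult_distrib norm_mult)
    also have "\<dots> = s\<^sup>2 * (L2_norm f)\<^sup>2 - 2 * s * I + (L2_norm g)\<^sup>2"
      using i fg by (simp add: L2_norm_power2 I_def)
    finally show ?thesis .
  qed
  have I0: "0 \<le> I" by (simp add: I_def)
  show ?thesis
  proof (cases "L2_norm f = 0")
    case True
    have "I = 0"
    proof (rule ccontr)
      assume "I \<noteq> 0"
      with q[of "((L2_norm g)\<^sup>2 + 1) / (2 * I)"] True show False by simp
    qed
    with True show ?thesis by (simp add: I_def)
  next
    case False
    with L2_norm_nonneg[of f] have "0 < L2_norm f" by simp
    with q[of "I / (L2_norm f)\<^sup>2"] have "I\<^sup>2 \<le> (L2_norm f)\<^sup>2 * (L2_norm g)\<^sup>2"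
      by (simp add: field_simps power2_eq_square)
    then have "I\<^sup>2 \<le> (L2_norm f * L2_norm g)\<^sup>2" by (simp add: power_mult_distrib)
    then have "I \<le> L2_norm f * L2_norm g"
      by (rule power2_le_imp_le) (simp add: L2_norm_nonneg)
    then show ?thesis by (simp add: I_def)
  qed
qed

lemma Cauchy_Schwarz_norm_integral:
  assumes f: "square_integrable f" and g: "square_integrable g"
  shows "cmod (LINT x|lborel. f x * g x) \<le> L2_norm f * L2_norm g"
  using Cauchy_Schwarz_integral[OF assms] integral_norm_bound[of lborel "\<lambda>x. f x * g x"] by linarith

lemma L2_norm_triangle:
  assumes f: "square_integrable f" and g: "square_integrable g"
  shows "L2_norm (\<lambda>x. f x + g x) \<le> L2_norm f + L2_norm g"
proof (rule power2_le_imp_le)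
  have i: "integrable lborel (\<lambda>x. cmod (f x * g x))"
    using Cauchy_Schwarz_integrable[OF assms] by auto
  have fg: "integrable lborel (\<lambda>x. (cmod (f x))\<^sup>2)" "integrable lborel (\<lambda>x. (cmod (g x))\<^sup>2)"
    using assms by (auto simp: square_integrable_def)
  have fg2: "integrable lborel (\<lambda>x. (cmod (f x + g x))\<^sup>2)"
    using square_integrable_add[OF assms] by (auto simp: square_integrable_def)
  have "(L2_norm (\<lambda>x. f x + g x))\<^sup>2 \<le> (LINT x|lborel. (cmod (f x))\<^sup>2 + 2 * cmod (f x * g x) + (cmod (g x))\<^sup>2)"
    unfolding L2_norm_power2
  proof (intro integral_mono fg2)
    fix x
    have "(cmod (f x + g x))\<^sup>2 \<le> (cmod (f x) + cmod (g x))\<^sup>2"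
      by (intro power_mono norm_triangle_ineq) auto
    then show "(cmod (f x + g x))\<^sup>2 \<le> (cmod (f x))\<^sup>2 + 2 * cmod (f x * g x) + (cmod (g x))\<^sup>2"
      by (simp add: power2_sum norm_mult)
  qed (use i fg in auto)
  also have "\<dots> \<le> (L2_norm f)\<^sup>2 + 2 * (L2_norm f * L2_norm g) + (L2_norm g)\<^sup>2"
    using Cauchy_Schwarz_integral[OF assms] i fg by (simp add: L2_norm_power2)
  finally show "(L2_norm (\<lambda>x. f x + g x))\<^sup>2 \<le> (L2_norm f + L2_norm g)\<^sup>2"
    by (simp add: power2_sum)
qed (simp add: L2_norm_nonneg)

lemma L2_norm_diff_ge:
  assumes f: "square_integrable f" and g: "square_integrable g"
  shows "\<bar>L2_norm f - L2_norm g\<bar> \<le> L2_norm (\<lambda>x. f x - g x)"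
  using L2_norm_triangle[OF square_integrable_diff[OF f g] g]
    L2_norm_triangle[OF square_integrable_diff[OF g f] f] L2_norm_minus_commute[of f g]
  by simp

lemma L2_norm_dominated_tendsto_0:
  fixes f :: "nat \<Rightarrow> 'a::euclidean_space \<Rightarrow> complex"
  assumes [measurable]: "\<And>k. f k \<in> borel_measurable borel" and w: "integrable lborel w"
    and lim: "AE x in lborel. (\<lambda>k. f k x) \<longlonglongrightarrow> 0"
    and bd: "\<And>k. AE x in lborel. (cmod (f k x))\<^sup>2 \<le> w x"
  shows "(\<lambda>k::nat. L2_norm (f k)) \<longlonglongrightarrow> 0"
proof -
  have "(\<lambda>k. LINT x|lborel. (cmod (f k x))\<^sup>2) \<longlonglongrightarrow> (LINT x|(lborel::'a measure). (0::real))"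
  proof (rule integral_dominated_convergence[OF _ _ w])
    show "AE x in lborel. (\<lambda>k. (cmod (f k x))\<^sup>2) \<longlonglongrightarrow> 0"
      using lim by eventually_elim (auto intro!: tendsto_eq_intros)
  qed (use bd in auto)
  then show ?thesis
    unfolding L2_norm_def by (auto intro!: tendsto_eq_intros)
qed

section \<open>Gaussian densities\<close>

text \<open>Lebesgue measure on a Euclidean space is the image of the product of one-dimensional ones, so
  integrals of products of functions of single coordinates factor.  This reduces Gaussian integrals,
  and the integrability of Schwartz functions, to the real line.\<close>

lemma
  fixes f :: "'a::euclidean_space \<Rightarrow> real \<Rightarrow> 'b::{real_normed_field,banach,second_countable_topology}"
  assumes f: "\<And>b. b \<in> Basis \<Longrightarrow> integrable lborel (f b)"
  shows integrable_lborel_Basis_prod: "integrable lborel (\<lambda>x. \<Prod>b\<in>Basis. f b (x \<bullet> b))"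
    and integral_lborel_Basis_prod:
      "(LINT x|lborel. (\<Prod>b\<in>Basis. f b (x \<bullet> b))) = (\<Prod>b\<in>Basis. LINT x|lborel. f b x)"
proof -
  interpret product_sigma_finite "\<lambda>_::'a. lborel :: real measure" ..
  have fm: "f b \<in> borel_measurable borel" if "b \<in> Basis" for b
    using borel_measurable_integrable[OF f[OF that]] by simp
  have m: "(\<lambda>x. \<Prod>b\<in>Basis. f b (x \<bullet> b)) \<in> borel_measurable borel"
    by (intro borel_measurable_prod measurable_compose[OF _ fm]) measurable
  have [measurable]: "(\<lambda>g. \<Sum>b\<in>Basis. g b *\<^sub>R b) \<in> (\<Pi>\<^sub>M b\<in>(Basis::'a set). lborel) \<rightarrow>\<^sub>M borel"
    by measurable
  have e: "(\<Prod>b\<in>Basis. f b ((\<Sum>b\<in>Basis. g b *\<^sub>R b) \<bullet> b)) = (\<Prod>b\<in>Basis. f b (g b))" for g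
    by (intro prod.cong) auto
  have "integrable (\<Pi>\<^sub>M b\<in>(Basis::'a set). lborel) (\<lambda>g. \<Prod>b\<in>Basis. f b (g b))"
    by (rule product_integrable_prod) (auto intro: f)
  then show "integrable lborel (\<lambda>x. \<Prod>b\<in>Basis. f b (x \<bullet> b))"
    by (subst lborel_eq, subst integrable_distr_eq) (auto simp: e m)
  have "(LINT g|(\<Pi>\<^sub>M b\<in>(Basis::'a set). lborel). (\<Prod>b\<in>Basis. f b (g b))) = (\<Prod>b\<in>Basis. LINT x|lborel. f b x)"
    by (rule product_integral_prod) (auto intro: f)
  then show "(LINT x|lborel. (\<Prod>b\<in>Basis. f b (x \<bullet> b))) = (\<Prod>b\<in>Basis. LINT x|lborel. f b x)"
    by (subst lborel_eq, subst integral_distr) (auto simp: e m)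
qed

definition gauss :: "real \<Rightarrow> 'a::euclidean_space \<Rightarrow> real" where
  "gauss s x = (\<Prod>b\<in>Basis. normal_density 0 s (x \<bullet> b))"

lemma gauss_nonneg: "0 \<le> gauss s x"
  by (auto simp: gauss_def intro!: prod_nonneg)

lemma norm_power2_Basis: "(norm (x::'a::euclidean_space))\<^sup>2 = (\<Sum>b\<in>Basis. (x \<bullet> b)\<^sup>2)"
  unfolding power2_norm_eq_inner by (subst euclidean_inner) (simp add: power2_eq_square)

lemma gauss_eq:
  assumes "s > 0"
  shows "gauss s (x::'a::euclidean_space) = (1 / sqrt (2 * pi * s\<^sup>2)) ^ DIM('a) * exp (- (norm x)\<^sup>2 / (2 * s\<^sup>2))"
proof -
  have "gauss s x = (\<Prod>b\<in>(Basis::'a set). 1 / sqrt (2 * pi * s\<^sup>2)) * (\<Prod>b\<in>Basis. exp (- (x \<bullet> b)\<^sup>2 / (2 * s\<^sup>2)))"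
    unfolding gauss_def normal_density_def by (subst prod.distrib[symmetric]) simp
  also have "(\<Prod>b\<in>Basis. exp (- (x \<bullet> b)\<^sup>2 / (2 * s\<^sup>2))) = exp (- (norm x)\<^sup>2 / (2 * s\<^sup>2))"
    by (subst exp_sum[symmetric]) (simp_all add: norm_power2_Basis sum_divide_distrib sum_negf)
  finally show ?thesis by simp
qed

lemma gauss_measurable [measurable]: "gauss s \<in> borel_measurable borel"
  unfolding gauss_def by measurable

lemma
  assumes "s > 0"
  shows integrable_gauss: "integrable lborel (gauss s :: 'a::euclidean_space \<Rightarrow> real)"
    and integral_gauss: "(LINT x|lborel. gauss s (x::'a)) = 1"
  using integrable_lborel_Basis_prod[of "\<lambda>_::'a. normal_density 0 s"]
    integral_lborel_Basis_prod[of "\<lambda>_::'a. normal_density 0 s"] assms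
  by (auto simp: gauss_def[abs_def] integrable_normal_density integral_normal_density)

lemma integrable_exp_neg_power2:
  assumes "a > 0"
  shows "integrable lborel (\<lambda>x::'a::euclidean_space. exp (- a * (norm x)\<^sup>2))"
proof -
  define s where "s = sqrt (1 / (2 * a))"
  have s: "s > 0" and s2: "2 * s\<^sup>2 = 1 / a" using assms by (auto simp: s_def)
  have "integrable lborel (\<lambda>x::'a. gauss s x / (1 / sqrt (2 * pi * s\<^sup>2)) ^ DIM('a))"
    using integrable_gauss[OF s] by auto
  also have "(\<lambda>x::'a. gauss s x / (1 / sqrt (2 * pi * s\<^sup>2)) ^ DIM('a)) = (\<lambda>x. exp (- a * (norm x)\<^sup>2))"
    using s assms by (auto simp: gauss_eq s2 field_simps)
  finally show ?thesis .
qed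

text \<open>A rescaling of the characteristic function of the standard normal distribution.\<close>

lemma gauss_integral_cis_real:
  fixes s z :: real
  assumes s: "s > 0"
  shows "integrable lborel (\<lambda>x. exp (- s\<^sup>2 * x\<^sup>2 / 2) *\<^sub>R cis (x * z))" (is "integrable lborel ?f")
    and "(LINT x|lborel. exp (- s\<^sup>2 * x\<^sup>2 / 2) *\<^sub>R cis (x * z)) = of_real (2 * pi * normal_density 0 s z)"
proof -
  have d: "exp (- s\<^sup>2 * x\<^sup>2 / 2) = sqrt (2 * pi) * std_normal_density (0 + s * x)" for x
    by (simp add: std_normal_density_def power_mult_distrib)
  have i: "integrable lborel (\<lambda>x. std_normal_density x *\<^sub>R cis (x * (z / s)))"
  proof (rule Bochner_Integration.integrable_bound)
    show "integrable lborel std_normal_density" by (rule integrable_normal_density) simp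
    show "(\<lambda>x. std_normal_density x *\<^sub>R cis (x * (z / s))) \<in> borel_measurable lborel"
      unfolding cis_conv_exp by measurable
  qed auto
  have e: "?f x = sqrt (2 * pi) *\<^sub>R (std_normal_density (0 + s * x) *\<^sub>R cis ((0 + s * x) * (z / s)))" for x
    using s unfolding d by simp
  show "integrable lborel ?f"
    unfolding e using s by (intro integrable_scaleR_right lborel_integrable_real_affine[OF i, of s 0]) blast
  have "exp (- ((z / s)^2) / 2) = char std_normal_distribution (z / s)"
    by (simp add: char_std_normal_distribution)
  also have "\<dots> = (LINT x|lborel. std_normal_density x *\<^sub>R cis (x * (z / s)))"
    unfolding char_def
    by (subst integral_density) (auto simp: cis_conv_exp mult_ac normal_density_nonneg
       intro!: borel_measurable_continuous_onI continuous_intros)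
  also have "\<dots> = s *\<^sub>R (LINT x|lborel. std_normal_density (0 + s * x) *\<^sub>R cis ((0 + s * x) * (z / s)))"
    using s by (subst lborel_integral_real_affine[of s _ 0]) auto
  finally have *: "(LINT x|lborel. std_normal_density (0 + s * x) *\<^sub>R cis ((0 + s * x) * (z / s))) =
      of_real (exp (- ((z / s)^2) / 2) / s)"
    using s by (simp add: scaleR_conv_of_real field_simps)
  have "sqrt (2 * pi) * (exp (- ((z / s)^2) / 2) / s) = 2 * pi * normal_density 0 s z"
    using s by (simp add: normal_density_def real_sqrt_mult power_divide field_simps)
  then show "(LINT x|lborel. ?f x) = of_real (2 * pi * normal_density 0 s z)"
    unfolding e integral_scaleR_right * by (simp only: scaleR_conv_of_real flip: of_real_mult)
qed

lemma cis_inner: "cis (x \<bullet> z) = (\<Prod>b\<in>Basis. cis ((x \<bullet> b) * (z \<bullet> b)))"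
  by (subst euclidean_inner) (simp add: cis_conv_exp exp_sum sum_distrib_left)

lemma gauss_integral_cis:
  fixes z :: "'a::euclidean_space"
  assumes s: "s > 0"
  shows "integrable lborel (\<lambda>x. exp (- s\<^sup>2 * (norm x)\<^sup>2 / 2) *\<^sub>R cis (x \<bullet> z))"
    and "(LINT x|lborel. exp (- s\<^sup>2 * (norm x)\<^sup>2 / 2) *\<^sub>R cis (x \<bullet> z)) = of_real ((2 * pi) ^ DIM('a) * gauss s z)"
proof -
  have e: "exp (- s\<^sup>2 * (norm x)\<^sup>2 / 2) *\<^sub>R cis (x \<bullet> z) =
     (\<Prod>b\<in>Basis. exp (- s\<^sup>2 * (x \<bullet> b)\<^sup>2 / 2) *\<^sub>R cis ((x \<bullet> b) * (z \<bullet> b)))" for x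
  proof -
    have "exp (- s\<^sup>2 * (norm x)\<^sup>2 / 2) = (\<Prod>b\<in>Basis. exp (- s\<^sup>2 * (x \<bullet> b)\<^sup>2 / 2))"
      by (subst exp_sum[symmetric])
        (simp_all add: norm_power2_Basis sum_divide_distrib sum_distrib_left sum_negf)
    then show ?thesis
      by (simp add: cis_inner scaleR_conv_of_real prod.distrib)
  qed
  show "integrable lborel (\<lambda>x. exp (- s\<^sup>2 * (norm x)\<^sup>2 / 2) *\<^sub>R cis (x \<bullet> z))"
    unfolding e by (rule integrable_lborel_Basis_prod) (rule gauss_integral_cis_real[OF s])
  show "(LINT x|lborel. exp (- s\<^sup>2 * (norm x)\<^sup>2 / 2) *\<^sub>R cis (x \<bullet> z)) = of_real ((2 * pi) ^ DIM('a) * gauss s z)"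
    unfolding e
    by (subst integral_lborel_Basis_prod, rule gauss_integral_cis_real[OF s])
      (simp add: gauss_integral_cis_real(2)[OF s, simplified] gauss_def prod.distrib)
qed

section \<open>Translations and dilations\<close>

lemma
  fixes f :: "'a::euclidean_space \<Rightarrow> 'b::{banach,second_countable_topology}"
  assumes f[measurable]: "f \<in> borel_measurable borel"
  shows integrable_translate_iff: "integrable lborel (\<lambda>x. f (x + z)) \<longleftrightarrow> integrable lborel f"
    and integral_translate: "(LINT x|lborel. f (x + z)) = (LINT x|lborel. f x)"
proof -
  have d: "lborel = distr lborel borel ((+) z)"
    by (rule lborel_distr_plus[symmetric])
  show "integrable lborel (\<lambda>x. f (x + z)) \<longleftrightarrow> integrable lborel f"
    by (subst (2) d, subst integrable_distr_eq) (simp_all add: add.commute)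
  show "(LINT x|lborel. f (x + z)) = (LINT x|lborel. f x)"
    by (subst (2) d, subst integral_distr) (simp_all add: add.commute)
qed

lemma square_integrable_translate:
  "square_integrable f \<Longrightarrow> square_integrable (\<lambda>x. f (x + z))"
  unfolding square_integrable_def
  by (auto simp: integrable_translate_iff[of "\<lambda>x. (cmod (f x))\<^sup>2"])

lemma L2_norm_translate: "f \<in> borel_measurable borel \<Longrightarrow> L2_norm (\<lambda>x. f (x + z)) = L2_norm f"
  unfolding L2_norm_def
  by (subst integral_translate[of "\<lambda>x. (cmod (f x))\<^sup>2"]) auto

lemma
  fixes f :: "'a::euclidean_space \<Rightarrow> 'b::{banach,second_countable_topology}"
  assumes f[measurable]: "f \<in> borel_measurable borel" and s: "s > 0"
  shows integrable_dilate_iff: "integrable lborel (\<lambda>x. f (s *\<^sub>R x)) \<longleftrightarrow> integrable lborel f"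
    and integral_dilate: "(LINT x|lborel. f x) = s ^ DIM('a) *\<^sub>R (LINT x|lborel. f (s *\<^sub>R x))"
proof -
  have d: "lborel = density (distr lborel borel (\<lambda>x::'a. s *\<^sub>R x)) (\<lambda>_. ennreal (s ^ DIM('a)))"
    using lborel_affine[of s "0::'a"] s by simp
  have "integrable lborel f \<longleftrightarrow> integrable lborel (\<lambda>x. s ^ DIM('a) *\<^sub>R f (s *\<^sub>R x))"
    using s by (subst d, subst integrable_density) (auto simp: integrable_distr_eq)
  also have "\<dots> \<longleftrightarrow> integrable lborel (\<lambda>x. f (s *\<^sub>R x))"
    using s integrable_scaleR_right[of "1 / s ^ DIM('a)" lborel "\<lambda>x. s ^ DIM('a) *\<^sub>R f (s *\<^sub>R x)"]
    by auto
  finally show "integrable lborel (\<lambda>x. f (s *\<^sub>R x)) \<longleftrightarrow> integrable lborel f" ..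
  show "(LINT x|lborel. f x) = s ^ DIM('a) *\<^sub>R (LINT x|lborel. f (s *\<^sub>R x))"
    using s by (subst d, subst integral_density) (auto simp: integral_distr)
qed

lemma integrable_indicator_cball: "integrable lborel (\<lambda>x. c * indicator (cball a r) x :: real)"
  by (intro integrable_mult_right integrable_real_indicator) (use emeasure_lborel_cball_finite in auto)

text \<open>Continuous functions of compact support are dense in \<open>L\<^sup>2\<close>.  After truncating \<open>f\<close> in height and in
  support, it is an almost everywhere limit of continuous functions; these are made uniformly bounded
  by the retraction \<open>\<phi>\<close> onto a disc and compactly supported by the cut-off \<open>\<theta>\<close>, both of which fix the
  truncated function, and then dominated convergence applies.\<close>

lemma square_integrable_approx_continuous:
  fixes f :: "'a::euclidean_space \<Rightarrow> complex"
  assumes f: "square_integrable f" and "e > 0"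
  obtains g R M where "continuous_on UNIV g" "\<And>x. norm x > R \<Longrightarrow> g x = 0" "\<And>x. cmod (g x) \<le> M"
    "square_integrable g" "L2_norm (\<lambda>x. f x - g x) < e"
proof -
  have [measurable]: "f \<in> borel_measurable borel" using f by measurable
  define F where "F k x = (if norm x \<le> real (Suc k) \<and> cmod (f x) \<le> real (Suc k) then f x else 0)" for k x
  have [measurable]: "F k \<in> borel_measurable borel" for k
    unfolding F_def by measurable
  have "(\<lambda>k. L2_norm (\<lambda>x. f x - F k x)) \<longlonglongrightarrow> 0"
  proof (rule L2_norm_dominated_tendsto_0)
    show "integrable lborel (\<lambda>x. (cmod (f x))\<^sup>2)" using f by (simp add: square_integrable_def)
    show "AE x in lborel. (\<lambda>k. f x - F k x) \<longlonglongrightarrow> 0"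
    proof (rule AE_I2, rule tendsto_eventually)
      fix x
      obtain n where n: "max (norm x) (cmod (f x)) \<le> real n" using real_arch_simple by blast
      show "\<forall>\<^sub>F k in sequentially. f x - F k x = 0"
        using eventually_ge_at_top[of n] by eventually_elim (use n in \<open>auto simp: F_def\<close>)
    qed
  qed (auto simp: F_def)
  then have "\<forall>\<^sub>F k in sequentially. L2_norm (\<lambda>x. f x - F k x) < e / 2"
    using \<open>e > 0\<close> by (intro order_tendstoD) auto
  then obtain k where k: "L2_norm (\<lambda>x. f x - F k x) < e / 2"
    by (auto simp: eventually_sequentially)
  define K where "K = real (Suc k)"
  have K: "K \<ge> 1" by (simp add: K_def)
  have "F k measurable_on UNIV"
    by (rule lebesgue_measurable_imp_measurable_on) (auto intro: measurable_completion)
  then obtain N h where N: "negligible N" and h: "\<And>n. continuous_on UNIV (h n)"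
    and lim: "\<And>x. x \<notin> N \<Longrightarrow> (\<lambda>n. h n x) \<longlonglongrightarrow> F k x"
    by (auto simp: measurable_on_def)
  have "AE x in lebesgue. x \<notin> N"
    using N by (intro AE_not_in) (simp add: negligible_iff_null_sets)
  then have AE: "AE x in lborel. x \<notin> N" by (simp add: AE_completion_iff)
  define \<phi> where "\<phi> z = z / of_real (max 1 (cmod z / K))" for z
  define \<theta> where "\<theta> x = max 0 (min 1 (K + 1 - norm x))" for x :: 'a
  define G where "G n x = of_real (\<theta> x) * \<phi> (h n x)" for n x
  have \<phi>c: "continuous_on UNIV \<phi>"
    unfolding \<phi>_def using K by (intro continuous_intros) (auto simp: max_def)
  have Gc: "continuous_on UNIV (G n)" for n
    unfolding G_def \<theta>_def
    by (intro continuous_intros continuous_on_compose2[OF \<phi>c h]) auto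
  have \<phi>b: "cmod (\<phi> z) \<le> K" for z
    using K by (auto simp: \<phi>_def norm_divide max_def field_simps)
  have \<theta>b: "0 \<le> \<theta> x" "\<theta> x \<le> 1" for x by (auto simp: \<theta>_def)
  have Gb: "cmod (G n x) \<le> K" for n x
    using mult_mono[OF \<theta>b(2)[of x] \<phi>b[of "h n x"]] \<theta>b[of x] by (simp add: G_def norm_mult)
  have G0: "G n x = 0" if "norm x > K + 1" for n x
    using that by (simp add: G_def \<theta>_def)
  have Fb: "cmod (F k x) \<le> K" for x by (auto simp: F_def K_def)
  have F0: "F k x = 0" if "norm x > K" for x using that by (auto simp: F_def K_def)
  have [measurable]: "G n \<in> borel_measurable borel" for n
    using Gc by (rule borel_measurable_continuous_onI)
  have "(\<lambda>n. L2_norm (\<lambda>x. F k x - G n x)) \<longlonglongrightarrow> 0"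
  proof (rule L2_norm_dominated_tendsto_0)
    show "integrable lborel (\<lambda>x::'a. (2 * K)\<^sup>2 * indicator (cball 0 (K + 1)) x)"
      by (rule integrable_indicator_cball)
    show "AE x in lborel. (\<lambda>n. F k x - G n x) \<longlonglongrightarrow> 0"
      using AE
    proof eventually_elim
      case (elim x)
      have "(\<lambda>n. \<phi> (h n x)) \<longlonglongrightarrow> \<phi> (F k x)"
        using \<phi>c lim[OF elim] by (auto simp: continuous_on_eq_continuous_at intro: isCont_tendsto_compose)
      also have "\<phi> (F k x) = F k x"
        using Fb[of x] K by (simp add: \<phi>_def max_def field_simps)
      finally have "(\<lambda>n. F k x - G n x) \<longlonglongrightarrow> F k x - of_real (\<theta> x) * F k x"
        unfolding G_def by (intro tendsto_intros)
      also have "F k x - of_real (\<theta> x) * F k x = 0"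
        using F0[of x] by (cases "norm x \<le> K") (auto simp: \<theta>_def)
      finally show ?case .
    qed
    show "AE x in lborel. (cmod (F k x - G n x))\<^sup>2 \<le> (2 * K)\<^sup>2 * indicator (cball 0 (K + 1)) x" for n
    proof (rule AE_I2)
      fix x
      have "(cmod (F k x - G n x))\<^sup>2 \<le> (2 * K)\<^sup>2"
        using norm_triangle_ineq4[of "F k x" "G n x"] Fb[of x] Gb[of n x] by (intro power_mono) auto
      then show "(cmod (F k x - G n x))\<^sup>2 \<le> (2 * K)\<^sup>2 * indicator (cball 0 (K + 1)) x"
        using F0[of x] G0[of x n] by (auto simp: indicator_def)
    qed
  qed measurable
  then have "\<forall>\<^sub>F n in sequentially. L2_norm (\<lambda>x. F k x - G n x) < e / 2"
    using \<open>e > 0\<close> by (intro order_tendstoD) auto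
  then obtain n where n: "L2_norm (\<lambda>x. F k x - G n x) < e / 2"
    by (auto simp: eventually_sequentially)
  have F2: "square_integrable (F k)"
    by (rule square_integrable_dominated(1)[where h = "\<lambda>x. (cmod (f x))\<^sup>2"])
      (use f in \<open>auto simp: square_integrable_def F_def\<close>)
  have G2: "square_integrable (G n)"
  proof (rule square_integrable_dominated(1)[where h = "\<lambda>x. K\<^sup>2 * indicator (cball 0 (K + 1)) x"])
    show "AE x in lborel. (cmod (G n x))\<^sup>2 \<le> K\<^sup>2 * indicator (cball 0 (K + 1)) x"
      using G0[of _ n] Gb[of n] by (intro AE_I2) (auto simp: indicator_def intro: power_mono)
    show "integrable lborel (\<lambda>x::'a. K\<^sup>2 * indicator (cball 0 (K + 1)) x)"
      by (rule integrable_indicator_cball)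
  qed measurable
  have "L2_norm (\<lambda>x. f x - G n x) \<le> L2_norm (\<lambda>x. f x - F k x) + L2_norm (\<lambda>x. F k x - G n x)"
    using L2_norm_triangle[OF square_integrable_diff[OF f F2] square_integrable_diff[OF F2 G2]] by simp
  also have "\<dots> < e" using k n by simp
  finally show thesis
    using that[of "G n" "K + 1" K] Gc Gb G0 G2 by blast
qed

text \<open>Translation is continuous in \<open>L\<^sup>2\<close>: it is for continuous functions of compact support, by
  dominated convergence, and translations are isometries.\<close>

lemma L2_norm_translation_tendsto_0:
  fixes f :: "'a::euclidean_space \<Rightarrow> complex"
  assumes f: "square_integrable f" and z: "z \<longlonglongrightarrow> 0"
  shows "(\<lambda>k. L2_norm (\<lambda>x. f (x + z k) - f x)) \<longlonglongrightarrow> 0"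
proof (rule LIMSEQ_I)
  fix e :: real assume e: "e > 0"
  then obtain g R M where g: "continuous_on UNIV g" "\<And>x. norm x > R \<Longrightarrow> g x = 0" "\<And>x. cmod (g x) \<le> M"
    "square_integrable g" "L2_norm (\<lambda>x. f x - g x) < e / 3"
    using square_integrable_approx_continuous[OF f, of "e / 3"] by (metis zero_less_divide_iff zero_less_numeral)
  have [measurable]: "f \<in> borel_measurable borel" "g \<in> borel_measurable borel" using f g(4) by measurable
  have z': "(\<lambda>k. norm (z k)) \<longlonglongrightarrow> 0" using z by (rule tendsto_norm_zero)
  obtain B where B: "\<And>k. norm (z k) \<le> B"
    using convergent_imp_Bseq[of z] z by (auto simp: convergent_def Bseq_def)
  have "(\<lambda>k. L2_norm (\<lambda>x. g (x + z k) - g x)) \<longlonglongrightarrow> 0"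
  proof (rule L2_norm_dominated_tendsto_0)
    show "integrable lborel (\<lambda>x::'a. (2 * M)\<^sup>2 * indicator (cball 0 (R + B)) x)"
      by (rule integrable_indicator_cball)
    have "(\<lambda>k. g (x + z k) - g x) \<longlonglongrightarrow> g (x + 0) - g x" for x
      using g(1) z by (intro tendsto_intros isCont_tendsto_compose[of _ g])
        (auto simp: continuous_on_eq_continuous_at)
    then show "AE x in lborel. (\<lambda>k. g (x + z k) - g x) \<longlonglongrightarrow> 0" by simp
    show "AE x in lborel. (cmod (g (x + z k) - g x))\<^sup>2 \<le> (2 * M)\<^sup>2 * indicator (cball 0 (R + B)) x" for k
    proof (rule AE_I2)
      fix x
      have "(cmod (g (x + z k) - g x))\<^sup>2 \<le> (2 * M)\<^sup>2"
        using norm_triangle_ineq4[of "g (x + z k)" "g x"] g(3)[of x] g(3)[of "x + z k"]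
        by (intro power_mono) auto
      moreover have "g (x + z k) = 0" "g x = 0" if "norm x > R + B"
        using that B[of k] norm_ge_zero[of "z k"] norm_diff_ineq[of x "z k"]
        by (auto intro!: g(2) simp del: norm_ge_zero)
      ultimately show "(cmod (g (x + z k) - g x))\<^sup>2 \<le> (2 * M)\<^sup>2 * indicator (cball 0 (R + B)) x"
        by (cases "norm x > R + B") (auto simp: indicator_def)
    qed
  qed measurable
  then have "\<forall>\<^sub>F k in sequentially. L2_norm (\<lambda>x. g (x + z k) - g x) < e / 3"
    using e by (intro order_tendstoD) auto
  moreover have "L2_norm (\<lambda>x. f (x + z k) - f x) < e" if k: "L2_norm (\<lambda>x. g (x + z k) - g x) < e / 3" for k
  proof -
    have fg: "square_integrable (\<lambda>x. f x - g x)" by (rule square_integrable_diff[OF f g(4)])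
    note fgt = square_integrable_translate[OF fg, of "z k"]
    have gg: "square_integrable (\<lambda>x. g (x + z k) - g x)"
      by (intro square_integrable_diff square_integrable_translate g)
    have gf: "square_integrable (\<lambda>x. g x - f x)" by (rule square_integrable_diff[OF g(4) f])
    have "L2_norm (\<lambda>x. f (x + z k) - f x) =
        L2_norm (\<lambda>x. ((f (x + z k) - g (x + z k)) + (g (x + z k) - g x)) + (g x - f x))"
      by (intro L2_norm_cong) simp
    also have "\<dots> \<le> (L2_norm (\<lambda>x. f (x + z k) - g (x + z k)) + L2_norm (\<lambda>x. g (x + z k) - g x))
         + L2_norm (\<lambda>x. g x - f x)"
      by (intro order_trans[OF L2_norm_triangle] add_right_mono square_integrable_add fgt gg gf L2_norm_triangle)
    also have "L2_norm (\<lambda>x. f (x + z k) - g (x + z k)) = L2_norm (\<lambda>x. f x - g x)"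
      by (rule L2_norm_translate[of "\<lambda>x. f x - g x"]) measurable
    finally show ?thesis using k g(5) L2_norm_minus_commute[of g f] by simp
  qed
  ultimately have "\<forall>\<^sub>F k in sequentially. L2_norm (\<lambda>x. f (x + z k) - f x) < e"
    by (rule eventually_mono)
  then show "\<exists>no. \<forall>k\<ge>no. norm (L2_norm (\<lambda>x. f (x + z k) - f x) - 0) < e"
    by (auto simp: eventually_sequentially L2_norm_nonneg)
qed

section \<open>Gaussian regularisation\<close>

definition gconv :: "real \<Rightarrow> ('a::euclidean_space \<Rightarrow> complex) \<Rightarrow> 'a \<Rightarrow> complex" where
  "gconv s f x = (LINT y|lborel. f y * of_real (gauss s (y - x)))"

lemma gauss_bound: "s > 0 \<Longrightarrow> gauss s (x::'a::euclidean_space) \<le> (1 / sqrt (2 * pi * s\<^sup>2)) ^ DIM('a)"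
  unfolding gauss_eq by (intro mult_left_le) auto

lemma square_integrable_gauss: "s > 0 \<Longrightarrow> square_integrable (\<lambda>x. of_real (gauss s (x - a)))"
proof -
  assume s: "s > 0"
  have "square_integrable (\<lambda>x::'a. of_real (gauss s x))"
  proof (rule square_integrable_dominated(1))
    show "integrable lborel (\<lambda>x::'a. (1 / sqrt (2 * pi * s\<^sup>2)) ^ DIM('a) * gauss s x)"
      by (rule integrable_mult_right) (rule integrable_gauss[OF s])
    show "AE x in lborel. (cmod (of_real (gauss s (x::'a))))\<^sup>2 \<le> (1 / sqrt (2 * pi * s\<^sup>2)) ^ DIM('a) * gauss s x"
      using gauss_bound[OF s] gauss_nonneg by (auto simp: power2_eq_square intro!: mult_right_mono AE_I2)
  qed measurable
  from square_integrable_translate[OF this, of "-a"] show ?thesis by simp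
qed

lemma gconv_measurable:
  assumes [measurable]: "f \<in> borel_measurable borel"
  shows "gconv s f \<in> borel_measurable borel"
  unfolding gconv_def[abs_def] by measurable

text \<open>Jensen's inequality for the probability density \<open>gauss s\<close>, in the form of the Cauchy-Schwarz
  inequality with the weight split evenly between both factors.\<close>

lemma gconv_minus_id_Jensen:
  fixes f :: "'a::euclidean_space \<Rightarrow> complex"
  assumes f: "square_integrable f" and s: "s > 0"
  shows "integrable lborel (\<lambda>z. (cmod (f (x + z) - f x))\<^sup>2 * gauss s z)"
    and "(cmod (gconv s f x - f x))\<^sup>2 \<le> (LINT z|lborel. (cmod (f (x + z) - f x))\<^sup>2 * gauss s z)"
proof -
  have [measurable]: "f \<in> borel_measurable borel" using f by measurable
  define B where "B = (1 / sqrt (2 * pi * s\<^sup>2)) ^ DIM('a)"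
  have fx: "square_integrable (\<lambda>z. f (x + z))"
    using square_integrable_translate[OF f, of x] by (simp add: add.commute)
  note gi = integrable_gauss[OF s, where 'a='a]
  show i: "integrable lborel (\<lambda>z. (cmod (f (x + z) - f x))\<^sup>2 * gauss s z)"
  proof (rule Bochner_Integration.integrable_bound)
    show "integrable lborel (\<lambda>z. 2 * B * (cmod (f (x + z)))\<^sup>2 + 2 * (cmod (f x))\<^sup>2 * gauss s z)"
      using fx gi by (auto simp: square_integrable_def)
    show "AE z in lborel. norm ((cmod (f (x + z) - f x))\<^sup>2 * gauss s z)
       \<le> norm (2 * B * (cmod (f (x + z)))\<^sup>2 + 2 * (cmod (f x))\<^sup>2 * gauss s z)"
    proof (rule AE_I2)
      fix z
      have "(cmod (f (x + z) - f x))\<^sup>2 * gauss s z \<le> (2 * (cmod (f (x + z)))\<^sup>2 + 2 * (cmod (f x))\<^sup>2) * gauss s z"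
        using norm_add_square_le[of "f (x + z)" "- f x"] by (intro mult_right_mono gauss_nonneg) auto
      also have "\<dots> \<le> 2 * B * (cmod (f (x + z)))\<^sup>2 + 2 * (cmod (f x))\<^sup>2 * gauss s z"
        using mult_left_mono[OF gauss_bound[OF s, of z], of "2 * (cmod (f (x + z)))\<^sup>2"]
        by (simp add: B_def algebra_simps)
      finally show "norm ((cmod (f (x + z) - f x))\<^sup>2 * gauss s z)
         \<le> norm (2 * B * (cmod (f (x + z)))\<^sup>2 + 2 * (cmod (f x))\<^sup>2 * gauss s z)"
        using gauss_nonneg[of s z] by simp
    qed
  qed measurable
  define p where "p z = (f (x + z) - f x) * of_real (sqrt (gauss s z))" for z
  define q where "q z = complex_of_real (sqrt (gauss s z))" for z :: 'a
  have [measurable]: "p \<in> borel_measurable borel" "q \<in> borel_measurable borel"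
    unfolding p_def q_def by measurable
  have p2: "(cmod (p z))\<^sup>2 = (cmod (f (x + z) - f x))\<^sup>2 * gauss s z" for z
    by (simp add: p_def norm_mult power_mult_distrib gauss_nonneg)
  have q2: "(cmod (q z))\<^sup>2 = gauss s z" for z
    by (simp add: q_def gauss_nonneg)
  have pi: "square_integrable p" using i by (simp add: square_integrable_def p2)
  have qi: "square_integrable q" using gi by (simp add: square_integrable_def q2)
  have pq: "p z * q z = f (x + z) * of_real (gauss s z) - f x * of_real (gauss s z)" for z
    using gauss_nonneg[of s z] by (simp add: p_def q_def algebra_simps flip: of_real_mult)
  have "(LINT z|lborel. p z * q z) = gconv s f x - f x"
  proof -
    have i1: "integrable lborel (\<lambda>z. f (x + z) * of_real (gauss s z))"
      using Cauchy_Schwarz_integrable[OF fx square_integrable_gauss[OF s, of 0]] by simp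
    have gi': "integrable lborel (\<lambda>z::'a. complex_of_real (gauss s z))"
      using gi by simp
    have "(LINT z|lborel. f (x + z) * of_real (gauss s z)) = gconv s f x"
      unfolding gconv_def
      using integral_translate[of "\<lambda>y. f y * of_real (gauss s (y - x))" x] by (simp add: add.commute)
    moreover have "(LINT z|lborel. f x * complex_of_real (gauss s (z::'a))) = f x"
      using integral_gauss[OF s, where 'a='a] by simp
    ultimately show ?thesis
      unfolding pq using i1 gi' by (subst Bochner_Integration.integral_diff) auto
  qed
  then have "cmod (gconv s f x - f x) \<le> L2_norm p * L2_norm q"
    using Cauchy_Schwarz_norm_integral[OF pi qi] by simp
  also have "L2_norm q = 1"
    unfolding L2_norm_def q2 using integral_gauss[OF s, where 'a='a] by simp
  finally have "(cmod (gconv s f x - f x))\<^sup>2 \<le> (L2_norm p)\<^sup>2"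
    by (intro power_mono) auto
  then show "(cmod (gconv s f x - f x))\<^sup>2 \<le> (LINT z|lborel. (cmod (f (x + z) - f x))\<^sup>2 * gauss s z)"
    unfolding L2_norm_power2 p2 .
qed

text \<open>Gaussians are an approximate identity in \<open>L\<^sup>2\<close>.  By Jensen and Tonelli the squared distance is at most
  the Gaussian average of \<open>w z = \<parallel>f(\<cdot> + z) - f\<parallel>\<^sup>2\<close>, a bounded function tending to \<open>0\<close> at the origin;
  after rescaling the average to a fixed Gaussian, dominated convergence gives the limit.\<close>

lemma gconv_tendsto_L2:
  fixes f :: "'a::euclidean_space \<Rightarrow> complex"
  assumes f: "square_integrable f"
  shows "\<And>s. s > 0 \<Longrightarrow> square_integrable (\<lambda>x. gconv s f x - f x)"
    and "(\<lambda>k. L2_norm (\<lambda>x. gconv (1 / real (Suc k)) f x - f x)) \<longlonglongrightarrow> 0"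
proof -
  have [measurable]: "f \<in> borel_measurable borel" using f by measurable
  have [measurable]: "gconv s f \<in> borel_measurable borel" for s by (rule gconv_measurable) measurable
  define w where "w z = (LINT x|lborel. (cmod (f (x + z) - f x))\<^sup>2)" for z
  have w2: "w z = (L2_norm (\<lambda>x. f (x + z) - f x))\<^sup>2" for z by (simp add: w_def L2_norm_power2)
  have w0: "0 \<le> w z" for z by (simp add: w2)
  have [measurable]: "w \<in> borel_measurable borel" unfolding w_def by measurable
  have ft: "square_integrable (\<lambda>x. f (x + z) - f x)" for z
    by (intro square_integrable_diff square_integrable_translate f)
  have wb: "w z \<le> (2 * L2_norm f)\<^sup>2" for z
  proof -
    have "L2_norm (\<lambda>x. f (x + z) - f x) \<le> L2_norm (\<lambda>x. f (x + z)) + L2_norm (\<lambda>x. - 1 * f x)"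
      using L2_norm_triangle[OF square_integrable_translate[OF f] square_integrable_cmult[OF f, of "-1"], of z] by simp
    also have "\<dots> = 2 * L2_norm f"
      unfolding L2_norm_cmult by (simp add: L2_norm_translate)
    finally show ?thesis unfolding w2 by (intro power_mono) (auto simp: L2_norm_nonneg)
  qed
  have gw: "integrable lborel (\<lambda>z. w z * gauss s z)" if s: "s > 0" for s
  proof (rule Bochner_Integration.integrable_bound)
    show "integrable lborel (\<lambda>z::'a. (2 * L2_norm f)\<^sup>2 * gauss s z)"
      using integrable_gauss[OF s] by auto
    show "AE z in lborel. norm (w z * gauss s z) \<le> norm ((2 * L2_norm f)\<^sup>2 * gauss s z)"
      using wb w0 gauss_nonneg[of s] by (auto simp: abs_mult intro!: mult_right_mono)
  qed measurable
  have nn: "(\<integral>\<^sup>+x. ennreal ((cmod (gconv s f x - f x))\<^sup>2) \<partial>lborel) \<le> ennreal (LINT z|lborel. w z * gauss s z)"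
    if s: "s > 0" for s
  proof -
    have "(\<integral>\<^sup>+x. ennreal ((cmod (gconv s f x - f x))\<^sup>2) \<partial>lborel) \<le>
        (\<integral>\<^sup>+x. \<integral>\<^sup>+z. ennreal ((cmod (f (x + z) - f x))\<^sup>2 * gauss s z) \<partial>lborel \<partial>lborel)"
    proof (rule nn_integral_mono)
      fix x
      have "ennreal ((cmod (gconv s f x - f x))\<^sup>2) \<le> ennreal (LINT z|lborel. (cmod (f (x + z) - f x))\<^sup>2 * gauss s z)"
        by (intro ennreal_leI gconv_minus_id_Jensen f s)
      also have "\<dots> = (\<integral>\<^sup>+z. ennreal ((cmod (f (x + z) - f x))\<^sup>2 * gauss s z) \<partial>lborel)"
        by (rule nn_integral_eq_integral[symmetric]) (auto intro: gconv_minus_id_Jensen f s simp: gauss_nonneg)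
      finally show "ennreal ((cmod (gconv s f x - f x))\<^sup>2) \<le> \<dots>" .
    qed
    also have "\<dots> = (\<integral>\<^sup>+z. \<integral>\<^sup>+x. ennreal ((cmod (f (x + z) - f x))\<^sup>2 * gauss s z) \<partial>lborel \<partial>lborel)"
      by (rule lborel_pair.Fubini') measurable
    also have "\<dots> = (\<integral>\<^sup>+z. ennreal (w z * gauss s z) \<partial>lborel)"
    proof (rule nn_integral_cong)
      fix z
      have "(\<integral>\<^sup>+x. ennreal ((cmod (f (x + z) - f x))\<^sup>2) \<partial>lborel) = ennreal (w z)"
        unfolding w_def using ft[of z] by (intro nn_integral_eq_integral) (auto simp: square_integrable_def)
      then show "(\<integral>\<^sup>+x. ennreal ((cmod (f (x + z) - f x))\<^sup>2 * gauss s z) \<partial>lborel) = ennreal (w z * gauss s z)"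
        by (simp add: ennreal_mult' w0 gauss_nonneg nn_integral_multc)
    qed
    also have "\<dots> = ennreal (LINT z|lborel. w z * gauss s z)"
      by (rule nn_integral_eq_integral) (auto simp: gw s w0 gauss_nonneg)
    finally show ?thesis .
  qed
  show sq: "square_integrable (\<lambda>x. gconv s f x - f x)" if "s > 0" for s
    unfolding square_integrable_def
  proof (intro conjI integrableI_bounded)
    show "(\<integral>\<^sup>+x. ennreal (norm ((cmod (gconv s f x - f x))\<^sup>2)) \<partial>lborel) < \<infinity>"
      using le_less_trans[OF nn[OF that]] by simp
  qed measurable
  have bd: "(L2_norm (\<lambda>x. gconv s f x - f x))\<^sup>2 \<le> (LINT z|lborel. w z * gauss s z)" if s: "s > 0" for s
  proof -
    have "ennreal ((L2_norm (\<lambda>x. gconv s f x - f x))\<^sup>2) = (\<integral>\<^sup>+x. ennreal ((cmod (gconv s f x - f x))\<^sup>2) \<partial>lborel)"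
      unfolding L2_norm_power2 using sq[OF s]
      by (intro nn_integral_eq_integral[symmetric]) (auto simp: square_integrable_def)
    also note nn[OF s]
    finally show ?thesis
      by (subst (asm) ennreal_le_iff) (auto intro!: integral_nonneg_AE simp: w0 gauss_nonneg)
  qed
  have sc: "(LINT z|lborel. w z * gauss s z) = (LINT z|lborel. w (s *\<^sub>R z) * gauss 1 z)" if s: "s > 0" for s
  proof -
    have "s ^ DIM('a) * gauss s (s *\<^sub>R z) = gauss 1 z" for z :: 'a
      using s by (simp add: gauss_eq real_sqrt_mult power_mult_distrib power_divide field_simps)
    then have "s ^ DIM('a) * (w (s *\<^sub>R z) * gauss s (s *\<^sub>R z)) = w (s *\<^sub>R z) * gauss 1 z" for z
      by (simp add: algebra_simps)
    then have "(\<lambda>z. s ^ DIM('a) * (w (s *\<^sub>R z) * gauss s (s *\<^sub>R z))) = (\<lambda>z. w (s *\<^sub>R z) * gauss 1 z)"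
      by blast
    then show ?thesis
      by (subst integral_dilate[OF _ s]) (simp_all only: real_scaleR_def integral_mult_right_zero[symmetric], measurable)
  qed
  have lim: "(\<lambda>k. LINT z|lborel. w ((1 / real (Suc k)) *\<^sub>R z) * gauss 1 z) \<longlonglongrightarrow> (LINT z|(lborel::'a measure). (0::real))"
  proof (rule integral_dominated_convergence)
    show "integrable lborel (\<lambda>z::'a. (2 * L2_norm f)\<^sup>2 * gauss 1 z)"
      using integrable_gauss[of 1] by auto
    show "AE z in lborel. norm (w ((1 / real (Suc k)) *\<^sub>R z) * gauss 1 z) \<le> (2 * L2_norm f)\<^sup>2 * gauss 1 z" for k
      unfolding real_norm_def abs_mult abs_of_nonneg[OF w0] abs_of_nonneg[OF gauss_nonneg]
      by (intro AE_I2 mult_right_mono wb gauss_nonneg)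
    show "AE z in lborel. (\<lambda>k. w ((1 / real (Suc k)) *\<^sub>R z) * gauss 1 z) \<longlonglongrightarrow> 0"
    proof (rule AE_I2)
      fix z :: 'a
      have "(\<lambda>k. 1 / real (Suc k)) \<longlonglongrightarrow> 0"
        using LIMSEQ_inverse_real_of_nat by (simp add: inverse_eq_divide)
      then have "(\<lambda>k. (1 / real (Suc k)) *\<^sub>R z) \<longlonglongrightarrow> 0 *\<^sub>R z" by (intro tendsto_intros)
      then have "(\<lambda>k. (1 / real (Suc k)) *\<^sub>R z) \<longlonglongrightarrow> 0" by simp
      from L2_norm_translation_tendsto_0[OF f this]
      show "(\<lambda>k. w ((1 / real (Suc k)) *\<^sub>R z) * gauss 1 z) \<longlonglongrightarrow> 0"
        unfolding w2 by (auto intro!: tendsto_eq_intros)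
    qed
  qed measurable
  have "(\<lambda>k. (L2_norm (\<lambda>x. gconv (1 / real (Suc k)) f x - f x))\<^sup>2) \<longlonglongrightarrow> 0"
  proof (rule tendsto_sandwich[OF _ _ tendsto_const])
    show "(\<lambda>k. LINT z|lborel. w ((1 / real (Suc k)) *\<^sub>R z) * gauss 1 z) \<longlonglongrightarrow> 0" using lim by simp
    show "\<forall>\<^sub>F k in sequentially. (L2_norm (\<lambda>x. gconv (1 / real (Suc k)) f x - f x))\<^sup>2
        \<le> (LINT z|lborel. w ((1 / real (Suc k)) *\<^sub>R z) * gauss 1 z)"
      using bd sc by (intro always_eventually) auto
  qed auto
  then have "(\<lambda>k. sqrt ((L2_norm (\<lambda>x. gconv (1 / real (Suc k)) f x - f x))\<^sup>2)) \<longlonglongrightarrow> sqrt 0"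
    by (rule tendsto_real_sqrt)
  then show "(\<lambda>k. L2_norm (\<lambda>x. gconv (1 / real (Suc k)) f x - f x)) \<longlonglongrightarrow> 0"
    by (simp add: L2_norm_nonneg)
qed

section \<open>The Fourier transform of integrable functions\<close>

lemma cis_measurable [measurable (raw)]:
  "f \<in> borel_measurable M \<Longrightarrow> (\<lambda>x. cis (f x)) \<in> borel_measurable M"
  unfolding cis_conv_exp by measurable

lemma inverse_fourier_eq: "inverse_fourier f x = fourier f (- x)"
  by (simp add: inverse_fourier_def fourier_def inner_commute)

lemma fourier_eq_cnj: "fourier f x = cnj (inverse_fourier (\<lambda>x. cnj (f x)) x)"
  by (simp add: inverse_fourier_def fourier_def cis_cnj inner_commute flip: Bochner_Integration.integral_cnj)

lemma inverse_fourier_measurable [measurable]: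
  assumes [measurable]: "f \<in> borel_measurable borel"
  shows "inverse_fourier f \<in> borel_measurable borel"
  unfolding inverse_fourier_def[abs_def] by measurable

lemma fourier_measurable [measurable]:
  assumes [measurable]: "f \<in> borel_measurable borel"
  shows "fourier f \<in> borel_measurable borel"
  unfolding fourier_def[abs_def] by measurable

lemma integrable_cis_mult:
  assumes "integrable lborel f" "g \<in> borel_measurable borel"
  shows "integrable lborel (\<lambda>x. cis (g x) * f x)"
  by (rule Bochner_Integration.integrable_bound[OF assms(1)]) (use assms in \<open>auto simp: norm_mult\<close>)

lemma fourier_bound:
  fixes f :: "'a::euclidean_space \<Rightarrow> complex"
  shows "cmod (fourier f x) \<le> (2 * pi) powr (- real DIM('a) / 2) * L1_norm f"
proof -
  have "cmod (LINT y|lborel. cis (- (y \<bullet> x)) * f y) \<le> (LINT y|lborel. cmod (cis (- (y \<bullet> x)) * f y))"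
    by (rule integral_norm_bound)
  then show ?thesis
    unfolding fourier_def L1_norm_def by (simp add: norm_mult mult_left_mono)
qed

lemma fourier_diff:
  assumes "integrable lborel f" "integrable lborel g"
  shows "fourier (\<lambda>x. f x - g x) y = fourier f y - fourier g y"
proof -
  have "(LINT x|lborel. cis (- (x \<bullet> y)) * (f x - g x)) =
     (LINT x|lborel. cis (- (x \<bullet> y)) * f x) - (LINT x|lborel. cis (- (x \<bullet> y)) * g x)"
    unfolding right_diff_distrib
    by (intro Bochner_Integration.integral_diff integrable_cis_mult assms) measurable
  then show ?thesis by (simp add: fourier_def scaleR_diff_right)
qed

lemma inverse_fourier_diff:
  assumes "integrable lborel f" "integrable lborel g"
  shows "inverse_fourier (\<lambda>x. f x - g x) y = inverse_fourier f y - inverse_fourier g y"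
  by (simp add: inverse_fourier_eq fourier_diff assms)

lemma fourier_isCont_0:
  assumes f: "integrable lborel f"
  shows "isCont (fourier f) 0"
  unfolding continuous_at_sequentially
proof (intro allI impI)
  fix z :: "nat \<Rightarrow> 'a" assume z: "z \<longlonglongrightarrow> 0"
  have [measurable]: "f \<in> borel_measurable borel" using f by measurable
  have "(\<lambda>k. LINT x|lborel. cis (- (x \<bullet> z k)) * f x) \<longlonglongrightarrow> (LINT x|lborel. cis (- (x \<bullet> 0)) * f x)"
  proof (rule integral_dominated_convergence)
    show "integrable lborel (\<lambda>x. cmod (f x))" using f by auto
    show "AE x in lborel. (\<lambda>k. cis (- (x \<bullet> z k)) * f x) \<longlonglongrightarrow> cis (- (x \<bullet> 0)) * f x"
      using z unfolding cis_conv_exp by (intro AE_I2 tendsto_intros)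
  qed (auto simp: norm_mult)
  then show "(fourier f \<circ> z) \<longlonglongrightarrow> fourier f 0"
    unfolding fourier_def o_def by (intro tendsto_intros)
qed

lemma fourier_0: "fourier f (0::'a::euclidean_space) = (2 * pi) powr (- real DIM('a) / 2) *\<^sub>R P_int f"
  by (simp add: fourier_def P_int_def)

text \<open>Fubini's theorem for the kernel \<open>cis (x \<bullet> y)\<close>, which is symmetric in \<open>x\<close> and \<open>y\<close>.\<close>

lemma inverse_fourier_multiplication_formula:
  fixes f g :: "'a::euclidean_space \<Rightarrow> complex"
  assumes f: "integrable lborel f" and g: "integrable lborel g"
  shows "(LINT x|lborel. f x * inverse_fourier g x) = (LINT x|lborel. inverse_fourier f x * g x)"
proof -
  have [measurable]: "f \<in> borel_measurable borel" "g \<in> borel_measurable borel" using f g by measurable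
  define F where "F x y = cis (x \<bullet> y) * (f x * g y)" for x y
  have "integrable (lborel \<Otimes>\<^sub>M lborel) (case_prod F)"
  proof (rule lborel_pair.Fubini_integrable)
    show "case_prod F \<in> borel_measurable (lborel \<Otimes>\<^sub>M lborel)"
      unfolding F_def by measurable
    show "integrable lborel (\<lambda>x. LINT y|lborel. norm (case_prod F (x, y)))"
      using f by (simp add: F_def norm_mult)
    show "AE x in lborel. integrable lborel (\<lambda>y. case_prod F (x, y))"
      unfolding F_def prod.case by (intro AE_I2 integrable_cis_mult integrable_mult_right g) measurable
  qed
  from lborel_pair.Fubini_integral[OF this]
  have "(LINT y|lborel. LINT x|lborel. F x y) = (LINT x|lborel. LINT y|lborel. F x y)" .
  moreover have "f x * inverse_fourier g x = (2 * pi) powr (- real DIM('a) / 2) *\<^sub>R (LINT y|lborel. F x y)" for x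
  proof -
    have "(LINT y|lborel. F x y) = (LINT y|lborel. f x * (cis (x \<bullet> y) * g y))"
      unfolding F_def by (simp add: mult_ac)
    then show ?thesis by (simp add: inverse_fourier_def inner_commute)
  qed
  moreover have "inverse_fourier f y * g y = (2 * pi) powr (- real DIM('a) / 2) *\<^sub>R (LINT x|lborel. F x y)" for y
  proof -
    have "(LINT x|lborel. F x y) = (LINT x|lborel. (cis (x \<bullet> y) * f x) * g y)"
      unfolding F_def by (simp add: mult_ac)
    then show ?thesis by (simp add: inverse_fourier_def inner_commute)
  qed
  ultimately show ?thesis by simp
qed

lemma integrable_bounded_mult:
  fixes f g :: "'a \<Rightarrow> complex"
  assumes g: "integrable M g" and [measurable]: "f \<in> borel_measurable M" and b: "\<And>x. cmod (f x) \<le> B"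
  shows "integrable M (\<lambda>x. f x * g x)"
proof (rule Bochner_Integration.integrable_bound)
  show "integrable M (\<lambda>x. B * cmod (g x))" using g by auto
  have [measurable]: "g \<in> borel_measurable M" using g by measurable
  show "(\<lambda>x. f x * g x) \<in> borel_measurable M" by measurable
  show "AE x in M. cmod (f x * g x) \<le> norm (B * cmod (g x))"
    using b order_trans[OF norm_ge_zero b] by (auto simp: norm_mult abs_mult intro!: mult_right_mono)
qed

lemma inverse_fourier_bound:
  fixes f :: "'a::euclidean_space \<Rightarrow> complex"
  shows "cmod (inverse_fourier f x) \<le> (2 * pi) powr (- real DIM('a) / 2) * L1_norm f"
  unfolding inverse_fourier_eq by (rule fourier_bound)

text \<open>Fourier inversion for transforms damped by a Gaussian: the damping turns the identity into
  Gaussian regularisation.  It follows from the multiplication formula, because the inverse transform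
  of a modulated Gaussian is a translated Gaussian.\<close>

lemma fourier_damped_inverse_fourier:
  fixes h :: "'a::euclidean_space \<Rightarrow> complex"
  assumes h: "integrable lborel h" and s: "s > 0"
  shows "integrable lborel (\<lambda>x. inverse_fourier h x * of_real (exp (- s\<^sup>2 * (norm x)\<^sup>2 / 2)))"
    and "fourier (\<lambda>x. inverse_fourier h x * of_real (exp (- s\<^sup>2 * (norm x)\<^sup>2 / 2))) \<xi> = gconv s h \<xi>"
proof -
  have [measurable]: "h \<in> borel_measurable borel" using h by measurable
  define E where "E x = complex_of_real (exp (- s\<^sup>2 * (norm x)\<^sup>2 / 2))" for x :: 'a
  define c where "c = (2 * pi) powr (- real DIM('a) / 2)"
  have c: "c * c * (2 * pi) ^ DIM('a) = 1"
  proof -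
    have "(2 * pi) ^ DIM('a) = (2 * pi) powr real DIM('a)" by (simp add: powr_realpow)
    then show ?thesis unfolding c_def by (simp only: powr_add[symmetric]) simp
  qed
  have Ei: "integrable lborel E"
    unfolding E_def using gauss_integral_cis(1)[OF s, of 0] by (simp add: scaleR_conv_of_real)
  show "integrable lborel (\<lambda>x. inverse_fourier h x * of_real (exp (- s\<^sup>2 * (norm x)\<^sup>2 / 2)))"
    by (fold E_def, rule integrable_bounded_mult[OF Ei _ inverse_fourier_bound]) measurable
  define g where "g x = cis (- (x \<bullet> \<xi>)) * E x" for x
  have gi: "integrable lborel g"
    unfolding g_def by (intro integrable_cis_mult Ei) measurable
  have ig: "inverse_fourier g \<eta> = of_real (c * ((2 * pi) ^ DIM('a) * gauss s (\<eta> - \<xi>)))" for \<eta>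
  proof -
    have "cis (\<eta> \<bullet> x) * g x = exp (- s\<^sup>2 * (norm x)\<^sup>2 / 2) *\<^sub>R cis (x \<bullet> (\<eta> - \<xi>))" for x
      by (simp add: g_def E_def scaleR_conv_of_real cis_mult inner_diff_right inner_commute flip: mult.assoc)
    then have "(LINT x|lborel. cis (\<eta> \<bullet> x) * g x) = of_real ((2 * pi) ^ DIM('a) * gauss s (\<eta> - \<xi>))"
      using gauss_integral_cis(2)[OF s, of "\<eta> - \<xi>"] by simp
    then show ?thesis by (simp only: inverse_fourier_def c_def scaleR_conv_of_real of_real_mult)
  qed
  have "fourier (\<lambda>x. inverse_fourier h x * E x) \<xi> = c *\<^sub>R (LINT x|lborel. inverse_fourier h x * g x)"
    unfolding fourier_def g_def c_def by (simp add: mult_ac)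
  also have "\<dots> = c *\<^sub>R (LINT x|lborel. h x * inverse_fourier g x)"
    by (subst inverse_fourier_multiplication_formula[OF h gi]) simp
  also have "\<dots> = (LINT x|lborel. of_real (c * c * (2 * pi) ^ DIM('a)) * (h x * of_real (gauss s (x - \<xi>))))"
    unfolding ig scaleR_conv_of_real integral_mult_right_zero[symmetric]
    by (intro Bochner_Integration.integral_cong) (simp_all add: mult_ac)
  also have "\<dots> = gconv s h \<xi>"
    unfolding c gconv_def by simp
  finally show "fourier (\<lambda>x. inverse_fourier h x * of_real (exp (- s\<^sup>2 * (norm x)\<^sup>2 / 2))) \<xi> = gconv s h \<xi>"
    unfolding E_def .
qed

text \<open>By the multiplication formula and damped inversion, the integral of the squared modulus of the
  inverse transform against a wide Gaussian is the inner product of \<open>h\<close> with its Gaussian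
  regularisation.  As the Gaussian widens, the former increases to the squared norm of the inverse
  transform, and the latter tends to that of \<open>h\<close>.\<close>

lemma Plancherel_L1_L2:
  fixes h :: "'a::euclidean_space \<Rightarrow> complex"
  assumes h: "integrable lborel h" and h2: "square_integrable h"
  shows "square_integrable (inverse_fourier h)" "L2_norm (inverse_fourier h) = L2_norm h"
proof -
  have [measurable]: "h \<in> borel_measurable borel" using h by measurable
  define E where "E s x = exp (- s\<^sup>2 * (norm x)\<^sup>2 / 2)" for s and x :: 'a
  define s where "s k = 1 / real (Suc k)" for k
  have s: "s k > 0" for k by (simp add: s_def)
  have hE: "integrable lborel (\<lambda>x. inverse_fourier h x * of_real (E (s k) x))" for k
    unfolding E_def by (rule fourier_damped_inverse_fourier(1)[OF h s])
  have hE': "integrable lborel (\<lambda>x. cnj (inverse_fourier h x) * of_real (E (s k) x))" for k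
    using integrable_cnj[OF hE[of k]] by simp
  have id: "cnj (gconv (s k) h x) = inverse_fourier (\<lambda>x. cnj (inverse_fourier h x) * of_real (E (s k) x)) x" for k x
    unfolding fourier_damped_inverse_fourier(2)[OF h s, of k x, symmetric] fourier_eq_cnj E_def by simp
  have e: "inverse_fourier h x * (cnj (inverse_fourier h x) * of_real (E (s k) x)) =
       of_real ((cmod (inverse_fourier h x))\<^sup>2 * E (s k) x)" for k x
    by (simp only: of_real_mult complex_norm_square mult.assoc)
  have id2: "(LINT x|lborel. h x * cnj (gconv (s k) h x)) = of_real (LINT x|lborel. (cmod (inverse_fourier h x))\<^sup>2 * E (s k) x)" for k
    unfolding id inverse_fourier_multiplication_formula[OF h hE'] e by (rule integral_complex_of_real)
  have intE: "integrable lborel (\<lambda>x. (cmod (inverse_fourier h x))\<^sup>2 * E (s k) x)" for k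
  proof -
    have "integrable lborel (\<lambda>x. inverse_fourier h x * (cnj (inverse_fourier h x) * of_real (E (s k) x)))"
      by (rule integrable_bounded_mult[OF hE' _ inverse_fourier_bound]) measurable
    then show ?thesis unfolding e by (simp only: complex_of_real_integrable_eq)
  qed
  have lim: "(\<lambda>k. LINT x|lborel. h x * cnj (gconv (s k) h x)) \<longlonglongrightarrow> of_real ((L2_norm h)\<^sup>2)"
  proof (rule LIM_zero_cancel, rule Lim_null_comparison)
    show "(\<lambda>k. L2_norm h * L2_norm (\<lambda>x. gconv (s k) h x - h x)) \<longlonglongrightarrow> 0"
      unfolding s_def using gconv_tendsto_L2(2)[OF h2] by (rule tendsto_mult_right_zero)
    show "\<forall>\<^sub>F k in sequentially. norm ((LINT x|lborel. h x * cnj (gconv (s k) h x)) - of_real ((L2_norm h)\<^sup>2))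
       \<le> L2_norm h * L2_norm (\<lambda>x. gconv (s k) h x - h x)"
    proof (intro always_eventually allI)
      fix k
      have g2: "square_integrable (\<lambda>x. cnj (gconv (s k) h x - h x))"
        by (intro square_integrable_cnj gconv_tendsto_L2(1) h2 s)
      have i1: "integrable lborel (\<lambda>x. h x * cnj (gconv (s k) h x - h x))"
        by (rule Cauchy_Schwarz_integrable[OF h2 g2])
      have i2: "integrable lborel (\<lambda>x. h x * cnj (h x))"
        by (rule Cauchy_Schwarz_integrable[OF h2 square_integrable_cnj[OF h2]])
      have "(LINT x|lborel. h x * cnj (h x)) = of_real ((L2_norm h)\<^sup>2)"
        unfolding L2_norm_power2 complex_norm_square[symmetric] by (rule integral_complex_of_real)
      moreover have "(LINT x|lborel. h x * cnj (gconv (s k) h x)) =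
          (LINT x|lborel. h x * cnj (gconv (s k) h x - h x) + h x * cnj (h x))"
        by (intro Bochner_Integration.integral_cong) (auto simp: algebra_simps)
      ultimately have "(LINT x|lborel. h x * cnj (gconv (s k) h x)) - of_real ((L2_norm h)\<^sup>2) =
          (LINT x|lborel. h x * cnj (gconv (s k) h x - h x))"
        using i1 i2 by simp
      also have "norm \<dots> \<le> L2_norm h * L2_norm (\<lambda>x. cnj (gconv (s k) h x - h x))"
        by (rule Cauchy_Schwarz_norm_integral[OF h2 g2])
      also have "L2_norm (\<lambda>x. cnj (gconv (s k) h x - h x)) = L2_norm (\<lambda>x. gconv (s k) h x - h x)"
        by (intro L2_norm_cong complex_mod_cnj)
      finally show "norm ((LINT x|lborel. h x * cnj (gconv (s k) h x)) - of_real ((L2_norm h)\<^sup>2))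
         \<le> L2_norm h * L2_norm (\<lambda>x. gconv (s k) h x - h x)" .
    qed
  qed
  then have lim': "(\<lambda>k. LINT x|lborel. (cmod (inverse_fourier h x))\<^sup>2 * E (s k) x) \<longlonglongrightarrow> (L2_norm h)\<^sup>2"
    unfolding id2 tendsto_of_real_iff .
  have mono: "AE x in lborel. mono (\<lambda>k. (cmod (inverse_fourier h x))\<^sup>2 * E (s k) x)"
  proof (rule AE_I2, rule monoI)
    fix x and j k :: nat assume "j \<le> k"
    then have "(s k)\<^sup>2 \<le> (s j)\<^sup>2" by (intro power_mono) (auto simp: s_def field_simps)
    then have "E (s j) x \<le> E (s k) x" by (auto simp: E_def intro!: divide_right_mono mult_right_mono)
    then show "(cmod (inverse_fourier h x))\<^sup>2 * E (s j) x \<le> (cmod (inverse_fourier h x))\<^sup>2 * E (s k) x"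
      by (intro mult_left_mono) auto
  qed
  have ptw: "AE x in lborel. (\<lambda>k. (cmod (inverse_fourier h x))\<^sup>2 * E (s k) x) \<longlonglongrightarrow> (cmod (inverse_fourier h x))\<^sup>2"
  proof (rule AE_I2)
    fix x
    have "s \<longlonglongrightarrow> 0"
      unfolding s_def using LIMSEQ_inverse_real_of_nat by (simp add: inverse_eq_divide)
    then have "(\<lambda>k. (cmod (inverse_fourier h x))\<^sup>2 * E (s k) x) \<longlonglongrightarrow> (cmod (inverse_fourier h x))\<^sup>2 * exp (- 0\<^sup>2 * (norm x)\<^sup>2 / 2)"
      unfolding E_def by (intro tendsto_intros) auto
    then show "(\<lambda>k. (cmod (inverse_fourier h x))\<^sup>2 * E (s k) x) \<longlonglongrightarrow> (cmod (inverse_fourier h x))\<^sup>2" by simp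
  qed
  have m: "(\<lambda>x. (cmod (inverse_fourier h x))\<^sup>2) \<in> borel_measurable lborel" by measurable
  have "integrable lborel (\<lambda>x. (cmod (inverse_fourier h x))\<^sup>2)"
    by (rule integrable_monotone_convergence[OF intE mono ptw lim' m])
  then show "square_integrable (inverse_fourier h)" by (simp add: square_integrable_def)
  have "(LINT x|lborel. (cmod (inverse_fourier h x))\<^sup>2) = (L2_norm h)\<^sup>2"
    by (rule integral_monotone_convergence[OF intE mono ptw lim' m])
  then show "L2_norm (inverse_fourier h) = L2_norm h"
    by (simp add: L2_norm_def)
qed

section \<open>Schwartz functions\<close>

lemma smooth_measurable:
  fixes f :: "'a::euclidean_space \<Rightarrow> 'b::real_normed_vector"
  assumes "smooth f"
  shows "f \<in> borel_measurable borel"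
proof -
  have "\<And>x. fold partial_deriv [] f differentiable (at x)"
    using assms unfolding smooth_def by (metis empty_set empty_subsetI)
  then have "continuous_on UNIV f"
    by (intro differentiable_imp_continuous_on) (auto simp: differentiable_on_def)
  then show ?thesis by (rule borel_measurable_continuous_onI)
qed

lemma schwartz_measurable: "\<psi> \<in> schwartz \<Longrightarrow> \<psi> \<in> borel_measurable borel"
  by (simp add: schwartz_def smooth_measurable)

lemma schwartz_decay:
  assumes "\<psi> \<in> schwartz"
  obtains B where "\<And>x. (1 + norm x) ^ k * cmod (\<psi> x) \<le> B"
proof -
  have "bounded (range (\<lambda>x. (1 + norm x) ^ k *\<^sub>R fold partial_deriv [] \<psi> x))"
    using assms unfolding schwartz_def mem_Collect_eq by (metis empty_set empty_subsetI)
  then obtain B where "\<And>x. norm ((1 + norm x) ^ k *\<^sub>R \<psi> x) \<le> B"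
    unfolding bounded_iff by auto
  then show thesis using that[of B] by simp
qed

text \<open>The majorant is the product over the coordinates of \<open>1 / (1 + x\<^sub>b\<^sup>2)\<close>, which is at least
  \<open>(1 + |x|)\<close> to the power \<open>-2n\<close> and integrable.\<close>

lemma schwartz_integrable:
  fixes \<psi> :: "'a::euclidean_space \<Rightarrow> complex"
  assumes "\<psi> \<in> schwartz"
  shows "integrable lborel \<psi>" "square_integrable \<psi>"
proof -
  have [measurable]: "\<psi> \<in> borel_measurable borel" by (rule schwartz_measurable[OF assms])
  obtain B where B: "\<And>x. (1 + norm x) ^ (2 * DIM('a)) * cmod (\<psi> x) \<le> B"
    using schwartz_decay[OF assms, of "2 * DIM('a)"] by blast
  obtain M where "\<And>x. (1 + norm x) ^ 0 * cmod (\<psi> x) \<le> M"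
    using schwartz_decay[OF assms, of 0] by blast
  then have M: "cmod (\<psi> x) \<le> M" for x by simp
  define w :: "'a \<Rightarrow> real" where "w x = (\<Prod>b\<in>Basis. inverse (1 + (x \<bullet> b)\<^sup>2))" for x
  have "integrable lborel (\<lambda>x::real. inverse (1 + x\<^sup>2))"
    using integrable_inverse_1_plus_square by (simp add: set_integrable_def)
  then have w: "integrable lborel w"
    unfolding w_def by (intro integrable_lborel_Basis_prod)
  have bd: "cmod (\<psi> x) \<le> B * w x" for x
  proof -
    have "(\<Prod>b\<in>Basis. 1 + (x \<bullet> b)\<^sup>2) \<le> (\<Prod>b\<in>(Basis::'a set). (1 + norm x)\<^sup>2)"
    proof (intro prod_mono conjI)
      fix b :: 'a assume b: "b \<in> Basis"
      have "(x \<bullet> b)\<^sup>2 \<le> (norm x)\<^sup>2"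
        using Basis_le_norm[OF b, of x] by (metis abs_ge_zero power2_abs power_mono)
      then show "1 + (x \<bullet> b)\<^sup>2 \<le> (1 + norm x)\<^sup>2" using norm_ge_zero[of x] unfolding power2_sum one_power2 by linarith
    qed simp
    also have "\<dots> = (1 + norm x) ^ (2 * DIM('a))" by (simp add: power_mult)
    finally have "(\<Prod>b\<in>Basis. 1 + (x \<bullet> b)\<^sup>2) * cmod (\<psi> x) \<le> B"
      using B[of x] by (meson mult_right_mono norm_ge_zero order_trans)
    moreover have "0 < (\<Prod>b\<in>Basis. 1 + (x \<bullet> b)\<^sup>2)"
      by (intro prod_pos) (auto intro: add_pos_nonneg)
    moreover have "w x = inverse (\<Prod>b\<in>Basis. 1 + (x \<bullet> b)\<^sup>2)"
      unfolding w_def using prod_inversef[of "\<lambda>b. 1 + (x \<bullet> b)\<^sup>2" Basis] by (simp only: o_def)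
    ultimately show ?thesis by (simp add: pos_le_divide_eq mult.commute flip: divide_inverse)
  qed
  show "integrable lborel \<psi>"
    by (rule Bochner_Integration.integrable_bound[OF integrable_mult_right[OF w]])
      (use bd in \<open>auto intro: order_trans[OF bd abs_ge_self]\<close>)
  show "square_integrable \<psi>"
  proof (rule square_integrable_dominated(1))
    show "integrable lborel (\<lambda>x. M * cmod (\<psi> x))"
      using \<open>integrable lborel \<psi>\<close> by auto
    show "AE x in lborel. (cmod (\<psi> x))\<^sup>2 \<le> M * cmod (\<psi> x)"
      using M by (auto simp: power2_eq_square intro!: mult_right_mono)
  qed measurable
qed

lemma real_polynomial_function_deriv:
  fixes p :: "'a::euclidean_space \<Rightarrow> real"
  assumes "real_polynomial_function p"
  shows "\<exists>p'. (\<forall>x. (p has_derivative p' x) (at x)) \<and> (\<forall>b. real_polynomial_function (\<lambda>x. p' x b))"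
  using assms
proof (induction rule: real_polynomial_function.induct)
  case (linear f)
  then show ?case
    by (intro exI[of _ "\<lambda>x. f"]) (auto intro: bounded_linear_imp_has_derivative real_polynomial_function.intros(2))
next
  case (const c)
  then show ?case
    by (intro exI[of _ "\<lambda>x b. 0"]) (auto intro: real_polynomial_function.intros(2))
next
  case (add f g)
  then obtain f' g' where "\<And>x. (f has_derivative f' x) (at x)" "\<And>b. real_polynomial_function (\<lambda>x. f' x b)"
    "\<And>x. (g has_derivative g' x) (at x)" "\<And>b. real_polynomial_function (\<lambda>x. g' x b)" by blast
  then show ?case
    by (intro exI[of _ "\<lambda>x b. f' x b + g' x b"]) (auto intro: derivative_intros real_polynomial_function.intros(3))
next
  case (mult f g)
  then obtain f' g' where "\<And>x. (f has_derivative f' x) (at x)" "\<And>b. real_polynomial_function (\<lambda>x. f' x b)"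
    "\<And>x. (g has_derivative g' x) (at x)" "\<And>b. real_polynomial_function (\<lambda>x. g' x b)" by blast
  with mult.hyps show ?case
    by (intro exI[of _ "\<lambda>x b. f x * g' x b + f' x b * g x"] conjI allI has_derivative_mult
        real_polynomial_function.intros(3,4))
qed

lemma real_polynomial_function_growth:
  fixes p :: "'a::euclidean_space \<Rightarrow> real"
  assumes "real_polynomial_function p"
  shows "\<exists>A\<ge>0. \<exists>m. \<forall>x. \<bar>p x\<bar> \<le> A * (1 + norm x) ^ m"
  using assms
proof (induction rule: real_polynomial_function.induct)
  case (linear f)
  then obtain K where "K > 0" "\<And>x. norm (f x) \<le> norm x * K" using bounded_linear.pos_bounded by blast
  then have "\<bar>f x\<bar> \<le> K * (1 + norm x) ^ 1" for x
    by (smt (verit, ccfv_threshold) mult.commute mult_left_mono power_one_right real_norm_def)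
  with \<open>K > 0\<close> show ?case by (meson less_imp_le)
next
  case (const c)
  then show ?case by (intro exI[of _ "\<bar>c\<bar>"] exI[of _ 0] conjI) auto
next
  case (add f g)
  then obtain A m A' m' where *: "A \<ge> 0" "\<And>x. \<bar>f x\<bar> \<le> A * (1 + norm x) ^ m"
    "A' \<ge> 0" "\<And>x. \<bar>g x\<bar> \<le> A' * (1 + norm x) ^ m'" by blast
  have "\<bar>f x + g x\<bar> \<le> (A + A') * (1 + norm x) ^ (m + m')" for x
  proof -
    have "\<bar>f x + g x\<bar> \<le> A * (1 + norm x) ^ m + A' * (1 + norm x) ^ m'"
      using *(2)[of x] *(4)[of x] by simp
    also have "\<dots> \<le> A * (1 + norm x) ^ (m + m') + A' * (1 + norm x) ^ (m + m')"
      using * by (intro add_mono mult_left_mono power_increasing) auto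
    finally show ?thesis by (simp add: algebra_simps)
  qed
  then show ?case using * by (meson add_nonneg_nonneg)
next
  case (mult f g)
  then obtain A m A' m' where *: "A \<ge> 0" "\<And>x. \<bar>f x\<bar> \<le> A * (1 + norm x) ^ m"
    "A' \<ge> 0" "\<And>x. \<bar>g x\<bar> \<le> A' * (1 + norm x) ^ m'" by blast
  have "\<bar>f x * g x\<bar> \<le> (A * A') * (1 + norm x) ^ (m + m')" for x
    using mult_mono[OF *(2)[of x] *(4)[of x]] * by (simp add: abs_mult power_add mult_ac)
  then show ?case using * by (meson mult_nonneg_nonneg)
qed

text \<open>A class of functions that contains the translated Gaussians, is closed under partial derivatives
  and consists of rapidly decreasing functions; hence Gaussians belong to the Schwartz space.\<close>

definition gauss_times_polynomial :: "real \<Rightarrow> 'a::euclidean_space \<Rightarrow> ('a \<Rightarrow> complex) set" where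
  "gauss_times_polynomial s a =
    {\<lambda>x. of_real (p x * exp (- ((x - a) \<bullet> (x - a)) / (2 * s\<^sup>2))) |p. real_polynomial_function p}"

lemma gauss_times_polynomial_deriv:
  fixes f :: "'a::euclidean_space \<Rightarrow> complex"
  assumes f: "f \<in> gauss_times_polynomial s a" and s: "s > 0"
  shows "f differentiable (at x)" "partial_deriv b f \<in> gauss_times_polynomial s a"
proof -
  obtain p where p: "real_polynomial_function p"
    and fp: "f = (\<lambda>x. of_real (p x * exp (- ((x - a) \<bullet> (x - a)) / (2 * s\<^sup>2))))"
    using f unfolding gauss_times_polynomial_def by blast
  obtain p' where p': "\<And>x. (p has_derivative p' x) (at x)" "\<And>b. real_polynomial_function (\<lambda>x. p' x b)"
    using real_polynomial_function_deriv[OF p] by blast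
  define q where "q x b = p' x b + p x * (- ((x - a) \<bullet> b) / s\<^sup>2)" for x b
  have d: "(f has_derivative (\<lambda>h. of_real (q x h * exp (- ((x - a) \<bullet> (x - a)) / (2 * s\<^sup>2))))) (at x)" for x
    unfolding fp q_def
    by (rule has_derivative_eq_rhs, (rule derivative_intros p' | simp add: s)+)
      (use s in \<open>auto simp: fun_eq_iff field_simps inner_commute power2_eq_square\<close>)
  show "f differentiable (at x)" using d unfolding differentiable_def by blast
  have "partial_deriv b f = (\<lambda>x. of_real (q x b * exp (- ((x - a) \<bullet> (x - a)) / (2 * s\<^sup>2))))"
    unfolding partial_deriv_def using frechet_derivative_at[OF d] by (auto simp: fun_eq_iff dest: fun_cong)
  moreover have "real_polynomial_function (\<lambda>x. q x b)"
  proof -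
    have "real_polynomial_function (\<lambda>x. x \<bullet> b)"
      by (rule real_polynomial_function.intros(1)) (rule bounded_linear_inner_left)
    then have "real_polynomial_function (\<lambda>x. p' x b + p x * ((x \<bullet> b + - (a \<bullet> b)) * (- 1 / s\<^sup>2)))"
      by (intro real_polynomial_function.intros(3) real_polynomial_function.intros(4) real_polynomial_function.intros(2) p p')
    then show ?thesis by (simp add: q_def inner_diff_left algebra_simps diff_divide_distrib)
  qed
  ultimately show "partial_deriv b f \<in> gauss_times_polynomial s a"
    unfolding gauss_times_polynomial_def by (auto intro!: exI[of _ "\<lambda>x. q x b"])
qed

lemma gauss_times_polynomial_bounded:
  fixes f :: "'a::euclidean_space \<Rightarrow> complex"
  assumes f: "f \<in> gauss_times_polynomial s a" and s: "s > 0"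
  shows "bounded (range (\<lambda>x. (1 + norm x) ^ k *\<^sub>R f x))"
proof -
  obtain p where p: "real_polynomial_function p"
    and fp: "f = (\<lambda>x. of_real (p x * exp (- ((x - a) \<bullet> (x - a)) / (2 * s\<^sup>2))))"
    using f unfolding gauss_times_polynomial_def by blast
  obtain A m where A: "A \<ge> 0" "\<And>x. \<bar>p x\<bar> \<le> A * (1 + norm x) ^ m"
    using real_polynomial_function_growth[OF p] by blast
  define j where "j = k + m"
  have "norm ((1 + norm x) ^ k *\<^sub>R f x) \<le> A * (1 + norm a) ^ j * exp ((real j)\<^sup>2 * s\<^sup>2 / 2)" for x
  proof -
    define t where "t = norm (x - a)"
    have t: "t \<ge> 0" by (simp add: t_def)
    have "norm x \<le> norm a + t" unfolding t_def by (metis add.commute diff_add_cancel norm_triangle_ineq)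
    then have "1 + norm x \<le> (1 + norm a) * (1 + t)"
      using mult_nonneg_nonneg[OF norm_ge_zero[of a] t] by (simp add: algebra_simps)
    also have "\<dots> \<le> (1 + norm a) * exp t"
      using exp_ge_add_one_self[of t] by (intro mult_left_mono) auto
    finally have "(1 + norm x) ^ j \<le> ((1 + norm a) * exp t) ^ j"
      by (intro power_mono) auto
    also have "\<dots> = (1 + norm a) ^ j * exp (j * t)"
      by (simp add: power_mult_distrib exp_of_nat_mult)
    finally have 1: "(1 + norm x) ^ j \<le> (1 + norm a) ^ j * exp (j * t)" .
    have "norm ((1 + norm x) ^ k *\<^sub>R f x) = (1 + norm x) ^ k * \<bar>p x\<bar> * exp (- t\<^sup>2 / (2 * s\<^sup>2))"
      by (simp add: fp norm_mult t_def power2_norm_eq_inner abs_mult)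
    also have "\<dots> \<le> (1 + norm x) ^ k * (A * (1 + norm x) ^ m) * exp (- t\<^sup>2 / (2 * s\<^sup>2))"
      by (intro mult_right_mono mult_left_mono A) auto
    also have "\<dots> = A * (1 + norm x) ^ j * exp (- t\<^sup>2 / (2 * s\<^sup>2))"
      by (simp add: j_def power_add mult_ac)
    also have "\<dots> \<le> A * ((1 + norm a) ^ j * exp (j * t)) * exp (- t\<^sup>2 / (2 * s\<^sup>2))"
      by (intro mult_right_mono mult_left_mono A 1) auto
    also have "\<dots> = A * (1 + norm a) ^ j * exp (j * t - t\<^sup>2 / (2 * s\<^sup>2))"
      by (simp add: exp_diff exp_minus field_simps)
    also have "\<dots> \<le> A * (1 + norm a) ^ j * exp ((real j)\<^sup>2 * s\<^sup>2 / 2)"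
    proof -
      have "0 \<le> (real j * s - t / s)\<^sup>2" by simp
      then have "j * t - t\<^sup>2 / (2 * s\<^sup>2) \<le> (real j)\<^sup>2 * s\<^sup>2 / 2"
        using s by (simp add: power2_diff power_mult_distrib power_divide)
      then show ?thesis using A(1) by (intro mult_left_mono) auto
    qed
    finally show ?thesis .
  qed
  then show ?thesis unfolding bounded_iff by blast
qed

lemma gauss_schwartz:
  assumes s: "s > 0"
  shows "(\<lambda>x::'a::euclidean_space. complex_of_real (gauss s (x - a))) \<in> schwartz"
proof -
  have *: "fold partial_deriv bs f \<in> gauss_times_polynomial s a"
    if "f \<in> gauss_times_polynomial s a" for bs and f :: "'a \<Rightarrow> complex"
    using that by (induction bs arbitrary: f) (auto intro: gauss_times_polynomial_deriv(2)[OF _ s])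
  have "(\<lambda>x::'a. complex_of_real (gauss s (x - a))) \<in> gauss_times_polynomial s a"
    unfolding gauss_times_polynomial_def gauss_eq[OF s] power2_norm_eq_inner
    by (intro CollectI exI[of _ "\<lambda>x. (1 / sqrt (2 * pi * s\<^sup>2)) ^ DIM('a)"] conjI refl real_polynomial_function.intros(2))
  then show ?thesis
    unfolding schwartz_def smooth_def
    by (auto intro!: gauss_times_polynomial_deriv(1)[OF * s] gauss_times_polynomial_bounded[OF * s])
qed

section \<open>The L2 norm of a distribution and of its transform\<close>

text \<open>The Gaussian regularisations of \<open>f\<close> are pairings with translated Gaussians, hence vanish, and they
  tend to \<open>f\<close>.\<close>

lemma L2_norm_eq_0_if_annihilates_schwartz:
  assumes f: "square_integrable f" and z: "\<And>\<psi>. \<psi> \<in> schwartz \<Longrightarrow> (LINT x|lborel. f x * \<psi> x) = 0"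
  shows "L2_norm f = 0"
proof -
  have "gconv s f x = 0" if "s > 0" for s x
    unfolding gconv_def using z gauss_schwartz[OF that] by blast
  then have "(\<lambda>k. L2_norm (\<lambda>x. 0 - f x)) \<longlonglongrightarrow> 0"
    using gconv_tendsto_L2(2)[OF f] by simp
  then have "L2_norm (\<lambda>x. 0 - f x) = 0" by (simp add: LIMSEQ_const_iff)
  moreover have "L2_norm (\<lambda>x. 0 - f x) = L2_norm f" by (intro L2_norm_cong) simp
  ultimately show ?thesis by simp
qed

text \<open>Completeness of \<open>L\<^sup>2\<close>, for sequences that are Cauchy at a geometric rate.  The rate makes
  \<open>\<Sum>\<^sub>k 2\<^sup>k |f\<^sub>k - f\<^sub>k\<^sub>+\<^sub>1|\<^sup>2\<close> integrable, which forces convergence almost everywhere; the error estimate for the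
  pointwise limit is then Fatou's lemma.\<close>

lemma L2_complete_geometric:
  fixes f :: "nat \<Rightarrow> 'a::euclidean_space \<Rightarrow> complex"
  assumes f: "\<And>k. square_integrable (f k)"
    and d: "\<And>k m. k \<le> m \<Longrightarrow> L2_norm (\<lambda>x. f k x - f m x) \<le> C * (1 / 2) ^ k"
  obtains F where "square_integrable F" "\<And>k. L2_norm (\<lambda>x. f k x - F x) \<le> C * (1 / 2) ^ k"
proof -
  have [measurable]: "f k \<in> borel_measurable borel" for k using f[of k] by measurable
  have fd: "square_integrable (\<lambda>x. f k x - f m x)" for k m by (intro square_integrable_diff f)
  have nn: "(\<integral>\<^sup>+x. ennreal ((cmod (f k x - f m x))\<^sup>2) \<partial>lborel) = ennreal ((L2_norm (\<lambda>x. f k x - f m x))\<^sup>2)" for k m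
    unfolding L2_norm_power2 using fd by (intro nn_integral_eq_integral) (auto simp: square_integrable_def)
  have C: "0 \<le> C" using order_trans[OF L2_norm_nonneg d[of 0 0]] by simp
  have "(\<integral>\<^sup>+x. (\<Sum>k. ennreal (2 ^ k * (cmod (f k x - f (Suc k) x))\<^sup>2)) \<partial>lborel) =
     (\<Sum>k. (\<integral>\<^sup>+x. ennreal (2 ^ k * (cmod (f k x - f (Suc k) x))\<^sup>2) \<partial>lborel))"
    by (rule nn_integral_suminf) measurable
  also have "\<dots> \<le> (\<Sum>k. ennreal (C\<^sup>2 * (1 / 2) ^ k))"
  proof (intro suminf_le)
    fix k
    have "(\<integral>\<^sup>+x. ennreal (2 ^ k * (cmod (f k x - f (Suc k) x))\<^sup>2) \<partial>lborel)
       = ennreal (2 ^ k * (L2_norm (\<lambda>x. f k x - f (Suc k) x))\<^sup>2)"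
      by (simp add: ennreal_mult nn_integral_cmult nn)
    also have "\<dots> \<le> ennreal (2 ^ k * (C * (1 / 2) ^ k)\<^sup>2)"
      by (intro ennreal_leI mult_left_mono power_mono d L2_norm_nonneg) auto
    also have "2 ^ k * (C * (1 / 2) ^ k)\<^sup>2 = C\<^sup>2 * (1 / 2) ^ k"
      by (simp add: power2_eq_square power_divide field_simps)
    finally show "(\<integral>\<^sup>+x. ennreal (2 ^ k * (cmod (f k x - f (Suc k) x))\<^sup>2) \<partial>lborel) \<le> ennreal (C\<^sup>2 * (1 / 2) ^ k)" .
  qed auto
  also have "\<dots> = ennreal (\<Sum>k. C\<^sup>2 * (1 / 2) ^ k)"
    by (intro suminf_ennreal2 summable_mult summable_geometric) auto
  also have "\<dots> < \<infinity>" by simp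
  finally have fin: "(\<integral>\<^sup>+x. (\<Sum>k. ennreal (2 ^ k * (cmod (f k x - f (Suc k) x))\<^sup>2)) \<partial>lborel) \<noteq> \<infinity>"
    by simp
  have "AE x in lborel. (\<Sum>k. ennreal (2 ^ k * (cmod (f k x - f (Suc k) x))\<^sup>2)) \<noteq> \<infinity>"
    by (rule nn_integral_PInf_AE[OF _ fin]) measurable
  then have conv: "AE x in lborel. convergent (\<lambda>k. f k x)"
  proof eventually_elim
    case (elim x)
    have s2: "summable (\<lambda>k. 2 ^ k * (cmod (f k x - f (Suc k) x))\<^sup>2)"
      using elim by (intro summable_suminf_not_top) auto
    have "summable (\<lambda>k. f (Suc k) x - f k x)"
    proof (rule summable_comparison_test')
      show "summable (\<lambda>k. (1 / 2) ^ k + 2 ^ k * (cmod (f k x - f (Suc k) x))\<^sup>2 :: real)"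
        by (intro summable_add s2 summable_geometric) auto
      fix k
      define e :: real where "e = 2 ^ k"
      define D where "D = cmod (f (Suc k) x - f k x)"
      have e: "e > 0" by (simp add: e_def)
      have D: "D \<ge> 0" by (simp add: D_def)
      \<comment> \<open>\<open>D \<le> 1 / e + e D\<^sup>2\<close> trades the square for a summable error\<close>
      have "0 \<le> (1 - e * D)\<^sup>2" by simp
      then have "2 * (e * D) \<le> 1 + e * (e * D\<^sup>2)" by (simp add: power2_eq_square algebra_simps)
      then have "e * D \<le> 1 + e * (e * D\<^sup>2)" using e D mult_nonneg_nonneg[of e D] by linarith
      then have "D \<le> 1 / e + e * D\<^sup>2" using e by (simp add: field_simps)
      then show "norm (f (Suc k) x - f k x) \<le> (1 / 2) ^ k + 2 ^ k * (cmod (f k x - f (Suc k) x))\<^sup>2"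
        by (simp add: D_def e_def norm_minus_commute power_divide)
    qed
    then have "convergent (\<lambda>n. (\<Sum>k<n. f (Suc k) x - f k x))"
      by (simp add: summable_iff_convergent)
    then have "convergent (\<lambda>n. f n x - f 0 x)"
      by (subst (asm) sum_lessThan_telescope)
    then show ?case by (simp add: convergent_diff_const_right_iff)
  qed
  define F where "F x = lim (\<lambda>k. f k x)" for x
  have [measurable]: "F \<in> borel_measurable borel"
    unfolding F_def[abs_def] by (rule borel_measurable_lim_metric) measurable
  have lim: "AE x in lborel. (\<lambda>k. f k x) \<longlonglongrightarrow> F x"
    using conv by eventually_elim (simp add: F_def convergent_LIMSEQ_iff)
  have fat: "(\<integral>\<^sup>+x. ennreal ((cmod (f k x - F x))\<^sup>2) \<partial>lborel) \<le> ennreal ((C * (1 / 2) ^ k)\<^sup>2)" for k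
  proof -
    have "(\<integral>\<^sup>+x. ennreal ((cmod (f k x - F x))\<^sup>2) \<partial>lborel) =
        (\<integral>\<^sup>+x. liminf (\<lambda>m. ennreal ((cmod (f k x - f m x))\<^sup>2)) \<partial>lborel)"
    proof (rule nn_integral_cong_AE)
      show "AE x in lborel. ennreal ((cmod (f k x - F x))\<^sup>2) = liminf (\<lambda>m. ennreal ((cmod (f k x - f m x))\<^sup>2))"
        using lim
      proof eventually_elim
        case (elim x)
        have "(\<lambda>m. ennreal ((cmod (f k x - f m x))\<^sup>2)) \<longlonglongrightarrow> ennreal ((cmod (f k x - F x))\<^sup>2)"
          by (intro tendsto_ennrealI tendsto_intros elim)
        then show ?case by (rule lim_imp_Liminf[symmetric, rotated]) simp
      qed
    qed
    also have "\<dots> \<le> liminf (\<lambda>m. \<integral>\<^sup>+x. ennreal ((cmod (f k x - f m x))\<^sup>2) \<partial>lborel)"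
      by (rule nn_integral_liminf) measurable
    also have "\<dots> \<le> liminf (\<lambda>m. ennreal ((C * (1 / 2) ^ k)\<^sup>2))"
    proof (rule Liminf_mono)
      show "\<forall>\<^sub>F m in sequentially. (\<integral>\<^sup>+x. ennreal ((cmod (f k x - f m x))\<^sup>2) \<partial>lborel) \<le> ennreal ((C * (1 / 2) ^ k)\<^sup>2)"
        using eventually_ge_at_top[of k]
        by eventually_elim (auto simp only: nn intro!: ennreal_leI power_mono d L2_norm_nonneg)
    qed
    also have "\<dots> = ennreal ((C * (1 / 2) ^ k)\<^sup>2)" by (simp add: Liminf_const)
    finally show ?thesis .
  qed
  have sq: "square_integrable (\<lambda>x. f k x - F x)" for k
    unfolding square_integrable_def
    by (intro conjI integrableI_bounded) (use le_less_trans[OF fat[of k]] in auto)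
  have "square_integrable (\<lambda>x. f 0 x - (f 0 x - F x))" by (intro square_integrable_diff f sq)
  then have F: "square_integrable F" by simp
  have "L2_norm (\<lambda>x. f k x - F x) \<le> C * (1 / 2) ^ k" for k
  proof (rule power2_le_imp_le)
    have "ennreal ((L2_norm (\<lambda>x. f k x - F x))\<^sup>2) = (\<integral>\<^sup>+x. ennreal ((cmod (f k x - F x))\<^sup>2) \<partial>lborel)"
      unfolding L2_norm_power2 using sq[of k]
      by (intro nn_integral_eq_integral[symmetric]) (auto simp: square_integrable_def)
    also note fat[of k]
    finally show "(L2_norm (\<lambda>x. f k x - F x))\<^sup>2 \<le> (C * (1 / 2) ^ k)\<^sup>2"
      by (subst (asm) ennreal_le_iff) auto
    show "0 \<le> C * (1 / 2) ^ k" using C by simp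
  qed
  with F show thesis by (rule that)
qed

lemma tendsto_L2_pairing:
  assumes f: "\<And>k. square_integrable (f k)" and F: "square_integrable F" and p: "square_integrable p"
    and lim: "(\<lambda>k. L2_norm (\<lambda>x. f k x - F x)) \<longlonglongrightarrow> 0"
  shows "(\<lambda>k::nat. LINT x|lborel. f k x * p x) \<longlonglongrightarrow> (LINT x|lborel. F x * p x)"
proof (rule LIM_zero_cancel, rule Lim_null_comparison)
  show "(\<lambda>k. L2_norm (\<lambda>x. f k x - F x) * L2_norm p) \<longlonglongrightarrow> 0"
    using lim by (rule tendsto_mult_left_zero)
  show "\<forall>\<^sub>F k in sequentially. norm ((LINT x|lborel. f k x * p x) - (LINT x|lborel. F x * p x))
     \<le> L2_norm (\<lambda>x. f k x - F x) * L2_norm p"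
  proof (intro always_eventually allI)
    fix k
    have "(LINT x|lborel. f k x * p x) - (LINT x|lborel. F x * p x) = (LINT x|lborel. (f k x - F x) * p x)"
      unfolding left_diff_distrib
      by (intro Bochner_Integration.integral_diff[symmetric] Cauchy_Schwarz_integrable f F p)
    then show "norm ((LINT x|lborel. f k x * p x) - (LINT x|lborel. F x * p x))
       \<le> L2_norm (\<lambda>x. f k x - F x) * L2_norm p"
      using Cauchy_Schwarz_norm_integral[OF square_integrable_diff[OF f F] p] by simp
  qed
qed

text \<open>A square-integrable function need not be integrable, so its inverse transform is obtained as the
  \<open>L\<^sup>2\<close> limit of those of its truncations to balls, and is characterised by duality.\<close>

lemma Plancherel_L2:
  fixes g :: "'a::euclidean_space \<Rightarrow> complex"
  assumes g: "square_integrable g"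
  obtains f where "square_integrable f" "L2_norm f = L2_norm g"
    "\<And>\<psi>. integrable lborel \<psi> \<Longrightarrow> square_integrable \<psi> \<Longrightarrow>
       (LINT x|lborel. f x * \<psi> x) = (LINT \<xi>|lborel. g \<xi> * inverse_fourier \<psi> \<xi>)"
proof -
  have [measurable]: "g \<in> borel_measurable borel" using g by measurable
  define G where "G n x = (if norm x \<le> real n then g x else 0)" for n x
  have [measurable]: "G n \<in> borel_measurable borel" for n unfolding G_def by measurable
  have G2: "square_integrable (G n)" for n
    by (rule square_integrable_dominated(1)[where h = "\<lambda>x. (cmod (g x))\<^sup>2"])
      (use g in \<open>auto simp: square_integrable_def G_def\<close>)
  have G1: "integrable lborel (G n)" for n
  proof -
    have "square_integrable (\<lambda>x::'a. of_real (indicator (cball 0 (real n)) x))"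
    proof (rule square_integrable_dominated(1))
      show "integrable lborel (\<lambda>x::'a. 1 * indicator (cball 0 (real n)) x :: real)"
        by (rule integrable_indicator_cball)
    qed (auto simp: indicator_def)
    from Cauchy_Schwarz_integrable[OF G2[of n] this] show ?thesis
      by (rule back_subst[of "integrable lborel"]) (auto simp: G_def indicator_def)
  qed
  have "(\<lambda>n. L2_norm (\<lambda>x. G n x - g x)) \<longlonglongrightarrow> 0"
  proof (rule L2_norm_dominated_tendsto_0)
    show "integrable lborel (\<lambda>x. (cmod (g x))\<^sup>2)" using g by (simp add: square_integrable_def)
    show "AE x in lborel. (\<lambda>n. G n x - g x) \<longlonglongrightarrow> 0"
    proof (rule AE_I2, rule tendsto_eventually)
      fix x :: 'a
      obtain n where n: "norm x \<le> real n" using real_arch_simple by blast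
      show "\<forall>\<^sub>F k in sequentially. G k x - g x = 0"
        using eventually_ge_at_top[of n] by eventually_elim (use n in \<open>auto simp: G_def\<close>)
    qed
  qed (auto simp: G_def)
  then have "\<forall>\<^sub>F n in sequentially. L2_norm (\<lambda>x. G n x - g x) < (1 / 2) ^ k" for k
    by (intro order_tendstoD) auto
  then have "\<exists>n. L2_norm (\<lambda>x. G n x - g x) < (1 / 2) ^ k" for k
    by (meson eventually_happens trivial_limit_sequentially)
  then obtain n where n: "\<And>k. L2_norm (\<lambda>x. G (n k) x - g x) < (1 / 2) ^ k" by metis
  define f where "f k = inverse_fourier (G (n k))" for k
  have f2: "square_integrable (f k)" and fn: "L2_norm (f k) = L2_norm (G (n k))" for k
    unfolding f_def using Plancherel_L1_L2[OF G1 G2] by auto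
  have fd: "L2_norm (\<lambda>x. f k x - f m x) \<le> 2 * (1 / 2) ^ k" if "k \<le> m" for k m
  proof -
    have i1: "integrable lborel (\<lambda>x. G (n k) x - G (n m) x)"
      using G1 by (intro Bochner_Integration.integrable_diff)
    have "(\<lambda>x. f k x - f m x) = inverse_fourier (\<lambda>x. G (n k) x - G (n m) x)"
      unfolding f_def using inverse_fourier_diff[OF G1 G1] by (intro ext) simp
    then have "L2_norm (\<lambda>x. f k x - f m x) = L2_norm (\<lambda>x. G (n k) x - G (n m) x)"
      using Plancherel_L1_L2(2)[OF i1 square_integrable_diff[OF G2 G2]] by simp
    also have "\<dots> = L2_norm (\<lambda>x. (G (n k) x - g x) + (g x - G (n m) x))" by simp
    also have "\<dots> \<le> L2_norm (\<lambda>x. G (n k) x - g x) + L2_norm (\<lambda>x. g x - G (n m) x)"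
      by (intro L2_norm_triangle square_integrable_diff G2 g)
    also have "\<dots> \<le> (1 / 2) ^ k + (1 / 2) ^ m"
      using n[of k] n[of m] L2_norm_minus_commute[of g "G (n m)"] by simp
    also have "\<dots> \<le> 2 * (1 / 2) ^ k"
      using power_decreasing[OF that, of "1 / 2 :: real"] by simp
    finally show ?thesis .
  qed
  obtain F :: "'a \<Rightarrow> complex" where F: "square_integrable F" "\<And>k. L2_norm (\<lambda>x. f k x - F x) \<le> 2 * (1 / 2) ^ k"
  proof (rule L2_complete_geometric[of f 2])
    fix F :: "'a \<Rightarrow> complex" assume "square_integrable F" "\<And>k. L2_norm (\<lambda>x. f k x - F x) \<le> 2 * (1 / 2) ^ k"
    then show thesis using that by simp
  qed (auto intro: f2 fd)
  have half: "(\<lambda>k. (1 / 2) ^ k :: real) \<longlonglongrightarrow> 0" by (rule LIMSEQ_realpow_zero) auto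
  have limF: "(\<lambda>k. L2_norm (\<lambda>x. f k x - F x)) \<longlonglongrightarrow> 0"
    by (rule tendsto_sandwich[OF _ _ tendsto_const tendsto_mult_right_zero[OF half, of 2]])
      (use F(2) in \<open>auto simp: L2_norm_nonneg\<close>)
  have limg: "(\<lambda>k. L2_norm (\<lambda>x. G (n k) x - g x)) \<longlonglongrightarrow> 0"
    by (rule tendsto_sandwich[OF _ _ tendsto_const half])
      (use n in \<open>auto simp: L2_norm_nonneg less_imp_le\<close>)
  have "(\<lambda>k. L2_norm (f k)) \<longlonglongrightarrow> L2_norm F"
    by (rule LIM_zero_cancel, rule Lim_null_comparison[OF _ limF])
      (use L2_norm_diff_ge[OF f2 F(1)] in auto)
  moreover have "(\<lambda>k. L2_norm (G (n k))) \<longlonglongrightarrow> L2_norm g"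
    by (rule LIM_zero_cancel, rule Lim_null_comparison[OF _ limg])
      (use L2_norm_diff_ge[OF G2 g] in auto)
  ultimately have "L2_norm F = L2_norm g"
    unfolding fn by (rule LIMSEQ_unique)
  moreover have "(LINT x|lborel. F x * \<psi> x) = (LINT \<xi>|lborel. g \<xi> * inverse_fourier \<psi> \<xi>)"
    if \<psi>: "integrable lborel \<psi>" "square_integrable \<psi>" for \<psi>
  proof (rule LIMSEQ_unique)
    show "(\<lambda>k. LINT x|lborel. f k x * \<psi> x) \<longlonglongrightarrow> (LINT x|lborel. F x * \<psi> x)"
      by (rule tendsto_L2_pairing[OF f2 F(1) \<psi>(2) limF])
    have "(LINT x|lborel. f k x * \<psi> x) = (LINT \<xi>|lborel. G (n k) \<xi> * inverse_fourier \<psi> \<xi>)" for k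
      unfolding f_def by (rule inverse_fourier_multiplication_formula[OF G1 \<psi>(1), symmetric])
    then show "(\<lambda>k. LINT x|lborel. f k x * \<psi> x) \<longlonglongrightarrow> (LINT \<xi>|lborel. g \<xi> * inverse_fourier \<psi> \<xi>)"
      using tendsto_L2_pairing[OF G2 g Plancherel_L1_L2(1)[OF \<psi>] limg] by simp
  qed
  ultimately show thesis using that F(1) by blast
qed

text \<open>This reduces every claim about the \<open>L\<^sup>2\<close> norm of a distribution to one about its Fourier transform.
  The choice of the representing function does not matter because a square-integrable function is
  determined by its pairings with Schwartz functions.\<close>

lemma distr_L2_norm_eq:
  fixes T :: "'a::euclidean_space distr"
  assumes g: "square_integrable g"
    and T: "\<And>\<psi>. \<psi> \<in> schwartz \<Longrightarrow> T \<psi> = (LINT \<xi>|lborel. g \<xi> * inverse_fourier \<psi> \<xi>)"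
  shows "in_L2 T" "distr_L2_norm T = L2_norm g"
proof -
  obtain f where f: "square_integrable f" "L2_norm f = L2_norm g"
    and fT: "\<And>\<psi>. integrable lborel \<psi> \<Longrightarrow> square_integrable \<psi> \<Longrightarrow>
       (LINT x|lborel. f x * \<psi> x) = (LINT \<xi>|lborel. g \<xi> * inverse_fourier \<psi> \<xi>)"
    using Plancherel_L2[OF g] by metis
  have rep: "represents f T"
    unfolding represents_def
    by (intro ballI conjI Cauchy_Schwarz_integrable f schwartz_integrable)
      (simp_all add: T fT schwartz_integrable)
  then show "in_L2 T" unfolding in_L2_def using f by blast
  define F where "F = (SOME f. square_integrable f \<and> represents f T)"
  have F: "square_integrable F" "represents F T"
    unfolding F_def using someI[of "\<lambda>f. square_integrable f \<and> represents f T" f] f(1) rep by auto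
  have d: "square_integrable (\<lambda>x. F x - f x)" by (intro square_integrable_diff F f)
  have "L2_norm (\<lambda>x. F x - f x) = 0"
  proof (rule L2_norm_eq_0_if_annihilates_schwartz[OF d])
    fix \<psi> :: "'a \<Rightarrow> complex" assume \<psi>: "\<psi> \<in> schwartz"
    have "(LINT x|lborel. F x * \<psi> x) = (LINT x|lborel. f x * \<psi> x)"
      using F(2) rep \<psi> unfolding represents_def by metis
    then show "(LINT x|lborel. (F x - f x) * \<psi> x) = 0"
      unfolding left_diff_distrib
      by (subst Bochner_Integration.integral_diff)
        (simp_all add: Cauchy_Schwarz_integrable F(1) f(1) schwartz_integrable(2)[OF \<psi>])
  qed
  with L2_norm_diff_ge[OF F(1) f(1)] have "L2_norm F = L2_norm f" by simp
  then show "distr_L2_norm T = L2_norm g"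
    unfolding distr_L2_norm_def F_def[symmetric] f(2) .
qed

section \<open>The system at a fixed frequency\<close>

lemma exp_mult_has_vector_derivative:
  "((\<lambda>t. exp (of_real t * k)) has_vector_derivative k * exp (of_real t * k)) (at t)" for k :: complex
  by (rule has_vector_derivative_real_field[of "\<lambda>z. exp (z * k)"]) (auto intro!: derivative_eq_intros)

text \<open>Continuity at \<open>0\<close> replaces the equation there.  Applied to suitable linear combinations of the
  unknowns, this solves the system at a frequency without a separate uniqueness theorem.\<close>

lemma linear_ode_solution:
  fixes y :: "real \<Rightarrow> complex"
  assumes c: "continuous_on {0..} y" and d: "\<And>t. t > 0 \<Longrightarrow> (y has_vector_derivative k * y t) (at t)"
    and t: "t \<ge> 0"
  shows "y t = exp (of_real t * k) * y 0"
proof -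
  define \<phi> where "\<phi> s = exp (of_real s * - k) * y s" for s
  have "\<phi> t = y 0"
  proof (rule has_derivative_zero_unique_strong_interval)
    show "continuous_on {0..t} \<phi>"
      unfolding \<phi>_def by (intro continuous_intros continuous_on_subset[OF c]) auto
    show "(\<phi> has_derivative (\<lambda>h. 0)) (at s within {0..t})" if "s \<in> {0..t} - {0}" for s
    proof -
      have "(\<phi> has_vector_derivative exp (of_real s * - k) * (k * y s) + (- k * exp (of_real s * - k)) * y s) (at s)"
        unfolding \<phi>_def using that
        by (intro has_vector_derivative_mult d exp_mult_has_vector_derivative) auto
      then have "(\<phi> has_vector_derivative 0) (at s)" by (simp add: mult_ac)
      then show ?thesis
        by (simp add: has_vector_derivative_def has_derivative_at_withinI)
    qed
  qed (use t in \<open>auto simp: \<phi>_def\<close>)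
  then show ?thesis by (simp add: \<phi>_def exp_minus field_simps)
qed

lemma cubic_root_exists:
  fixes r :: real
  assumes r: "r > 0"
  shows "\<exists>\<mu>. 0 < \<mu> \<and> \<mu> < r\<^sup>2 \<and> \<mu> ^ 3 - r\<^sup>2 * \<mu>\<^sup>2 + (1 + r\<^sup>2) * \<mu> - r ^ 4 = 0"
proof -
  define q where "q \<mu> = \<mu> ^ 3 - r\<^sup>2 * \<mu>\<^sup>2 + (1 + r\<^sup>2) * \<mu> - r ^ 4" for \<mu>
  have q0: "q 0 < 0" using r by (simp add: q_def)
  have q1: "q (r\<^sup>2) = r\<^sup>2" by (simp add: q_def algebra_simps power2_eq_square power3_eq_cube power4_eq_xxxx)
  have "\<exists>\<mu>. 0 \<le> \<mu> \<and> \<mu> \<le> r\<^sup>2 \<and> q \<mu> = 0"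
  proof (rule IVT')
    show "continuous_on {0..r\<^sup>2} q" unfolding q_def by (intro continuous_intros)
  qed (use q0 q1 in auto)
  then obtain \<mu> where "0 \<le> \<mu>" "\<mu> \<le> r\<^sup>2" "q \<mu> = 0" by blast
  moreover have "\<mu> \<noteq> 0" "\<mu> \<noteq> r\<^sup>2" using \<open>q \<mu> = 0\<close> q0 q1 r by auto
  ultimately show ?thesis by (auto simp: q_def intro!: exI[of _ \<mu>])
qed

lemma mult_exp_neg_le:
  fixes x a :: real
  assumes "a > 0"
  shows "x * exp (- a * x) \<le> (2 / a) * exp (- a * x / 2)"
proof -
  have "a * x / 2 \<le> exp (a * x / 2)" using exp_ge_add_one_self[of "a * x / 2"] by linarith
  then have "(a * x / 2) * exp (- a * x) \<le> exp (a * x / 2) * exp (- a * x)" by (intro mult_right_mono) auto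
  also have "\<dots> = exp (- a * x / 2)" by (simp flip: exp_add)
  finally show ?thesis using assms by (simp add: field_simps)
qed

lemma exp_neg_diff_le:
  fixes x y :: real
  assumes "m \<le> x" "m \<le> y"
  shows "\<bar>exp (- x) - exp (- y)\<bar> \<le> \<bar>x - y\<bar> * exp (- m)"
proof -
  have *: "exp (- x) - exp (- y) \<le> (y - x) * exp (- m)" if "m \<le> x" "x \<le> y" for x y
  proof -
    have "exp (- x) - exp (- y) = exp (- x) * (1 - exp (- (y - x)))"
      by (simp add: right_diff_distrib flip: exp_add)
    also have "\<dots> \<le> exp (- m) * (y - x)"
    proof (intro mult_mono)
      show "1 - exp (- (y - x)) \<le> y - x" using exp_ge_add_one_self[of "- (y - x)"] by linarith
    qed (use that in auto)
    finally show ?thesis by (simp add: mult.commute)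
  qed
  show ?thesis using *[of x y] *[of y x] assms by (cases "x \<le> y") auto
qed

lemma abs_cos_diff_le: "\<bar>cos x - cos y\<bar> \<le> \<bar>x - y\<bar>" for x y :: real
proof -
  have "\<bar>cos x - cos y\<bar> = 2 * \<bar>sin ((x + y) / 2)\<bar> * \<bar>sin ((y - x) / 2)\<bar>"
    by (simp add: cos_diff_cos abs_mult)
  also have "\<dots> \<le> 2 * 1 * \<bar>(y - x) / 2\<bar>"
    by (intro mult_mono abs_sin_x_le_abs_x) auto
  finally show ?thesis by simp
qed

text \<open>At frequency modulus \<open>r\<close> the system has the characteristic polynomial
  \<open>\<lambda>\<^sup>3 + r\<^sup>2 \<lambda>\<^sup>2 + (1 + r\<^sup>2) \<lambda> + r\<^sup>4\<close>, with exactly one real root \<open>-\<mu>\<close>.  Dividing by \<open>\<lambda> + \<mu>\<close> leaves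
  \<open>\<lambda>\<^sup>2 + b \<lambda> + c\<close>, a damped oscillator of frequency \<open>\<omega>\<close>.  The three coefficients of the cubic give the
  identities \<open>\<mu> + b = r\<^sup>2\<close>, \<open>c + \<mu> b = 1 + r\<^sup>2\<close> and \<open>\<mu> c = r\<^sup>4\<close>, from which all asymptotics of the roots
  for small and large \<open>r\<close> are read off without solving the cubic.\<close>

locale characteristic_root =
  fixes r \<mu> :: real
  assumes r: "r > 0" and \<mu>: "0 < \<mu>" "\<mu> < r\<^sup>2"
    and cubic: "\<mu> ^ 3 - r\<^sup>2 * \<mu>\<^sup>2 + (1 + r\<^sup>2) * \<mu> - r ^ 4 = 0"
begin

definition b where "b = r\<^sup>2 - \<mu>"
definition c where "c = 1 + r\<^sup>2 - \<mu> * b"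
definition \<omega> where "\<omega> = sqrt (c - b\<^sup>2 / 4)"
text \<open>The quadratic factor evaluated at the real root, which is the derivative of the cubic there.\<close>

definition D where "D = \<mu>\<^sup>2 - b * \<mu> + c"

lemma b_pos: "b > 0" using \<mu> by (simp add: b_def)

lemma b_le: "b \<le> r\<^sup>2" using \<mu> by (simp add: b_def)

lemma mult_c: "\<mu> * c = r ^ 4"
  using cubic unfolding c_def b_def by (simp add: algebra_simps power2_eq_square power3_eq_cube)

text \<open>The cubic equation at \<open>-\<mu>\<close>, solved for \<open>b\<close>; it shows that \<open>b\<close> is of order \<open>r\<^sup>2\<close> for small and of order
  \<open>r\<^sup>-\<^sup>2\<close> for large \<open>r\<close>.\<close>

lemma b_eq: "b * (\<mu>\<^sup>2 + r\<^sup>2) = \<mu>"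
  using cubic unfolding b_def by (simp add: algebra_simps power2_eq_square power3_eq_cube power4_eq_xxxx)

lemma mult_b_less_1: "\<mu> * b < 1"
proof -
  have "\<mu> * b * (\<mu>\<^sup>2 + r\<^sup>2) = \<mu>\<^sup>2" unfolding mult.assoc b_eq by (simp add: power2_eq_square)
  also have "\<dots> < 1 * (\<mu>\<^sup>2 + r\<^sup>2)" using r by simp
  finally show ?thesis by (rule mult_right_less_imp_less) simp
qed

lemma mult_b_le: "\<mu> * b \<le> r\<^sup>2"
proof -
  have "\<mu> * b * (\<mu>\<^sup>2 + r\<^sup>2) = \<mu>\<^sup>2" unfolding mult.assoc b_eq by (simp add: power2_eq_square)
  also have "\<dots> \<le> (r\<^sup>2)\<^sup>2" using \<mu> by (intro power_mono) auto
  also have "\<dots> \<le> r\<^sup>2 * (\<mu>\<^sup>2 + r\<^sup>2)"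
    unfolding power2_eq_square[of "r\<^sup>2"] by (intro mult_left_mono) auto
  finally show ?thesis
    by (rule mult_right_le_imp_le) (use r in \<open>auto intro: add_nonneg_pos\<close>)
qed

lemma c_ge: "c \<ge> 1" "c \<ge> r\<^sup>2" "c \<le> 1 + r\<^sup>2"
  using mult_b_less_1 mult_b_le mult_nonneg_nonneg[of \<mu> b] b_pos \<mu> by (auto simp: c_def)

lemma b_le_half: "2 * r * b \<le> 1"
proof -
  have "0 \<le> (\<mu> - r)\<^sup>2" by simp
  then have "2 * r * \<mu> \<le> \<mu>\<^sup>2 + r\<^sup>2" by (simp add: power2_diff mult_ac)
  then have "b * (2 * r * \<mu>) \<le> \<mu>" using b_pos b_eq by (metis mult_left_mono less_imp_le)
  then have "(2 * r * b) * \<mu> \<le> 1 * \<mu>" by (simp add: mult_ac)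
  then show ?thesis using \<mu> by simp
qed

lemma b_le_1: "b \<le> 1"
proof (cases "r \<le> 1")
  case True
  then have "r\<^sup>2 \<le> 1" using r by (simp add: power_le_one)
  then show ?thesis using b_le by simp
next
  case False
  then have "b * 1 \<le> b * (2 * r)" using b_pos by (intro mult_left_mono) auto
  then show ?thesis using b_le_half by (simp add: mult_ac)
qed

text \<open>The oscillator is underdamped at every frequency, so \<open>\<omega>\<close> is a genuine square root and bounded away
  from \<open>0\<close>.\<close>

lemma \<omega>_power2: "\<omega>\<^sup>2 = c - b\<^sup>2 / 4" and \<omega>_power2_ge: "\<omega>\<^sup>2 \<ge> 3 * c / 4"
proof -
  have "b\<^sup>2 \<le> c" using b_le_1 b_pos c_ge power_le_one[of b 2] by simp
  then have "c - b\<^sup>2 / 4 \<ge> 3 * c / 4" "3 * c / 4 \<ge> 0" using c_ge by auto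
  then show "\<omega>\<^sup>2 = c - b\<^sup>2 / 4" "\<omega>\<^sup>2 \<ge> 3 * c / 4" by (auto simp: \<omega>_def)
qed

lemma \<omega>_ge: "\<omega> \<ge> 1 / 2" "\<omega> \<ge> r / 2"
proof -
  have w: "\<omega> \<ge> 0" using \<omega>_power2_ge \<omega>_power2 c_ge by (simp add: \<omega>_def)
  show "\<omega> \<ge> 1 / 2"
    by (rule power2_le_imp_le[OF _ w]) (use \<omega>_power2_ge c_ge in \<open>auto simp: power_divide\<close>)
  show "\<omega> \<ge> r / 2"
    by (rule power2_le_imp_le[OF _ w]) (use \<omega>_power2_ge c_ge in \<open>auto simp: power_divide\<close>)
qed

lemma D_eq: "D = (\<mu> - b / 2)\<^sup>2 + \<omega>\<^sup>2"
  unfolding \<omega>_power2 by (simp add: D_def power2_eq_square algebra_simps)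

lemma D_ge: "D \<ge> 3 / 4"
  using D_eq \<omega>_power2_ge c_ge zero_le_power2[of "\<mu> - b / 2"] by linarith

end

text \<open>The system of \<open>cauchy_solution\<close> at a single frequency \<open>\<xi>\<close> with \<open>r = |\<xi>|\<close>.\<close>

locale frequency_solution = characteristic_root +
  fixes U U1 V :: "real \<Rightarrow> complex"
  assumes cont: "continuous_on {0..} U" "continuous_on {0..} U1" "continuous_on {0..} V"
    and dU: "\<And>t. t > 0 \<Longrightarrow> (U has_vector_derivative U1 t) (at t)"
    and dU1: "\<And>t. t > 0 \<Longrightarrow> (U1 has_vector_derivative (- (r\<^sup>2 *\<^sub>R U t) - V t)) (at t)"
    and dV: "\<And>t. t > 0 \<Longrightarrow> (V has_vector_derivative (- (r\<^sup>2 *\<^sub>R V t) + U1 t)) (at t)"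
begin

text \<open>The combination \<open>Y = (c - r\<^sup>2) U + b U' - V\<close>, which equals \<open>U'' + b U' + c U\<close>, satisfies \<open>Y' = -\<mu> Y\<close>.
  Subtracting the corresponding exponential \<open>A e\<^sup>-\<^sup>\<mu>\<^sup>t\<close> from \<open>U\<close> leaves a solution \<open>Z\<close> of the oscillator
  equation, and \<open>Z' - s Z\<close> is again an exponential for each root \<open>s\<close> of \<open>s\<^sup>2 + b s + c\<close>.\<close>

lemma solution_formula:
  fixes A :: complex
  assumes t: "t \<ge> 0"
  defines "A \<equiv> ((c - r\<^sup>2) * U 0 + b * U1 0 - V 0) / D"
  shows "U t = A * exp (- \<mu> * t) + exp (- b * t / 2) *
    (cos (\<omega> * t) * (U 0 - A) + sin (\<omega> * t) / \<omega> * (U1 0 + \<mu> * A + b / 2 * (U 0 - A)))"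
proof -
  have D0: "complex_of_real D \<noteq> 0" using D_ge by simp
  define Y where "Y t = of_real (c - r\<^sup>2) * U t + of_real b * U1 t - V t" for t
  have Y: "Y t = exp (of_real t * - of_real \<mu>) * Y 0" if "t \<ge> 0" for t
  proof (rule linear_ode_solution[OF _ _ that])
    show "continuous_on {0..} Y" unfolding Y_def by (intro continuous_intros cont)
    fix t :: real assume t: "t > 0"
    have 1: "c - r\<^sup>2 - 1 = - \<mu> * b" by (simp add: c_def)
    have 2: "b * r\<^sup>2 = \<mu> * (c - r\<^sup>2)" using mult_c by (simp add: b_def algebra_simps power2_eq_square power4_eq_xxxx)
    have "(Y has_vector_derivative (of_real (c - r\<^sup>2) * U1 t + of_real b * (- (r\<^sup>2 *\<^sub>R U t) - V t) -
        (- (r\<^sup>2 *\<^sub>R V t) + U1 t))) (at t)"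
      unfolding Y_def by (intro has_vector_derivative_add has_vector_derivative_diff has_vector_derivative_mult_right dU dU1 dV t)
    also have "of_real (c - r\<^sup>2) * U1 t + of_real b * (- (r\<^sup>2 *\<^sub>R U t) - V t) - (- (r\<^sup>2 *\<^sub>R V t) + U1 t) =
       of_real (c - r\<^sup>2 - 1) * U1 t - of_real (b * r\<^sup>2) * U t + of_real (r\<^sup>2 - b) * V t"
      by (simp add: scaleR_conv_of_real algebra_simps)
    also have "\<dots> = - of_real \<mu> * Y t"
      unfolding 1 2 by (simp add: Y_def b_def algebra_simps)
    finally show "(Y has_vector_derivative - of_real \<mu> * Y t) (at t)" .
  qed
  have YA: "Y 0 = of_real D * A" using D0 by (simp add: Y_def A_def)
  define e where "e t = exp (of_real t * - complex_of_real \<mu>)" for t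
  have de: "(e has_vector_derivative (- of_real \<mu> * e t)) (at t)" for t
    unfolding e_def by (rule exp_mult_has_vector_derivative)
  have ce: "continuous_on {0..} e" unfolding e_def by (intro continuous_intros)
  define Z where "Z t = U t - A * e t" for t
  define W where "W t = U1 t + of_real \<mu> * A * e t" for t
  have dZ: "(Z has_vector_derivative W t) (at t)" if "t > 0" for t
  proof -
    have "(Z has_vector_derivative (U1 t - A * (- of_real \<mu> * e t))) (at t)"
      unfolding Z_def by (intro has_vector_derivative_diff has_vector_derivative_mult_right dU de that)
    then show ?thesis by (simp add: W_def mult_ac)
  qed
  have dW: "(W has_vector_derivative (- of_real b * W t - of_real c * Z t)) (at t)" if "t > 0" for t
  proof -
    have "(W has_vector_derivative ((- (r\<^sup>2 *\<^sub>R U t) - V t) + of_real \<mu> * A * (- of_real \<mu> * e t))) (at t)"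
      unfolding W_def by (intro has_vector_derivative_add has_vector_derivative_mult_right dU1 de that)
    also have "- (r\<^sup>2 *\<^sub>R U t) - V t = of_real D * A * e t - of_real c * U t - of_real b * U1 t"
    proof -
      have "Y t = e t * (of_real D * A)" using Y[of t] that by (simp add: YA e_def)
      then show ?thesis unfolding Y_def by (simp add: scaleR_conv_of_real algebra_simps)
    qed
    also have "of_real D * A * e t - of_real c * U t - of_real b * U1 t + of_real \<mu> * A * (- of_real \<mu> * e t) =
       - of_real b * W t - of_real c * Z t"
      by (simp add: D_def W_def Z_def algebra_simps power2_eq_square)
    finally show ?thesis .
  qed
  have cZ: "continuous_on {0..} Z" and cW: "continuous_on {0..} W"
    unfolding Z_def W_def by (intro continuous_intros cont ce)+
  have osc: "W t - s2 * Z t = exp (of_real t * s1) * (W 0 - s2 * Z 0)"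
    if s: "s1 + s2 = - of_real b" "s1 * s2 = of_real c" for s1 s2
  proof (rule linear_ode_solution[OF _ _ t])
    show "continuous_on {0..} (\<lambda>t. W t - s2 * Z t)" by (intro continuous_intros cW cZ)
    fix t :: real assume "t > 0"
    then have "((\<lambda>t. W t - s2 * Z t) has_vector_derivative (- of_real b * W t - of_real c * Z t - s2 * W t)) (at t)"
      by (intro has_vector_derivative_diff has_vector_derivative_mult_right dW dZ)
    also have "- of_real b * W t - of_real c * Z t - s2 * W t = s1 * (W t - s2 * Z t)"
      unfolding s[symmetric] by (simp add: algebra_simps)
    finally show "((\<lambda>t. W t - s2 * Z t) has_vector_derivative s1 * (W t - s2 * Z t)) (at t)" .
  qed
  define s where "s = Complex (- b / 2) \<omega>"
  have s1: "s + cnj s = - of_real b" "cnj s + s = - of_real b" by (auto simp: s_def complex_eq_iff)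
  have s2: "s * cnj s = of_real c" "cnj s * s = of_real c"
    using \<omega>_power2 by (auto simp: s_def complex_eq_iff power2_eq_square)
  have w0: "complex_of_real \<omega> \<noteq> 0" using \<omega>_ge by auto
  have ss: "s - cnj s = 2 * \<i> * of_real \<omega>" by (auto simp: s_def complex_eq_iff)
  have es: "exp (of_real t * s) = of_real (exp (- b * t / 2)) * (of_real (cos (\<omega> * t)) + \<i> * of_real (sin (\<omega> * t)))"
    and es': "exp (of_real t * cnj s) = of_real (exp (- b * t / 2)) * (of_real (cos (\<omega> * t)) - \<i> * of_real (sin (\<omega> * t)))"
    by (auto simp: s_def exp_eq_polar complex_eq_iff mult_ac)
  have sb: "s = - of_real b / 2 + \<i> * of_real \<omega>" "cnj s = - of_real b / 2 - \<i> * of_real \<omega>"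
    by (auto simp: s_def complex_eq_iff)
  have "2 * \<i> * of_real \<omega> * Z t = (W t - cnj s * Z t) - (W t - s * Z t)"
    unfolding ss[symmetric] by (simp add: algebra_simps)
  also have "\<dots> = exp (of_real t * s) * (W 0 - cnj s * Z 0) - exp (of_real t * cnj s) * (W 0 - s * Z 0)"
    using osc[OF s1(1) s2(1)] osc[OF s1(2) s2(2)] by simp
  also have "\<dots> = 2 * \<i> * of_real \<omega> * (of_real (exp (- b * t / 2)) *
     (of_real (cos (\<omega> * t)) * Z 0 + of_real (sin (\<omega> * t)) / of_real \<omega> * (W 0 + of_real b / 2 * Z 0)))"
    unfolding es es' unfolding sb using w0 by (simp add: field_simps)
  finally have "Z t = of_real (exp (- b * t / 2)) *
     (of_real (cos (\<omega> * t)) * Z 0 + of_real (sin (\<omega> * t)) / of_real \<omega> * (W 0 + of_real b / 2 * Z 0))"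
    using w0 by simp
  moreover have "Z 0 = U 0 - A" "W 0 = U1 0 + of_real \<mu> * A" by (auto simp: Z_def W_def e_def)
  moreover have "U t = A * e t + Z t" by (simp add: Z_def)
  moreover have "e t = of_real (exp (- \<mu> * t))" by (simp add: e_def exp_of_real mult_ac flip: of_real_mult of_real_minus)
  ultimately show ?thesis by simp
qed


text \<open>For small \<open>r\<close> the identities give \<open>c = 1 + O(r\<^sup>2)\<close>, hence \<open>\<mu> = r\<^sup>4 + O(r\<^sup>6)\<close>, and \<open>A\<close> differs from
  \<open>u\<^sub>0 - v\<^sub>0\<close> by \<open>O(r\<^sup>2)\<close>; the oscillator part decays at the parabolic rate because \<open>b\<close> is of order \<open>r\<^sup>2\<close>.\<close>

lemma low_frequency_bound:
  assumes r1: "r \<le> 1" and t: "t \<ge> 0"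
  shows "cmod (U t - exp (- (r ^ 4 * t)) * (U 0 - V 0)) \<le>
    21 * (exp (- (r\<^sup>2 * t / 8)) + r\<^sup>2 * exp (- (r ^ 4 * t / 4))) * (cmod (U 0) + cmod (U1 0) + cmod (V 0))"
proof -
  define A where "A = ((c - r\<^sup>2) * U 0 + b * U1 0 - V 0) / D"
  define S where "S = cmod (U 0) + cmod (U1 0) + cmod (V 0)"
  have S: "cmod (U 0) \<le> S" "cmod (U1 0) \<le> S" "cmod (V 0) \<le> S" "S \<ge> 0" by (auto simp: S_def)
  have r2: "r\<^sup>2 \<le> 1" using r r1 by (simp add: power_le_one)
  have r4: "r ^ 4 \<le> r\<^sup>2" using r r1 by (intro power_decreasing) auto
  have \<mu>2: "\<mu>\<^sup>2 \<le> r\<^sup>2" "\<mu> \<le> 1"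
  proof -
    show "\<mu> \<le> 1" using \<mu> r2 by simp
    have "\<mu>\<^sup>2 \<le> (r\<^sup>2)\<^sup>2" using \<mu> by (intro power_mono) auto
    then show "\<mu>\<^sup>2 \<le> r\<^sup>2" using r4 by (simp flip: power_mult)
  qed
  have \<mu>b: "0 \<le> \<mu> * b" using \<mu> b_pos by simp
  have D0: "complex_of_real D \<noteq> 0" using D_ge by simp
  have Dc: "D = \<mu>\<^sup>2 + 2 * c - 1 - r\<^sup>2" by (simp add: D_def c_def)
  \<comment> \<open>over the common denominator \<open>D\<close>, every coefficient is \<open>O(r\<^sup>2)\<close>\<close>
  have "A - (U 0 - V 0) = (of_real (c - r\<^sup>2 - D) * U 0 + of_real b * U1 0 + of_real (D - 1) * V 0) / of_real D"
    using D0 by (simp add: A_def field_simps)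
  moreover have "cmod (of_real (c - r\<^sup>2 - D) * U 0 + of_real b * U1 0 + of_real (D - 1) * V 0) \<le> 2 * r\<^sup>2 * S"
  proof -
    have "cmod (of_real (c - r\<^sup>2 - D) * U 0 + of_real b * U1 0 + of_real (D - 1) * V 0) \<le>
       \<bar>c - r\<^sup>2 - D\<bar> * cmod (U 0) + \<bar>b\<bar> * cmod (U1 0) + \<bar>D - 1\<bar> * cmod (V 0)"
      by (intro order_trans[OF norm_triangle_ineq] add_mono) (simp_all only: norm_mult norm_of_real order_refl)
    also have "\<dots> \<le> 2 * r\<^sup>2 * cmod (U 0) + 2 * r\<^sup>2 * cmod (U1 0) + 2 * r\<^sup>2 * cmod (V 0)"
    proof (intro add_mono mult_right_mono norm_ge_zero)
      have 0: "0 \<le> \<mu>\<^sup>2" "0 \<le> r\<^sup>2" by simp_all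
      show "\<bar>c - r\<^sup>2 - D\<bar> \<le> 2 * r\<^sup>2" "\<bar>D - 1\<bar> \<le> 2 * r\<^sup>2" "\<bar>b\<bar> \<le> 2 * r\<^sup>2"
        unfolding Dc abs_le_iff using 0 c_ge \<mu>2 b_pos b_le by linarith+
    qed
    finally show ?thesis by (simp add: S_def algebra_simps)
  qed
  ultimately have "cmod (A - (U 0 - V 0)) * D \<le> 2 * r\<^sup>2 * S"
    using D_ge by (simp add: norm_divide)
  moreover have "cmod (A - (U 0 - V 0)) * (3 / 4) \<le> cmod (A - (U 0 - V 0)) * D"
    using D_ge by (intro mult_left_mono) auto
  ultimately have A1: "cmod (A - (U 0 - V 0)) \<le> 3 * r\<^sup>2 * S"
    using mult_nonneg_nonneg[OF zero_le_power2[of r] S(4)] by simp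
  have UV: "cmod (U 0 - V 0) \<le> S"
    using norm_triangle_ineq4[of "U 0" "V 0"] norm_ge_zero[of "U1 0"] unfolding S_def by linarith
  have A2: "cmod A \<le> 4 * S"
  proof -
    have "cmod A \<le> cmod (A - (U 0 - V 0)) + cmod (U 0 - V 0)"
      using norm_triangle_ineq[of "A - (U 0 - V 0)" "U 0 - V 0"] by simp
    also have "\<dots> \<le> 3 * 1 * S + S"
    proof (rule add_mono)
      show "cmod (A - (U 0 - V 0)) \<le> 3 * 1 * S" using A1 mult_right_mono[OF r2 S(4)] by simp
      show "cmod (U 0 - V 0) \<le> S" by (rule UV)
    qed
    finally show ?thesis by simp
  qed
  have Z0: "cmod (U 0 - A) \<le> 5 * S" using norm_triangle_ineq4[of "U 0" A] A2 S by simp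
  define Q where "Q = U1 0 + \<mu> * A + b / 2 * (U 0 - A)"
  have Q: "cmod Q \<le> 8 * S"
  proof -
    have "cmod Q \<le> cmod (U1 0) + \<mu> * cmod A + b / 2 * cmod (U 0 - A)"
      unfolding Q_def
      by (intro order_trans[OF norm_triangle_ineq] add_mono) (use \<mu> b_pos in \<open>simp_all add: norm_mult norm_divide\<close>)
    also have "\<dots> \<le> S + 1 * (4 * S) + 1 / 2 * (5 * S)"
      using \<mu>2 \<mu> b_pos b_le_1 S by (intro add_mono mult_mono A2 Z0) auto
    finally show ?thesis using S by simp
  qed
  have b_ge: "r\<^sup>2 / 4 \<le> b"
  proof -
    have "r ^ 4 \<le> \<mu> * 2"
      unfolding mult_c[symmetric] using c_ge r2 \<mu> by (intro mult_left_mono) auto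
    have "r\<^sup>2 * (\<mu>\<^sup>2 + r\<^sup>2) \<le> r\<^sup>2 * (2 * r\<^sup>2)" using \<mu>2 by (intro mult_left_mono) auto
    also have "\<dots> \<le> 4 * \<mu>" using \<open>r ^ 4 \<le> \<mu> * 2\<close> by (simp add: power2_eq_square power4_eq_xxxx)
    also have "\<dots> = (4 * b) * (\<mu>\<^sup>2 + r\<^sup>2)" using b_eq by simp
    finally have "r\<^sup>2 \<le> 4 * b"
      by (rule mult_right_le_imp_le) (use r in \<open>auto intro: add_nonneg_pos\<close>)
    then show ?thesis by simp
  qed
  have \<mu>_ge: "r ^ 4 / 2 \<le> \<mu>"
  proof -
    have "r ^ 4 \<le> \<mu> * 2"
      unfolding mult_c[symmetric] using c_ge r2 \<mu> by (intro mult_left_mono) auto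
    then show ?thesis by simp
  qed
  have \<mu>_le: "\<mu> \<le> r ^ 4"
    unfolding mult_c[symmetric] using c_ge \<mu> by simp
  have \<mu>_diff: "r ^ 4 - \<mu> \<le> r ^ 4 * r\<^sup>2"
  proof -
    have "r ^ 4 - \<mu> = \<mu> * (c - 1)" using mult_c by (simp add: algebra_simps)
    also have "\<dots> \<le> r ^ 4 * r\<^sup>2" using c_ge \<mu>_le \<mu> by (intro mult_mono) auto
    finally show ?thesis .
  qed
  have e1: "exp (- \<mu> * t) \<le> exp (- (r ^ 4 * t / 4))"
  proof -
    have "r ^ 4 / 4 \<le> \<mu>" using \<mu>_ge zero_le_power[of r 4] r by linarith
    then have "r ^ 4 / 4 * t \<le> \<mu> * t" using t by (intro mult_right_mono) auto
    then show ?thesis by simp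
  qed
  have e2: "\<bar>exp (- \<mu> * t) - exp (- (r ^ 4 * t))\<bar> \<le> 4 * r\<^sup>2 * exp (- (r ^ 4 * t / 4))"
  proof -
    have "r ^ 4 / 2 * t \<le> \<mu> * t" "\<mu> * t \<le> r ^ 4 * t"
      using mult_right_mono[OF \<mu>_ge t] mult_right_mono[OF \<mu>_le t] by blast+
    then have "\<bar>exp (- (\<mu> * t)) - exp (- (r ^ 4 * t))\<bar> \<le> \<bar>\<mu> * t - r ^ 4 * t\<bar> * exp (- (r ^ 4 / 2 * t))"
      by (intro exp_neg_diff_le) linarith+
    also have "\<bar>\<mu> * t - r ^ 4 * t\<bar> = (r ^ 4 - \<mu>) * t"
      using \<open>\<mu> * t \<le> r ^ 4 * t\<close> by (simp add: algebra_simps)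
    also have "(r ^ 4 - \<mu>) * t * exp (- (r ^ 4 / 2 * t)) \<le> (r ^ 4 * r\<^sup>2) * t * exp (- (r ^ 4 / 2 * t))"
      using t by (intro mult_right_mono \<mu>_diff) auto
    also have "\<dots> = r\<^sup>2 * ((r ^ 4 * t) * exp (- (1 / 2) * (r ^ 4 * t)))" by (simp add: mult_ac)
    also have "\<dots> \<le> r\<^sup>2 * ((2 / (1 / 2)) * exp (- (1 / 2) * (r ^ 4 * t) / 2))"
      by (intro mult_left_mono mult_exp_neg_le) auto
    finally show ?thesis by simp
  qed
  have eb: "exp (- b * t / 2) \<le> exp (- (r\<^sup>2 * t / 8))"
  proof -
    have "r\<^sup>2 / 4 * t \<le> b * t" using b_ge t by (intro mult_right_mono) auto
    then show ?thesis unfolding exp_le_cancel_iff by linarith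
  qed
  define P where "P = cos (\<omega> * t) * (U 0 - A) + sin (\<omega> * t) / \<omega> * Q"
  have P: "cmod P \<le> 21 * S"
  proof -
    have sw: "\<bar>sin (\<omega> * t) / \<omega>\<bar> \<le> 2"
    proof -
      have "\<bar>sin (\<omega> * t) / \<omega>\<bar> \<le> 1 / (1 / 2)"
        unfolding abs_divide using \<omega>_ge(1) by (intro frac_le) auto
      then show ?thesis by simp
    qed
    have "cmod P \<le> \<bar>cos (\<omega> * t)\<bar> * cmod (U 0 - A) + \<bar>sin (\<omega> * t) / \<omega>\<bar> * cmod Q"
      unfolding P_def by (rule order_trans[OF norm_triangle_ineq]) (simp only: norm_mult norm_of_real order_refl flip: of_real_divide)
    also have "\<dots> \<le> 1 * (5 * S) + 2 * (8 * S)"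
      using S sw by (intro add_mono mult_mono Z0 Q) auto
    finally show ?thesis by simp
  qed
  have "U t = A * exp (- \<mu> * t) + exp (- b * t / 2) * P"
    using solution_formula[OF t] unfolding A_def[symmetric] P_def Q_def by simp
  then have "U t - exp (- (r ^ 4 * t)) * (U 0 - V 0) =
    of_real (exp (- \<mu> * t)) * (A - (U 0 - V 0)) + of_real (exp (- \<mu> * t) - exp (- (r ^ 4 * t))) * (U 0 - V 0)
     + of_real (exp (- b * t / 2)) * P"
    by (simp add: algebra_simps)
  also have "cmod \<dots> \<le> exp (- \<mu> * t) * cmod (A - (U 0 - V 0)) + \<bar>exp (- \<mu> * t) - exp (- (r ^ 4 * t))\<bar> * cmod (U 0 - V 0)
     + exp (- b * t / 2) * cmod P"
    by (intro order_trans[OF norm_triangle_ineq] add_mono) (simp_all only: norm_mult norm_of_real abs_exp_cancel order_refl)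
  also have "\<dots> \<le> exp (- (r ^ 4 * t / 4)) * (3 * r\<^sup>2 * S) + (4 * r\<^sup>2 * exp (- (r ^ 4 * t / 4))) * S + exp (- (r\<^sup>2 * t / 8)) * (21 * S)"
    using S r by (intro add_mono mult_mono e1 e2 eb A1 P UV) auto
  also have "\<dots> \<le> 21 * (exp (- (r\<^sup>2 * t / 8)) + r\<^sup>2 * exp (- (r ^ 4 * t / 4))) * S"
    using S by (simp add: algebra_simps)
  finally show ?thesis by (simp add: S_def)
qed

text \<open>For large \<open>r\<close> the real root is of order \<open>r\<^sup>2\<close> and its coefficient \<open>A\<close> is small.  The oscillator
  carries the wave: \<open>b = r\<^sup>-\<^sup>2 + O(r\<^sup>-\<^sup>4)\<close> and \<open>\<omega> = r + O(r\<^sup>-\<^sup>3)\<close>.  These errors are multiplied by \<open>t\<close> in the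
  exponent and the phase, which costs a factor \<open>r\<^sup>2\<close> because \<open>x e\<^sup>-\<^sup>x\<^sup>/\<^sup>8\<close> with \<open>x = t / r\<^sup>2\<close> is
  bounded by \<open>16 e\<^sup>-\<^sup>x\<^sup>/\<^sup>1\<^sup>6\<close>; the phase error becomes the factor \<open>r\<^sup>-\<^sup>1\<close> in the bound.\<close>

lemma high_frequency_bound:
  assumes r1: "r \<ge> 1" and t: "t \<ge> 0"
  shows "cmod (U t - cos (r * t) * exp (- (t / (2 * r\<^sup>2))) * U 0) \<le>
    500 * exp (- (t / (16 * r\<^sup>2))) * (cmod (U 0) / r + cmod (U1 0) / r + cmod (V 0) / r ^ 3)"
proof -
  define A where "A = ((c - r\<^sup>2) * U 0 + b * U1 0 - V 0) / D"
  define B where "B = cmod (U 0) / r + cmod (U1 0) / r + cmod (V 0) / r ^ 3"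
  define x where "x = t / r\<^sup>2"
  have x: "x \<ge> 0" using t by (simp add: x_def)
  have B: "B \<ge> 0" "cmod (U 0) / r \<le> B" "cmod (U1 0) / r \<le> B" "cmod (V 0) / r ^ 3 \<le> B"
    using r by (auto simp: B_def)
  have r2: "r\<^sup>2 \<ge> 1" using r1 by simp
  have r2i: "1 / r\<^sup>2 \<le> 1" using frac_le[of 1 1 1 "r\<^sup>2"] r2 by simp
  have r_r2: "r \<le> r\<^sup>2" using r1 by (simp add: power2_eq_square)
  have b_half: "b \<le> 1 / 2"
  proof -
    have "1 * b \<le> r * b" using r1 b_pos by (intro mult_right_mono) auto
    then show ?thesis using b_le_half by simp
  qed
  have \<mu>_ge: "\<mu> \<ge> r\<^sup>2 / 2" using b_half r2 by (simp add: b_def)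
  have b_le': "b \<le> 2 / r\<^sup>2"
  proof -
    have "r\<^sup>2 / 2 * b \<le> \<mu> * b" using \<mu>_ge b_pos by (intro mult_right_mono) auto
    then have "r\<^sup>2 / 2 * b \<le> 1" using mult_b_less_1 by simp
    then show ?thesis using r by (simp add: field_simps)
  qed
  have c_le: "c - r\<^sup>2 \<le> 4 / r\<^sup>2"
  proof -
    \<comment> \<open>\<open>c - r\<^sup>2 = 1 - \<mu> b = r\<^sup>2 / (\<mu>\<^sup>2 + r\<^sup>2)\<close> with \<open>\<mu>\<close> of order \<open>r\<^sup>2\<close>\<close>
    have "(c - r\<^sup>2) * (r\<^sup>2 / 2)\<^sup>2 \<le> (c - r\<^sup>2) * (\<mu>\<^sup>2 + r\<^sup>2)"
    proof (intro mult_left_mono)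
      have "(r\<^sup>2 / 2)\<^sup>2 \<le> \<mu>\<^sup>2" using \<mu>_ge by (intro power_mono) auto
      then show "(r\<^sup>2 / 2)\<^sup>2 \<le> \<mu>\<^sup>2 + r\<^sup>2" by (simp add: add_increasing2)
    qed (use c_ge in simp)
    also have "\<dots> = \<mu>\<^sup>2 + r\<^sup>2 - \<mu> * (b * (\<mu>\<^sup>2 + r\<^sup>2))" by (simp add: c_def algebra_simps)
    also have "\<dots> = r\<^sup>2" unfolding b_eq by (simp add: power2_eq_square)
    finally have "(c - r\<^sup>2) * r\<^sup>2 * (r\<^sup>2 / 4) \<le> 4 / 4 * r\<^sup>2" by (simp add: power2_eq_square mult_ac)
    then have "((c - r\<^sup>2) * r\<^sup>2) * (r\<^sup>2 / 4) \<le> 4 * (r\<^sup>2 / 4)" by simp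
    then have "(c - r\<^sup>2) * r\<^sup>2 \<le> 4" by (rule mult_right_le_imp_le) (use r in simp)
    then show ?thesis using r by (simp add: field_simps)
  qed
  have D_ge': "D \<ge> r ^ 4 / 16"
  proof -
    have "r\<^sup>2 / 4 \<le> \<mu> - b / 2" using \<mu>_ge b_half r2 by simp
    then have "(r\<^sup>2 / 4)\<^sup>2 \<le> (\<mu> - b / 2)\<^sup>2" by (intro power_mono) auto
    then show ?thesis unfolding D_eq by (simp add: power_divide add_increasing2 flip: power_mult)
  qed
  define a where "a = cmod A"
  have a: "a \<ge> 0" by (simp add: a_def)
  have a_le: "r * a \<le> 64 * B"
  proof -
    have "a * D = cmod (of_real (c - r\<^sup>2) * U 0 + of_real b * U1 0 - V 0)"
      using D_ge by (simp add: a_def A_def norm_divide)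
    also have "\<dots> \<le> (c - r\<^sup>2) * cmod (U 0) + b * cmod (U1 0) + cmod (V 0)"
      using c_ge b_pos
      by (intro order_trans[OF norm_triangle_ineq4] add_mono order_trans[OF norm_triangle_ineq])
        (simp_all only: norm_mult norm_of_real abs_of_nonneg order_refl less_imp_le diff_ge_0_iff_ge)
    also have "\<dots> \<le> 4 / r\<^sup>2 * cmod (U 0) + 4 / r\<^sup>2 * cmod (U1 0) + 4 * cmod (V 0)"
      using c_le b_le' r
      by (intro add_mono mult_right_mono) (auto intro: order_trans[OF b_le' divide_right_mono])
    also have "\<dots> \<le> 4 * r ^ 3 * B"
    proof -
      have "1 / r\<^sup>2 * cmod (U 0) \<le> r\<^sup>2 * cmod (U 0)" "1 / r\<^sup>2 * cmod (U1 0) \<le> r\<^sup>2 * cmod (U1 0)"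
      proof -
        have "1 / r\<^sup>2 \<le> 1" by (rule r2i)
        then have "1 / r\<^sup>2 \<le> r\<^sup>2" using r2 by linarith
        then show "1 / r\<^sup>2 * cmod (U 0) \<le> r\<^sup>2 * cmod (U 0)" "1 / r\<^sup>2 * cmod (U1 0) \<le> r\<^sup>2 * cmod (U1 0)"
          by (rule mult_right_mono; simp)+
      qed
      moreover have "r ^ 3 * B = r\<^sup>2 * cmod (U 0) + r\<^sup>2 * cmod (U1 0) + cmod (V 0)"
        using r by (simp add: B_def field_simps power2_eq_square power3_eq_cube)
      ultimately show ?thesis by simp
    qed
    finally have "a * D \<le> 4 * r ^ 3 * B" .
    moreover have "a * (r ^ 4 / 16) \<le> a * D" using D_ge' a by (intro mult_left_mono)
    ultimately have "(r * a) * (r ^ 3 / 16) \<le> (64 * B) * (r ^ 3 / 16)"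
      by (simp add: power3_eq_cube power4_eq_xxxx mult_ac)
    then show ?thesis by (rule mult_right_le_imp_le) (use r in simp)
  qed
  have a_le': "a \<le> 64 * B" using mult_right_mono[OF r1 a] a_le by simp
  define Q where "Q = U1 0 + \<mu> * A + b / 2 * (U 0 - A)"
  have sw: "\<bar>sin (\<omega> * t) / \<omega>\<bar> \<le> 2 / r"
  proof -
    have "\<bar>sin (\<omega> * t) / \<omega>\<bar> \<le> 1 / (r / 2)"
      unfolding abs_divide using \<omega>_ge r by (intro frac_le) auto
    then show ?thesis by simp
  qed
  have Q: "cmod Q \<le> r * B + r * (64 * B) + 1 / 2 * (r * B + 64 * B)"
  proof -
    have rB: "cmod (U 0) \<le> r * B" "cmod (U1 0) \<le> r * B" using B r by (auto simp: field_simps)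
    have "cmod Q \<le> cmod (U1 0) + \<mu> * a + b / 2 * cmod (U 0 - A)"
      unfolding Q_def a_def
      by (intro order_trans[OF norm_triangle_ineq] add_mono) (use \<mu> b_pos in \<open>simp_all add: norm_mult norm_divide\<close>)
    also have "\<dots> \<le> cmod (U1 0) + r * (r * a) + 1 / 2 * (cmod (U 0) + a)"
    proof (intro add_mono order_refl)
      show "\<mu> * a \<le> r * (r * a)"
        using mult_right_mono[of \<mu> "r\<^sup>2" a] \<mu> a by (simp add: power2_eq_square mult.assoc)
      show "b / 2 * cmod (U 0 - A) \<le> 1 / 2 * (cmod (U 0) + a)"
        using b_half b_pos norm_triangle_ineq4[of "U 0" A] by (intro mult_mono) (auto simp: a_def)
    qed
    also have "\<dots> \<le> r * B + r * (64 * B) + 1 / 2 * (r * B + 64 * B)"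
      using r by (intro add_mono mult_left_mono a_le a_le' rB) auto
    finally show ?thesis .
  qed
  have wQ: "cmod (of_real (sin (\<omega> * t) / \<omega>) * Q) \<le> 195 * B"
  proof -
    have "cmod (of_real (sin (\<omega> * t) / \<omega>) * Q) \<le> (2 / r) * (r * B + r * (64 * B) + 1 / 2 * (r * B + 64 * B))"
      unfolding norm_mult norm_of_real using r by (intro mult_mono Q sw) auto
    also have "\<dots> = 131 * B + 64 * (B / r)" using r by (simp add: field_simps)
    also have "B / r \<le> B / 1" using B r1 by (intro divide_left_mono) auto
    finally show ?thesis by simp
  qed
  have b_ge: "1 / (4 * r\<^sup>2) \<le> b"
  proof -
    have "r\<^sup>2 \<le> r ^ 4" using r1 by (intro power_increasing) auto
    moreover have "\<mu>\<^sup>2 \<le> (r\<^sup>2)\<^sup>2" using \<mu> by (intro power_mono) auto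
    ultimately have *: "\<mu>\<^sup>2 + r\<^sup>2 \<le> 2 * r ^ 4" by (simp flip: power_mult)
    have "r\<^sup>2 / 2 \<le> b * (\<mu>\<^sup>2 + r\<^sup>2)" using \<mu>_ge b_eq by simp
    also have "\<dots> \<le> b * (2 * r ^ 4)" using * b_pos by (intro mult_left_mono) auto
    finally have "1 * (r\<^sup>2 / 2) \<le> (4 * r\<^sup>2 * b) * (r\<^sup>2 / 2)" by (simp add: power2_eq_square power4_eq_xxxx mult_ac)
    then have "1 \<le> 4 * r\<^sup>2 * b" by (rule mult_right_le_imp_le) (use r in simp)
    then show ?thesis using r by (simp add: field_simps)
  qed
  have b2: "b\<^sup>2 \<le> 4 / r\<^sup>2"
  proof -
    have "b\<^sup>2 \<le> b * 1" using b_le_1 b_pos by (simp add: power2_eq_square)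
    also have "\<dots> \<le> 4 / r\<^sup>2" using b_le' r by (simp add: order_trans[OF b_le'] divide_right_mono)
    finally show ?thesis .
  qed
  have eb: "exp (- b * t / 2) \<le> exp (- (x / 8))"
  proof -
    have "1 / (4 * r\<^sup>2) * t \<le> b * t" using b_ge t by (intro mult_right_mono) auto
    then show ?thesis by (simp add: x_def)
  qed
  have e16: "exp (- (x / 8)) \<le> exp (- (x / 16))" using x by simp
  have x16: "x * exp (- (x / 8)) \<le> 16 * exp (- (x / 16))"
    using mult_exp_neg_le[of "1 / 8" x] by simp
  have e\<mu>: "exp (- \<mu> * t) \<le> exp (- (x / 16))"
  proof -
    have "1 / r\<^sup>2 / 16 \<le> \<mu>" using \<mu>_ge r2 divide_right_mono[OF r2i, of 16] by linarith
    then have "1 / r\<^sup>2 / 16 * t \<le> \<mu> * t" using t by (intro mult_right_mono) auto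
    then show ?thesis by (simp add: x_def)
  qed
  have main1: "\<bar>exp (- (b * t / 2)) - exp (- (t / (2 * r\<^sup>2)))\<bar> \<le> 32 / r * exp (- (x / 16))"
  proof -
    have "r\<^sup>2 * b = \<mu> * b + b\<^sup>2" by (simp add: b_def algebra_simps power2_eq_square)
    then have "1 - r\<^sup>2 * b = (c - r\<^sup>2) - b\<^sup>2" by (simp add: c_def)
    then have "\<bar>1 - r\<^sup>2 * b\<bar> \<le> 4 / r\<^sup>2"
      unfolding abs_le_iff using c_le c_ge(2) b2 zero_le_power2[of b] by linarith
    moreover have "\<bar>b * t / 2 - t / (2 * r\<^sup>2)\<bar> = \<bar>1 - r\<^sup>2 * b\<bar> * x / 2"
    proof -
      have "b * t / 2 - t / (2 * r\<^sup>2) = - ((1 - r\<^sup>2 * b) * x / 2)" using r by (simp add: x_def field_simps)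
      then show ?thesis using x by (simp add: abs_mult)
    qed
    ultimately have d: "\<bar>b * t / 2 - t / (2 * r\<^sup>2)\<bar> \<le> 2 / r\<^sup>2 * x"
      using mult_right_mono[OF _ x, of "\<bar>1 - r\<^sup>2 * b\<bar>" "4 / r\<^sup>2"] by simp
    have "\<bar>exp (- (b * t / 2)) - exp (- (t / (2 * r\<^sup>2)))\<bar> \<le> \<bar>b * t / 2 - t / (2 * r\<^sup>2)\<bar> * exp (- (x / 8))"
    proof (rule exp_neg_diff_le)
      show "x / 8 \<le> b * t / 2" using eb by simp
      show "x / 8 \<le> t / (2 * r\<^sup>2)" using x by (simp add: x_def)
    qed
    also have "\<dots> \<le> 2 / r\<^sup>2 * x * exp (- (x / 8))" by (intro mult_right_mono d) auto
    also have "\<dots> \<le> 2 / r\<^sup>2 * (16 * exp (- (x / 16)))"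
      unfolding mult.assoc by (intro mult_left_mono x16) auto
    also have "\<dots> \<le> 2 / r * (16 * exp (- (x / 16)))"
      using r_r2 r by (intro mult_right_mono divide_left_mono) auto
    finally show ?thesis by simp
  qed
  have main2: "exp (- (b * t / 2)) * \<bar>cos (\<omega> * t) - cos (r * t)\<bar> \<le> 64 / r * exp (- (x / 16))"
  proof -
    have "(\<omega> - r) * (\<omega> + r) = c - r\<^sup>2 - b\<^sup>2 / 4"
      using \<omega>_power2 by (simp add: algebra_simps power2_eq_square)
    then have "\<bar>(\<omega> - r) * (\<omega> + r)\<bar> \<le> 4 / r\<^sup>2"
      unfolding abs_le_iff using c_le c_ge(2) b2 zero_le_power2[of b] by linarith
    moreover have "\<bar>\<omega> - r\<bar> * r \<le> \<bar>\<omega> - r\<bar> * \<bar>\<omega> + r\<bar>"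
      using \<omega>_ge r by (intro mult_left_mono) auto
    ultimately have "\<bar>\<omega> - r\<bar> * r \<le> 4 / r\<^sup>2" by (simp add: abs_mult)
    then have w: "\<bar>\<omega> - r\<bar> \<le> 4 / r\<^sup>2 / r" using r by (simp add: field_simps)
    have "\<bar>cos (\<omega> * t) - cos (r * t)\<bar> \<le> \<bar>\<omega> * t - r * t\<bar>" by (rule abs_cos_diff_le)
    also have "\<dots> = \<bar>\<omega> - r\<bar> * t" using t by (simp add: abs_mult flip: left_diff_distrib)
    also have "\<dots> \<le> 4 / r\<^sup>2 / r * t" using t by (intro mult_right_mono w)
    also have "\<dots> = 4 / r * x" by (simp add: x_def)
    finally have "exp (- (b * t / 2)) * \<bar>cos (\<omega> * t) - cos (r * t)\<bar> \<le> exp (- (x / 8)) * (4 / r * x)"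
      using eb x r by (intro mult_mono) auto
    also have "\<dots> = 4 / r * (x * exp (- (x / 8)))" by simp
    also have "\<dots> \<le> 4 / r * (16 * exp (- (x / 16)))" using r by (intro mult_left_mono x16) auto
    finally show ?thesis by simp
  qed
  \<comment> \<open>the error of replacing damping and frequency of the oscillator by their leading terms\<close>
  define K where "K = exp (- (b * t / 2)) * cos (\<omega> * t) - exp (- (t / (2 * r\<^sup>2))) * cos (r * t)"
  have K: "\<bar>K\<bar> \<le> 96 / r * exp (- (x / 16))"
  proof -
    have "K = exp (- (b * t / 2)) * (cos (\<omega> * t) - cos (r * t)) + (exp (- (b * t / 2)) - exp (- (t / (2 * r\<^sup>2)))) * cos (r * t)"
      by (simp add: K_def algebra_simps)
    then have "\<bar>K\<bar> \<le> exp (- (b * t / 2)) * \<bar>cos (\<omega> * t) - cos (r * t)\<bar> + \<bar>exp (- (b * t / 2)) - exp (- (t / (2 * r\<^sup>2)))\<bar> * \<bar>cos (r * t)\<bar>"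
      by (metis abs_triangle_ineq abs_mult abs_exp_cancel)
    also have "\<dots> \<le> 64 / r * exp (- (x / 16)) + 32 / r * exp (- (x / 16)) * 1"
      using r by (intro add_mono mult_mono main1 main2) auto
    finally show ?thesis by (simp add: field_simps)
  qed
  have "U t = A * exp (- \<mu> * t) + exp (- b * t / 2) * (cos (\<omega> * t) * (U 0 - A) + sin (\<omega> * t) / \<omega> * Q)"
    using solution_formula[OF t] unfolding A_def[symmetric] Q_def by simp
  then have "U t - cos (r * t) * exp (- (t / (2 * r\<^sup>2))) * U 0 =
     of_real (exp (- \<mu> * t)) * A + of_real (exp (- b * t / 2)) * (of_real (- cos (\<omega> * t)) * A + of_real (sin (\<omega> * t) / \<omega>) * Q)
      + of_real K * U 0"
    by (simp add: K_def algebra_simps)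
  also have "cmod \<dots> \<le> exp (- \<mu> * t) * a + exp (- b * t / 2) * (\<bar>- cos (\<omega> * t)\<bar> * a + cmod (of_real (sin (\<omega> * t) / \<omega>) * Q)) + \<bar>K\<bar> * cmod (U 0)"
    unfolding a_def
    by (intro order_trans[OF norm_triangle_ineq] add_mono; (simp only: norm_mult norm_of_real abs_exp_cancel order_refl)?)
      (intro mult_left_mono order_trans[OF norm_triangle_ineq], simp_all only: norm_mult norm_of_real order_refl exp_ge_zero)
  also have "\<dots> \<le> exp (- (x / 16)) * (64 * B) + exp (- (x / 16)) * (1 * (64 * B) + 195 * B) + 96 / r * exp (- (x / 16)) * cmod (U 0)"
    using a a_le' wQ e\<mu> order_trans[OF eb e16] K B by (intro add_mono mult_mono) auto
  also have "96 / r * exp (- (x / 16)) * cmod (U 0) = 96 * exp (- (x / 16)) * (cmod (U 0) / r)" by simp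
  also have "\<dots> \<le> 96 * exp (- (x / 16)) * B" using B by (intro mult_left_mono) auto
  finally have "cmod (U t - cos (r * t) * exp (- (t / (2 * r\<^sup>2))) * U 0) \<le> 419 * (exp (- (x / 16)) * B)"
    by (simp add: algebra_simps)
  also have "\<dots> \<le> 500 * (exp (- (x / 16)) * B)" using B by (intro mult_right_mono) auto
  finally show ?thesis by (simp add: B_def x_def algebra_simps)
qed

end

text \<open>The only information about the solution that the \<open>L\<^sup>2\<close> estimates use.  The frequency \<open>0\<close>, where the
  characteristic cubic has the root \<open>0\<close>, is left out: it is a null set.\<close>

definition frequency_bounds ::
  "('a::euclidean_space \<Rightarrow> complex) \<Rightarrow> ('a \<Rightarrow> complex) \<Rightarrow> ('a \<Rightarrow> complex) \<Rightarrow> real \<Rightarrow> ('a \<Rightarrow> complex) \<Rightarrow> bool"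
  where "frequency_bounds u0 u1 v0 t W \<longleftrightarrow> W \<in> borel_measurable borel \<and>
    (\<forall>\<xi>. \<xi> \<noteq> 0 \<longrightarrow> norm \<xi> \<le> 1 \<longrightarrow>
       cmod (W \<xi> - of_real (exp (- (norm \<xi> ^ 4 * t))) * (fourier u0 \<xi> - fourier v0 \<xi>)) \<le>
       21 * (exp (- ((norm \<xi>)\<^sup>2 * t / 8)) + (norm \<xi>)\<^sup>2 * exp (- (norm \<xi> ^ 4 * t / 4))) *
       (cmod (fourier u0 \<xi>) + cmod (fourier u1 \<xi>) + cmod (fourier v0 \<xi>))) \<and>
    (\<forall>\<xi>. 1 \<le> norm \<xi> \<longrightarrow>
       cmod (W \<xi> - of_real (cos (norm \<xi> * t) * exp (- (t / (2 * (norm \<xi>)\<^sup>2)))) * fourier u0 \<xi>) \<le>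
       500 * exp (- (t / (16 * (norm \<xi>)\<^sup>2))) *
       (cmod (fourier u0 \<xi>) / norm \<xi> + cmod (fourier u1 \<xi>) / norm \<xi> + cmod (fourier v0 \<xi>) / norm \<xi> ^ 3))"

lemma cauchy_solution_frequency_bounds:
  fixes u0 u1 v0 :: "'a::euclidean_space \<Rightarrow> complex"
  assumes "cauchy_solution u0 u1 v0 u v"
  obtains U where "\<And>t. t \<ge> 0 \<Longrightarrow> has_fourier (u t) (U t)" "\<And>\<xi>. U 0 \<xi> = fourier u0 \<xi>"
    "\<And>t. t \<ge> 0 \<Longrightarrow> frequency_bounds u0 u1 v0 t (U t)"
proof -
  obtain U U1 V where hf: "\<And>t. t \<ge> 0 \<Longrightarrow> has_fourier (u t) (U t)"
    and ini: "\<And>\<xi>. U 0 \<xi> = fourier u0 \<xi>" "\<And>\<xi>. U1 0 \<xi> = fourier u1 \<xi>" "\<And>\<xi>. V 0 \<xi> = fourier v0 \<xi>"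
    and cont: "\<And>\<xi>. continuous_on {0..} (\<lambda>t. U t \<xi>)" "\<And>\<xi>. continuous_on {0..} (\<lambda>t. U1 t \<xi>)"
      "\<And>\<xi>. continuous_on {0..} (\<lambda>t. V t \<xi>)"
    and der: "\<And>\<xi> t. t > 0 \<Longrightarrow> ((\<lambda>t. U t \<xi>) has_vector_derivative U1 t \<xi>) (at t)"
      "\<And>\<xi> t. t > 0 \<Longrightarrow> ((\<lambda>t. U1 t \<xi>) has_vector_derivative (- ((norm \<xi>)\<^sup>2 *\<^sub>R U t \<xi>) - V t \<xi>)) (at t)"
      "\<And>\<xi> t. t > 0 \<Longrightarrow> ((\<lambda>t. V t \<xi>) has_vector_derivative (- ((norm \<xi>)\<^sup>2 *\<^sub>R V t \<xi>) + U1 t \<xi>)) (at t)"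
    using assms unfolding cauchy_solution_def by blast
  have sol: "\<exists>\<mu>. frequency_solution (norm \<xi>) \<mu> (\<lambda>t. U t \<xi>) (\<lambda>t. U1 t \<xi>) (\<lambda>t. V t \<xi>)" if "\<xi> \<noteq> 0" for \<xi> :: 'a
  proof -
    have "\<exists>\<mu>. characteristic_root (norm \<xi>) \<mu>"
      using cubic_root_exists[of "norm \<xi>"] that unfolding characteristic_root_def by auto
    then obtain \<mu> where "characteristic_root (norm \<xi>) \<mu>" ..
    then show ?thesis
      using cont der by (intro exI[of _ \<mu>]) (simp add: frequency_solution_def frequency_solution_axioms_def)
  qed
  have "frequency_bounds u0 u1 v0 t (U t)" if t: "t \<ge> 0" for t
    unfolding frequency_bounds_def
  proof (intro conjI allI impI, goal_cases)
    case 1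
    show ?case using hf[OF t] by (simp add: has_fourier_def)
  next
    case (2 \<xi>)
    then obtain \<mu> where "frequency_solution (norm \<xi>) \<mu> (\<lambda>t. U t \<xi>) (\<lambda>t. U1 t \<xi>) (\<lambda>t. V t \<xi>)"
      using sol by blast
    from frequency_solution.low_frequency_bound[OF this 2(2) t] show ?case unfolding ini .
  next
    case (3 \<xi>)
    then have "\<xi> \<noteq> 0" by auto
    then obtain \<mu> where "frequency_solution (norm \<xi>) \<mu> (\<lambda>t. U t \<xi>) (\<lambda>t. U1 t \<xi>) (\<lambda>t. V t \<xi>)"
      using sol by blast
    from frequency_solution.high_frequency_bound[OF this 3 t] show ?case unfolding ini of_real_mult .
  qed
  with hf ini(1) show thesis by (rule that)
qed

section \<open>Decay of the frequency weights\<close>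

lemma powr_times_exp_neg_bounded:
  assumes "a \<ge> (0::real)"
  obtains C where "C > 0" "\<And>y. y > 0 \<Longrightarrow> y powr a * exp (- (y / 16)) \<le> C"
proof -
  obtain m where m: "a \<le> real m" using real_arch_simple by blast
  define n where "n = Suc m"
  have n: "n \<ge> 1" "a \<le> real n" using m by (auto simp: n_def)
  have "y powr a * exp (- (y / 16)) \<le> 1 + (16 * real n) ^ n" if y: "y > 0" for y
  proof -
    have "y powr a \<le> 1 + y ^ n"
    proof (cases "y \<le> 1")
      case True
      then have "y powr a \<le> 1 powr a" using y assms by (intro powr_mono2) auto
      then show ?thesis using y by (simp add: add_increasing2)
    next
      case False
      then have "y powr a \<le> y powr real n" using n by (intro powr_mono) auto
      then show ?thesis using y by (simp add: powr_realpow)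
    qed
    then have "y powr a * exp (- (y / 16)) \<le> (1 + y ^ n) * exp (- (y / 16))" by (intro mult_right_mono) auto
    also have "\<dots> = exp (- (y / 16)) + y ^ n * exp (- (y / 16))" by (simp add: algebra_simps)
    also have "\<dots> \<le> 1 + (16 * real n) ^ n"
    proof (rule add_mono)
      show "exp (- (y / 16)) \<le> 1" using y by simp
      have "y / (16 * real n) \<le> exp (y / (16 * real n))"
        using exp_ge_add_one_self[of "y / (16 * real n)"] by linarith
      then have "(y / (16 * real n)) ^ n \<le> exp (y / (16 * real n)) ^ n"
        using y by (intro power_mono) auto
      also have "\<dots> = exp (y / 16)" using n by (simp flip: exp_of_nat_mult)
      finally have "y ^ n / (16 * real n) ^ n \<le> exp (y / 16)" by (simp add: power_divide)
      then have "y ^ n \<le> (16 * real n) ^ n * exp (y / 16)" using n by (simp add: divide_le_eq mult.commute)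
      then have "y ^ n * exp (- (y / 16)) \<le> (16 * real n) ^ n * exp (y / 16) * exp (- (y / 16))"
        by (intro mult_right_mono) auto
      also have "\<dots> = (16 * real n) ^ n" by (simp add: exp_minus)
      finally show "y ^ n * exp (- (y / 16)) \<le> (16 * real n) ^ n" .
    qed
    finally show ?thesis .
  qed
  moreover have "1 + (16 * real n) ^ n > 0" by (simp add: add_pos_nonneg)
  ultimately show thesis using that by blast
qed

lemma powr_norm_le_bracket:
  assumes q: "q \<ge> (1::real)"
  shows "q powr s \<le> 2 powr \<bar>s\<bar> * (1 + q) powr s"
proof (cases "s \<ge> 0")
  case True
  have "1 * q powr s \<le> 2 powr \<bar>s\<bar> * (1 + q) powr s"
    using q True by (intro mult_mono powr_mono2) (auto simp: ge_one_powr_ge_zero)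
  then show ?thesis by simp
next
  case False
  have "q powr s \<le> ((1 + q) / 2) powr s" using q False by (intro powr_mono2') auto
  also have "\<dots> = 2 powr \<bar>s\<bar> * (1 + q) powr s"
    using q False by (simp add: powr_divide powr_minus field_simps)
  finally show ?thesis .
qed

text \<open>The regularity-loss mechanism: damping by \<open>e\<close> to the power \<open>-t/(16 r\<^sup>2)\<close> gives no uniform decay as \<open>r\<close>
  grows, but with \<open>y = (1 + t) / r\<^sup>2\<close> it is at most a constant times \<open>y\<close> to the power \<open>-l/2\<close>, so that
  \<open>l\<close> derivatives of the data buy the decay rate \<open>l/2\<close>.\<close>

lemma high_frequency_weight:
  assumes l: "l \<ge> (0::real)"
  shows "\<exists>C>0. \<forall>r t k. r \<ge> 1 \<longrightarrow> t \<ge> 0 \<longrightarrow> k \<le> 3 \<longrightarrow>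
       exp (- (t / (16 * r\<^sup>2))) / r ^ k \<le> C * (1 + t) powr (- l / 2) * (1 + r\<^sup>2) powr ((l - real k) / 2)"
proof -
  obtain C where C: "C > 0" "\<And>y. y > 0 \<Longrightarrow> y powr (l / 2) * exp (- (y / 16)) \<le> C"
    using powr_times_exp_neg_bounded[of "l / 2"] l by auto
  define C' where "C' = exp 1 * C * 2 powr (l + 3)"
  have "exp (- (t / (16 * r\<^sup>2))) / r ^ k \<le> C' * (1 + t) powr (- l / 2) * (1 + r\<^sup>2) powr ((l - real k) / 2)"
    if r: "r \<ge> 1" and t: "t \<ge> 0" and k: "k \<le> 3" for r t :: real and k :: nat
  proof -
    define q where "q = r\<^sup>2"
    have q: "q \<ge> 1" using r by (simp add: q_def)
    define y where "y = (1 + t) / q"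
    have y: "y > 0" using q t by (simp add: y_def)
    have "exp (- (t / (16 * r\<^sup>2))) = exp (1 / (16 * q)) * exp (- (y / 16))"
      using q by (simp add: y_def q_def add_divide_distrib flip: exp_add)
    also have "\<dots> \<le> exp 1 * exp (- (y / 16))"
      using q by (intro mult_right_mono) (auto simp: field_simps)
    also have "\<dots> = exp 1 * (y powr (l / 2) * exp (- (y / 16))) * y powr (- l / 2)"
      using y by (simp add: powr_minus)
    also have "\<dots> \<le> exp 1 * C * y powr (- l / 2)"
      by (intro mult_right_mono mult_left_mono C(2)[OF y]) auto
    also have "y powr (- l / 2) = (1 + t) powr (- l / 2) * q powr (l / 2)"
      using q t by (simp add: y_def powr_divide powr_minus field_simps)
    finally have "exp (- (t / (16 * r\<^sup>2))) / r ^ k \<le> exp 1 * C * ((1 + t) powr (- l / 2) * q powr (l / 2)) / r ^ k"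
      using r by (intro divide_right_mono) auto
    also have "\<dots> = exp 1 * C * (1 + t) powr (- l / 2) * (q powr (l / 2) / r ^ k)" by simp
    also have "q powr (l / 2) / r ^ k = q powr ((l - real k) / 2)"
    proof -
      have "r ^ k = q powr (real k / 2)"
      proof -
        have "q = r powr 2" using r by (simp add: q_def)
        then have "q powr (real k / 2) = r powr (2 * (real k / 2))" by (simp only: powr_powr)
        also have "\<dots> = r ^ k" using r by (simp add: powr_realpow)
        finally show ?thesis ..
      qed
      then show ?thesis by (simp only: diff_divide_distrib powr_diff)
    qed
    also have "exp 1 * C * (1 + t) powr (- l / 2) * q powr ((l - real k) / 2) \<le>
        exp 1 * C * (1 + t) powr (- l / 2) * (2 powr (l + 3) * (1 + q) powr ((l - real k) / 2))"
    proof (intro mult_left_mono)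
      have "2 powr \<bar>(l - real k) / 2\<bar> \<le> 2 powr (l + 3)" using k l by (intro powr_mono) (auto simp: abs_le_iff)
      then show "q powr ((l - real k) / 2) \<le> 2 powr (l + 3) * (1 + q) powr ((l - real k) / 2)"
        by (intro order_trans[OF powr_norm_le_bracket[OF q]] mult_right_mono) auto
    qed (use C in auto)
    finally show ?thesis by (simp add: C'_def q_def mult_ac)
  qed
  moreover have "C' > 0" using C by (simp add: C'_def)
  ultimately show ?thesis by blast
qed

lemma cmod_bessel_hat: "cmod (bessel_hat s f \<xi>) = (1 + (norm \<xi>)\<^sup>2) powr (s / 2) * cmod (fourier f \<xi>)"
  by (simp add: bessel_hat_def)

lemma high_frequency_bessel_bound:
  assumes l: "l \<ge> (0::real)"
  shows "\<exists>C>0. \<forall>(f :: 'a::euclidean_space \<Rightarrow> complex) \<xi> t k. norm \<xi> \<ge> 1 \<longrightarrow> t \<ge> 0 \<longrightarrow> k \<le> 3 \<longrightarrow>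
       exp (- (t / (16 * (norm \<xi>)\<^sup>2))) * (cmod (fourier f \<xi>) / norm \<xi> ^ k) \<le>
       C * (1 + t) powr (- l / 2) * cmod (bessel_hat (l - real k) f \<xi>)"
proof -
  obtain C where C: "C > 0"
    "\<And>r t k. r \<ge> 1 \<Longrightarrow> t \<ge> 0 \<Longrightarrow> k \<le> 3 \<Longrightarrow>
       exp (- (t / (16 * r\<^sup>2))) / r ^ k \<le> C * (1 + t) powr (- l / 2) * (1 + r\<^sup>2) powr ((l - real k) / 2)"
    using high_frequency_weight[OF l] by blast
  show ?thesis
  proof (intro exI[of _ C] conjI allI impI C(1))
    fix f :: "'a \<Rightarrow> complex" and \<xi> :: 'a and t :: real and k :: nat
    assume "norm \<xi> \<ge> 1" "t \<ge> (0::real)" "k \<le> 3"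
    from mult_right_mono[OF C(2)[OF this] norm_ge_zero[of "fourier f \<xi>"]]
    show "exp (- (t / (16 * (norm \<xi>)\<^sup>2))) * (cmod (fourier f \<xi>) / norm \<xi> ^ k) \<le>
       C * (1 + t) powr (- l / 2) * cmod (bessel_hat (l - real k) f \<xi>)"
      by (simp add: cmod_bessel_hat mult_ac)
  qed
qed

lemma integrable_exp_neg_power4:
  assumes "a > 0"
  shows "integrable lborel (\<lambda>x::'a::euclidean_space. exp (- (a * norm x ^ 4)))"
proof (rule Bochner_Integration.integrable_bound)
  show "integrable lborel (\<lambda>x::'a. exp a * exp (- (2 * a) * (norm x)\<^sup>2))"
    using integrable_exp_neg_power2[of "2 * a"] assms by (intro integrable_mult_right) simp
  have "exp (- (a * norm x ^ 4)) \<le> exp a * exp (- (2 * a) * (norm x)\<^sup>2)" for x :: 'a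
  proof -
    have "0 \<le> a * ((norm x)\<^sup>2 - 1)\<^sup>2" using assms by simp
    then have "- (a * norm x ^ 4) \<le> a + - (2 * a) * (norm x)\<^sup>2"
      by (simp add: power2_diff algebra_simps flip: power_mult)
    then show ?thesis by (simp flip: exp_add)
  qed
  then show "AE x::'a in lborel. norm (exp (- (a * norm x ^ 4))) \<le> norm (exp a * exp (- (2 * a) * (norm x)\<^sup>2))"
    by simp
qed measurable

lemma powr_quarter_power4: "\<tau> > 0 \<Longrightarrow> (\<tau> powr (1 / 4)) ^ 4 = (\<tau>::real)"
  by (simp add: powr_powr flip: powr_realpow)

text \<open>Scaling; this is the source of all powers of time coming from low frequencies.\<close>

lemma dilate_decay:
  fixes f :: "'a::euclidean_space \<Rightarrow> real"
  assumes f: "integrable lborel f" and \<tau>: "\<tau> > 0"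
  shows "integrable lborel (\<lambda>x. f (\<tau> powr p *\<^sub>R x))"
    and "(LINT x|lborel. f (\<tau> powr p *\<^sub>R x)) = \<tau> powr (- p * DIM('a)) * (LINT x|lborel. f x)"
proof -
  have [measurable]: "f \<in> borel_measurable borel" using f by measurable
  have s: "\<tau> powr p > 0" using \<tau> by simp
  show "integrable lborel (\<lambda>x. f (\<tau> powr p *\<^sub>R x))"
    using f by (subst integrable_dilate_iff[OF _ s]) auto
  have "\<tau> powr (- p * DIM('a)) * (LINT x|lborel. f x) =
    \<tau> powr (- p * DIM('a)) * (\<tau> powr p) ^ DIM('a) * (LINT x|lborel. f (\<tau> powr p *\<^sub>R x))"
    by (subst integral_dilate[OF _ s]) auto
  also have "\<tau> powr (- p * DIM('a)) * (\<tau> powr p) ^ DIM('a) = 1"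
    using \<tau> by (simp add: powr_powr flip: powr_realpow powr_add)
  finally show "(LINT x|lborel. f (\<tau> powr p *\<^sub>R x)) = \<tau> powr (- p * DIM('a)) * (LINT x|lborel. f x)" by simp
qed

lemma L2_decay_exp_power4:
  "\<exists>C>0. \<forall>\<tau>\<ge>1. integrable lborel (\<lambda>\<xi>::'a::euclidean_space. (exp (- (norm \<xi> ^ 4 * \<tau> / 8)))\<^sup>2) \<and>
     sqrt (LINT \<xi>|lborel. (exp (- (norm (\<xi>::'a) ^ 4 * \<tau> / 8)))\<^sup>2) \<le> C * \<tau> powr (- real DIM('a) / 8)"
proof -
  define f where "f x = exp (- (1 / 4 * norm x ^ 4))" for x :: 'a
  have f: "integrable lborel f" unfolding f_def by (rule integrable_exp_neg_power4) simp
  have e: "(exp (- (norm \<xi> ^ 4 * \<tau> / 8)))\<^sup>2 = f (\<tau> powr (1 / 4) *\<^sub>R \<xi>)" if "\<tau> \<ge> 1" for \<tau> and \<xi> :: 'a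
    using that by (simp add: f_def power_mult_distrib powr_quarter_power4 flip: exp_double)
  define I where "I = (LINT x|lborel. f x)"
  have I: "I \<ge> 0" unfolding I_def f_def by simp
  show ?thesis
  proof (intro exI[of _ "sqrt I + 1"] conjI allI impI)
    show "sqrt I + 1 > 0" using I by (simp add: add_nonneg_pos)
    fix \<tau> :: real assume \<tau>: "\<tau> \<ge> 1"
    then have \<tau>0: "\<tau> > 0" by simp
    show "integrable lborel (\<lambda>\<xi>::'a. (exp (- (norm \<xi> ^ 4 * \<tau> / 8)))\<^sup>2)"
      unfolding e[OF \<tau>] by (rule dilate_decay(1)[OF f \<tau>0])
    have "sqrt (LINT \<xi>|lborel. (exp (- (norm (\<xi>::'a) ^ 4 * \<tau> / 8)))\<^sup>2) = sqrt (\<tau> powr (- (1 / 4) * DIM('a))) * sqrt I"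
      unfolding e[OF \<tau>] dilate_decay(2)[OF f \<tau>0] I_def by (rule real_sqrt_mult)
    also have "sqrt (\<tau> powr (- (1 / 4) * DIM('a))) = \<tau> powr (- real DIM('a) / 8)"
      using \<tau>0 by (simp add: powr_half_sqrt[symmetric] powr_powr)
    also have "\<tau> powr (- real DIM('a) / 8) * sqrt I \<le> (sqrt I + 1) * \<tau> powr (- real DIM('a) / 8)"
      by (simp add: algebra_simps)
    finally show "sqrt (LINT \<xi>|lborel. (exp (- (norm (\<xi>::'a) ^ 4 * \<tau> / 8)))\<^sup>2) \<le> (sqrt I + 1) * \<tau> powr (- real DIM('a) / 8)" .
  qed
qed

text \<open>The weight in \<open>low_frequency_bound\<close>, as a function of \<open>\<tau> = 1 + t\<close>.\<close>

definition low_frequency_error :: "real \<Rightarrow> 'a::euclidean_space \<Rightarrow> real" where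
  "low_frequency_error \<tau> \<xi> =
    exp (- ((norm \<xi>)\<^sup>2 * \<tau> / 8)) + (norm \<xi>)\<^sup>2 * exp (- (norm \<xi> ^ 4 * \<tau> / 4))"

lemma low_frequency_error_nonneg: "low_frequency_error \<tau> \<xi> \<ge> 0"
  by (simp add: low_frequency_error_def)

text \<open>The first summand is a function of \<open>\<tau>\<^sup>1\<^sup>/\<^sup>2 \<xi>\<close> and yields the rate \<open>n/4\<close>; the exponential in the second is one
  of \<open>\<tau>\<^sup>1\<^sup>/\<^sup>4 \<xi>\<close>, and its factor \<open>|\<xi>|\<^sup>2\<close> improves the rate \<open>n/8\<close> by \<open>1/2\<close>.\<close>

lemma L2_decay_low_frequency_error:
  "\<exists>C>0. \<forall>\<tau>\<ge>1. integrable lborel (\<lambda>\<xi>::'a::euclidean_space. (low_frequency_error \<tau> \<xi>)\<^sup>2) \<and>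
     sqrt (LINT \<xi>|lborel. (low_frequency_error \<tau> (\<xi>::'a))\<^sup>2) \<le>
        C * \<tau> powr (- min (real DIM('a) / 8 + 1 / 2) (real DIM('a) / 4))"
proof -
  note \<phi>_def = low_frequency_error_def
  let ?\<phi> = "low_frequency_error :: real \<Rightarrow> 'a \<Rightarrow> real"
  define f where "f x = exp (- (1 / 4) * (norm x)\<^sup>2)" for x :: 'a
  define g where "g x = norm x ^ 4 * exp (- (1 / 2) * norm x ^ 4)" for x :: 'a
  have f: "integrable lborel f" unfolding f_def by (rule integrable_exp_neg_power2) simp
  have g: "integrable lborel g"
  proof (rule Bochner_Integration.integrable_bound)
    show "integrable lborel (\<lambda>x::'a. 4 * exp (- (1 / 4 * norm x ^ 4)))"
      by (intro integrable_mult_right integrable_exp_neg_power4) simp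
    show "AE x in lborel. norm (g x) \<le> norm (4 * exp (- (1 / 4 * norm x ^ 4)))"
      using mult_exp_neg_le[of "1 / 2" "norm x ^ 4" for x :: 'a] by (auto simp: g_def abs_mult)
    show "g \<in> borel_measurable lborel" unfolding g_def[abs_def] by measurable
  qed
  define m where "m = min (real DIM('a) / 8 + 1 / 2) (real DIM('a) / 4)"
  define I J where "I = (LINT x|lborel. f x)" and "J = (LINT x|lborel. g x)"
  have I: "I \<ge> 0" "J \<ge> 0" unfolding I_def J_def f_def g_def by simp_all
  have \<phi>2: "(?\<phi> \<tau> \<xi>)\<^sup>2 \<le> 2 * f (\<tau> powr (1 / 2) *\<^sub>R \<xi>) + 2 / \<tau> * g (\<tau> powr (1 / 4) *\<^sub>R \<xi>)" if \<tau>: "\<tau> \<ge> 1" for \<tau> \<xi>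
  proof -
    define a c where "a = exp (- ((norm \<xi>)\<^sup>2 * \<tau> / 8))" and "c = (norm \<xi>)\<^sup>2 * exp (- (norm \<xi> ^ 4 * \<tau> / 4))"
    have "(?\<phi> \<tau> \<xi>)\<^sup>2 \<le> 2 * a\<^sup>2 + 2 * c\<^sup>2"
      using sum_squares_bound[of a c] unfolding \<phi>_def a_def[symmetric] c_def[symmetric] by (simp add: power2_sum)
    also have "a\<^sup>2 = f (\<tau> powr (1 / 2) *\<^sub>R \<xi>)"
      using \<tau> by (simp add: a_def f_def power_mult_distrib powr_half_sqrt flip: exp_double)
    also have "c\<^sup>2 = g (\<tau> powr (1 / 4) *\<^sub>R \<xi>) / \<tau>"
      using \<tau> by (simp add: c_def g_def power_mult_distrib powr_quarter_power4 flip: exp_double power_mult)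
    finally show ?thesis by simp
  qed
  show ?thesis
  proof (intro exI[of _ "sqrt 2 * (sqrt I + sqrt J) + 1"] conjI allI impI)
    show "sqrt 2 * (sqrt I + sqrt J) + 1 > 0" using I by (simp add: add_nonneg_pos)
    fix \<tau> :: real assume \<tau>: "\<tau> \<ge> 1"
    then have \<tau>0: "\<tau> > 0" by simp
    have i: "integrable lborel (\<lambda>\<xi>. 2 * f (\<tau> powr (1 / 2) *\<^sub>R \<xi>) + 2 / \<tau> * g (\<tau> powr (1 / 4) *\<^sub>R \<xi>))"
      by (intro Bochner_Integration.integrable_add integrable_mult_right dilate_decay f g \<tau>0)
    show i2: "integrable lborel (\<lambda>\<xi>. (?\<phi> \<tau> \<xi>)\<^sup>2)"
      by (rule Bochner_Integration.integrable_bound[OF i])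
        (use \<phi>2[OF \<tau>] in \<open>auto simp: \<phi>_def intro: order_trans[OF _ abs_ge_self]\<close>)
    have "(LINT \<xi>|lborel. (?\<phi> \<tau> \<xi>)\<^sup>2) \<le> (LINT \<xi>|lborel. 2 * f (\<tau> powr (1 / 2) *\<^sub>R \<xi>) + 2 / \<tau> * g (\<tau> powr (1 / 4) *\<^sub>R \<xi>))"
      by (intro integral_mono i i2 \<phi>2 \<tau>)
    also have "\<dots> = 2 * (\<tau> powr (- (1 / 2) * DIM('a)) * I) + 2 / \<tau> * (\<tau> powr (- (1 / 4) * DIM('a)) * J)"
      using dilate_decay(1)[OF f \<tau>0] dilate_decay(1)[OF g \<tau>0]
      by (subst Bochner_Integration.integral_add) (simp_all add: dilate_decay(2)[OF f \<tau>0] dilate_decay(2)[OF g \<tau>0] I_def J_def)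
    also have "\<dots> = 2 * (\<tau> powr (- (1 / 2) * DIM('a)) * I) + 2 * (\<tau> powr (- (1 / 4) * DIM('a) - 1) * J)"
      using \<tau>0 by (simp add: powr_diff)
    also have "\<dots> \<le> 2 * (\<tau> powr (- 2 * m) * I) + 2 * (\<tau> powr (- 2 * m) * J)"
    proof -
      have "m \<le> real DIM('a) / 8 + 1 / 2" "m \<le> real DIM('a) / 4"
        unfolding m_def by (rule min.cobounded1, rule min.cobounded2)
      then have "- (1 / 2) * real DIM('a) \<le> - 2 * m" "- (1 / 4) * real DIM('a) - 1 \<le> - 2 * m" by auto
      then show ?thesis
        using \<tau> I by (intro add_mono mult_left_mono mult_right_mono powr_mono) auto
    qed
    also have "\<dots> = 2 * \<tau> powr (- 2 * m) * (I + J)" by (simp add: algebra_simps)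
    finally have "sqrt (LINT \<xi>|lborel. (?\<phi> \<tau> \<xi>)\<^sup>2) \<le> sqrt (2 * \<tau> powr (- 2 * m) * (I + J))"
      by (rule real_sqrt_le_mono)
    also have "\<dots> = sqrt 2 * \<tau> powr (- m) * sqrt (I + J)"
      using \<tau>0 by (simp add: real_sqrt_mult powr_half_sqrt[symmetric] powr_powr)
    also have "\<dots> \<le> sqrt 2 * \<tau> powr (- m) * (sqrt I + sqrt J)"
      using sqrt_add_le_add_sqrt[OF I] by (intro mult_left_mono) auto
    also have "\<dots> \<le> (sqrt 2 * (sqrt I + sqrt J) + 1) * \<tau> powr (- m)"
      by (simp add: algebra_simps)
    finally show "sqrt (LINT \<xi>|lborel. (?\<phi> \<tau> \<xi>)\<^sup>2) \<le> (sqrt 2 * (sqrt I + sqrt J) + 1) *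
      \<tau> powr (- min (real DIM('a) / 8 + 1 / 2) (real DIM('a) / 4))" by (simp add: m_def)
  qed
qed

text \<open>Turns pointwise bounds into \<open>L\<^sup>2\<close> bounds: at low frequencies \<open>\<phi>\<close> is the weight and \<open>S\<close> bounds the
  transformed data, at high frequencies \<open>h1\<close>, \<open>h2\<close>, \<open>h3\<close> are the Bessel potentials of the data.\<close>

lemma L2_norm_le_weighted_sum:
  assumes [measurable]: "g \<in> borel_measurable borel"
    and bd: "AE \<xi> in lborel. cmod (g \<xi>) \<le> K * (\<phi> \<xi> * S + \<theta> * (cmod (h1 \<xi>) + cmod (h2 \<xi>) + cmod (h3 \<xi>)))"
    and \<phi>: "integrable lborel (\<lambda>\<xi>. (\<phi> \<xi>)\<^sup>2)"
    and h: "square_integrable h1" "square_integrable h2" "square_integrable h3"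
    and nn: "K \<ge> 0" "S \<ge> 0" "\<theta> \<ge> 0"
  shows "square_integrable g"
    and "L2_norm g \<le> 2 * K * (sqrt (LINT \<xi>|lborel. (\<phi> \<xi>)\<^sup>2) * S + \<theta> * (L2_norm h1 + L2_norm h2 + L2_norm h3))"
proof -
  define H where "H \<xi> = (2 * K)\<^sup>2 * (S\<^sup>2 * (\<phi> \<xi>)\<^sup>2 + \<theta>\<^sup>2 * ((cmod (h1 \<xi>))\<^sup>2 + (cmod (h2 \<xi>))\<^sup>2 + (cmod (h3 \<xi>))\<^sup>2))" for \<xi>
  have hi: "integrable lborel (\<lambda>\<xi>. (cmod (h1 \<xi>))\<^sup>2)" "integrable lborel (\<lambda>\<xi>. (cmod (h2 \<xi>))\<^sup>2)" "integrable lborel (\<lambda>\<xi>. (cmod (h3 \<xi>))\<^sup>2)"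
    using h by (auto simp: square_integrable_def)
  have Hi: "integrable lborel H" unfolding H_def using hi \<phi> by auto
  have le: "AE \<xi> in lborel. (cmod (g \<xi>))\<^sup>2 \<le> H \<xi>"
    using bd
  proof eventually_elim
    case (elim \<xi>)
    define a b c d where "a = \<phi> \<xi> * S" and "b = \<theta> * cmod (h1 \<xi>)" and "c = \<theta> * cmod (h2 \<xi>)" and "d = \<theta> * cmod (h3 \<xi>)"
    have "(cmod (g \<xi>))\<^sup>2 \<le> (K * (a + b + c + d))\<^sup>2"
      using elim by (intro power_mono) (auto simp: a_def b_def c_def d_def algebra_simps)
    also have "\<dots> = K\<^sup>2 * (a + b + c + d)\<^sup>2" by (simp add: power_mult_distrib)
    also have "(a + b + c + d)\<^sup>2 \<le> 4 * (a\<^sup>2 + b\<^sup>2 + c\<^sup>2 + d\<^sup>2)"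
      using sum_squares_bound[of a b] sum_squares_bound[of a c] sum_squares_bound[of a d]
        sum_squares_bound[of b c] sum_squares_bound[of b d] sum_squares_bound[of c d]
      by (simp add: power2_sum algebra_simps)
    finally have "(cmod (g \<xi>))\<^sup>2 \<le> K\<^sup>2 * (4 * (a\<^sup>2 + b\<^sup>2 + c\<^sup>2 + d\<^sup>2))" by (simp add: mult_left_mono)
    then show ?case by (simp add: H_def a_def b_def c_def d_def power_mult_distrib algebra_simps)
  qed
  show "square_integrable g" by (rule square_integrable_dominated[OF _ Hi le]) measurable
  have "L2_norm g \<le> sqrt (LINT \<xi>|lborel. H \<xi>)" by (rule square_integrable_dominated[OF _ Hi le]) measurable
  also have "(LINT \<xi>|lborel. H \<xi>) = (2 * K)\<^sup>2 * (S\<^sup>2 * (LINT \<xi>|lborel. (\<phi> \<xi>)\<^sup>2) + \<theta>\<^sup>2 * ((L2_norm h1)\<^sup>2 + (L2_norm h2)\<^sup>2 + (L2_norm h3)\<^sup>2))"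
    unfolding H_def L2_norm_power2 using hi \<phi> by simp
  also have "sqrt \<dots> \<le> 2 * K * (sqrt (LINT \<xi>|lborel. (\<phi> \<xi>)\<^sup>2) * S + \<theta> * (L2_norm h1 + L2_norm h2 + L2_norm h3))"
  proof -
    define P where "P = sqrt (LINT \<xi>|lborel. (\<phi> \<xi>)\<^sup>2)"
    have P: "P \<ge> 0" "(LINT \<xi>|lborel. (\<phi> \<xi>)\<^sup>2) = P\<^sup>2" by (auto simp: P_def)
    have n: "L2_norm h1 \<ge> 0" "L2_norm h2 \<ge> 0" "L2_norm h3 \<ge> 0" by (auto intro: L2_norm_nonneg)
    have "(L2_norm h1)\<^sup>2 + (L2_norm h2)\<^sup>2 + (L2_norm h3)\<^sup>2 \<le> (L2_norm h1 + L2_norm h2 + L2_norm h3)\<^sup>2"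
      using n by (simp add: power2_sum)
    then have "S\<^sup>2 * P\<^sup>2 + \<theta>\<^sup>2 * ((L2_norm h1)\<^sup>2 + (L2_norm h2)\<^sup>2 + (L2_norm h3)\<^sup>2) \<le>
       (P * S)\<^sup>2 + (\<theta> * (L2_norm h1 + L2_norm h2 + L2_norm h3))\<^sup>2"
      by (auto simp: power_mult_distrib mult_ac intro!: add_mono mult_left_mono)
    also have "\<dots> \<le> (P * S + \<theta> * (L2_norm h1 + L2_norm h2 + L2_norm h3))\<^sup>2"
      using P n nn by (simp add: power2_sum)
    finally show ?thesis
      unfolding P(2) P_def[symmetric] using P n nn
      by (intro real_le_lsqrt) (auto simp: power_mult_distrib intro!: mult_left_mono)
  qed
  finally show "L2_norm g \<le> 2 * K * (sqrt (LINT \<xi>|lborel. (\<phi> \<xi>)\<^sup>2) * S + \<theta> * (L2_norm h1 + L2_norm h2 + L2_norm h3))" .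
qed

section \<open>The estimates in L2\<close>

definition transform_bound ::
  "('a::euclidean_space \<Rightarrow> complex) \<Rightarrow> ('a \<Rightarrow> complex) \<Rightarrow> ('a \<Rightarrow> complex) \<Rightarrow> real"
  where "transform_bound u0 u1 v0 =
    (2 * pi) powr (- real DIM('a) / 2) * (L1_norm u0 + L1_norm u1 + L1_norm v0)"

lemma fourier_le_transform_bound:
  "cmod (fourier u0 \<xi>) + cmod (fourier u1 \<xi>) + cmod (fourier v0 \<xi>) \<le> transform_bound u0 u1 v0"
  using fourier_bound[of u0 \<xi>] fourier_bound[of u1 \<xi>] fourier_bound[of v0 \<xi>]
  by (simp add: transform_bound_def algebra_simps)

lemma L1_norm_nonneg: "L1_norm f \<ge> 0"
  by (simp add: L1_norm_def)

lemma transform_bound_nonneg: "transform_bound u0 u1 v0 \<ge> 0"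
  unfolding transform_bound_def by (intro mult_nonneg_nonneg add_nonneg_nonneg L1_norm_nonneg) auto

text \<open>Replaces \<open>t\<close> by \<open>1 + t\<close> in the low-frequency weights, so that the scaling also covers small times.\<close>

lemma exp_shift_le:
  fixes t p d :: real
  assumes "0 \<le> p" "p \<le> d" "d > 0"
  shows "exp (- (p * t / d)) \<le> 3 * exp (- (p * (1 + t) / d))"
proof -
  have "p / d \<le> 1" using assms by simp
  then have "exp (p / d) \<le> 3" using exp_le order_trans[of "exp (p / d)" "exp 1" 3] by simp
  then have "exp (p / d) * exp (- (p * (1 + t) / d)) \<le> 3 * exp (- (p * (1 + t) / d))"
    by (intro mult_right_mono) auto
  moreover have "exp (p / d) * exp (- (p * (1 + t) / d)) = exp (- (p * t / d))"
    by (simp add: algebra_simps add_divide_distrib flip: exp_add)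
  ultimately show ?thesis by simp
qed

lemma frequency_bounds_low:
  fixes u0 :: "'a::euclidean_space \<Rightarrow> complex"
  assumes W: "frequency_bounds u0 u1 v0 t W" and t: "t \<ge> 0" and \<xi>: "\<xi> \<noteq> 0" "norm \<xi> \<le> 1"
  defines "F \<equiv> transform_bound u0 u1 v0"
  shows "cmod (W \<xi> - of_real (exp (- (norm \<xi> ^ 4 * t))) * (fourier u0 \<xi> - fourier v0 \<xi>)) \<le>
     63 * low_frequency_error (1 + t) \<xi> * F"
    and "cmod (W \<xi>) \<le> 129 * exp (- (norm \<xi> ^ 4 * (1 + t) / 8)) * F"
proof -
  define r where "r = norm \<xi>"
  have r: "0 \<le> r" "r \<le> 1" using \<xi> by (auto simp: r_def)
  have r2: "r\<^sup>2 \<le> 1" and r4: "r ^ 4 \<le> 1" "r ^ 4 \<le> r\<^sup>2"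
    using r by (auto simp: power_le_one intro: power_decreasing)
  have F: "cmod (fourier u0 \<xi>) + cmod (fourier u1 \<xi>) + cmod (fourier v0 \<xi>) \<le> F"
    unfolding F_def by (rule fourier_le_transform_bound)
  have F0: "F \<ge> 0" unfolding F_def by (rule transform_bound_nonneg)
  have 1: "cmod (W \<xi> - of_real (exp (- (r ^ 4 * t))) * (fourier u0 \<xi> - fourier v0 \<xi>)) \<le>
     21 * (exp (- (r\<^sup>2 * t / 8)) + r\<^sup>2 * exp (- (r ^ 4 * t / 4))) * F"
  proof -
    have "cmod (W \<xi> - of_real (exp (- (r ^ 4 * t))) * (fourier u0 \<xi> - fourier v0 \<xi>)) \<le>
       21 * (exp (- (r\<^sup>2 * t / 8)) + r\<^sup>2 * exp (- (r ^ 4 * t / 4))) *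
        (cmod (fourier u0 \<xi>) + cmod (fourier u1 \<xi>) + cmod (fourier v0 \<xi>))"
      using W \<xi> unfolding frequency_bounds_def r_def by blast
    also have "\<dots> \<le> 21 * (exp (- (r\<^sup>2 * t / 8)) + r\<^sup>2 * exp (- (r ^ 4 * t / 4))) * F"
      by (intro mult_left_mono F) auto
    finally show ?thesis .
  qed
  have "21 * (exp (- (r\<^sup>2 * t / 8)) + r\<^sup>2 * exp (- (r ^ 4 * t / 4))) * F \<le>
     21 * (3 * exp (- (r\<^sup>2 * (1 + t) / 8)) + r\<^sup>2 * (3 * exp (- (r ^ 4 * (1 + t) / 4)))) * F"
    using r2 r4 F0 by (intro mult_left_mono mult_right_mono add_mono exp_shift_le) auto
  with 1 show "cmod (W \<xi> - of_real (exp (- (norm \<xi> ^ 4 * t))) * (fourier u0 \<xi> - fourier v0 \<xi>)) \<le>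
     63 * low_frequency_error (1 + t) \<xi> * F"
    unfolding r_def low_frequency_error_def by (simp add: algebra_simps)
  have r4t: "r ^ 4 * t \<le> r\<^sup>2 * t" "0 \<le> r ^ 4 * t" using r4 t r by (auto intro: mult_right_mono)
  have "cmod (W \<xi>) \<le> cmod (W \<xi> - of_real (exp (- (r ^ 4 * t))) * (fourier u0 \<xi> - fourier v0 \<xi>))
      + cmod (of_real (exp (- (r ^ 4 * t))) * (fourier u0 \<xi> - fourier v0 \<xi>))"
    using norm_triangle_ineq[of "W \<xi> - of_real (exp (- (r ^ 4 * t))) * (fourier u0 \<xi> - fourier v0 \<xi>)"
        "of_real (exp (- (r ^ 4 * t))) * (fourier u0 \<xi> - fourier v0 \<xi>)"] by simp
  also have "\<dots> \<le> 21 * (exp (- (r\<^sup>2 * t / 8)) + r\<^sup>2 * exp (- (r ^ 4 * t / 4))) * F + exp (- (r ^ 4 * t)) * F"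
  proof (rule add_mono[OF 1])
    have "cmod (fourier u0 \<xi> - fourier v0 \<xi>) \<le> F"
      using F norm_triangle_ineq4[of "fourier u0 \<xi>" "fourier v0 \<xi>"] norm_ge_zero[of "fourier u1 \<xi>"] by linarith
    then show "cmod (of_real (exp (- (r ^ 4 * t))) * (fourier u0 \<xi> - fourier v0 \<xi>)) \<le> exp (- (r ^ 4 * t)) * F"
      by (simp add: norm_mult mult_left_mono)
  qed
  also have "\<dots> \<le> 21 * (exp (- (r ^ 4 * t / 8)) + 1 * exp (- (r ^ 4 * t / 8))) * F + exp (- (r ^ 4 * t / 8)) * F"
  proof -
    have "exp (- (r\<^sup>2 * t / 8)) \<le> exp (- (r ^ 4 * t / 8))" "exp (- (r ^ 4 * t / 4)) \<le> exp (- (r ^ 4 * t / 8))"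
      "exp (- (r ^ 4 * t)) \<le> exp (- (r ^ 4 * t / 8))"
      unfolding exp_le_cancel_iff using r4t by linarith+
    then show ?thesis
      using r2 F0 by (intro add_mono mult_left_mono mult_right_mono mult_mono) auto
  qed
  also have "\<dots> = 43 * F * exp (- (r ^ 4 * t / 8))" by (simp add: algebra_simps)
  also have "\<dots> \<le> 43 * F * (3 * exp (- (r ^ 4 * (1 + t) / 8)))"
    using F0 r4 r by (intro mult_left_mono exp_shift_le) auto
  finally show "cmod (W \<xi>) \<le> 129 * exp (- (norm \<xi> ^ 4 * (1 + t) / 8)) * F"
    unfolding r_def by (simp add: algebra_simps)
qed

lemma oscillating_factor_le:
  fixes r t :: real
  assumes "r \<ge> 1" "t \<ge> 0"
  shows "\<bar>cos (r * t) * exp (- (t / (2 * r\<^sup>2)))\<bar> \<le> exp (- (t / (16 * r\<^sup>2)))"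
proof -
  have "\<bar>cos (r * t)\<bar> * exp (- (t / (2 * r\<^sup>2))) \<le> 1 * exp (- (t / (2 * r\<^sup>2)))"
    by (intro mult_right_mono) auto
  also have "\<dots> \<le> exp (- (t / (16 * r\<^sup>2)))"
    using assms by (auto intro!: divide_left_mono)
  finally show ?thesis by (simp add: abs_mult)
qed

lemma AE_nonzero: "AE \<xi> in (lborel :: 'a::euclidean_space measure). \<xi> \<noteq> 0"
  by (rule AE_lborel_singleton)

lemma H_cap_L1D:
  assumes "f \<in> H_cap_L1 s"
  shows "integrable lborel f" "square_integrable (bessel_hat s f)"
  using assms by (auto simp: H_cap_L1_def)

text \<open>The shape of the upper bounds: \<open>p\<close> is the decay rate of the low frequencies, \<open>l/2\<close> that of the
  high ones, and \<open>s\<close> the order of regularity required of \<open>u0\<close>.\<close>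

definition decay_majorant ::
  "real \<Rightarrow> real \<Rightarrow> real \<Rightarrow> real \<Rightarrow> ('a::euclidean_space \<Rightarrow> complex) \<Rightarrow> ('a \<Rightarrow> complex) \<Rightarrow> ('a \<Rightarrow> complex) \<Rightarrow> real"
  where "decay_majorant p l s t u0 u1 v0 =
    (1 + t) powr (- p) * (L1_norm u0 + L1_norm u1 + L1_norm v0) +
    (1 + t) powr (- l / 2) * (H_norm s u0 + H_norm (l - 1) u1 + H_norm (l - 3) v0)"

text \<open>Combines both sources of decay.  The exponent \<open>k\<close> of the high-frequency weight of \<open>u0\<close> is what
  distinguishes the solution (\<open>k = 0\<close>) from its difference with the profiles (\<open>k = 1\<close>): the wave part of the
  solution has no negative power of \<open>|\<xi>|\<close>, so that \<open>u0\<close> needs one more derivative.\<close>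

lemma frequency_split_L2_bound:
  fixes \<phi> :: "real \<Rightarrow> 'a::euclidean_space \<Rightarrow> real"
  assumes l: "l \<ge> 0" and k: "k \<le> (3::nat)" and Cl: "Cl > 0" and K: "K > 0" and \<phi>0: "\<And>\<tau> \<xi>. \<phi> \<tau> \<xi> \<ge> 0"
    and \<phi>: "\<And>\<tau>. \<tau> \<ge> 1 \<Longrightarrow> integrable lborel (\<lambda>\<xi>. (\<phi> \<tau> \<xi>)\<^sup>2)"
      "\<And>\<tau>. \<tau> \<ge> 1 \<Longrightarrow> sqrt (LINT \<xi>|lborel. (\<phi> \<tau> \<xi>)\<^sup>2) \<le> Cl * \<tau> powr (- p)"
  shows "\<exists>C>0. \<forall>u0 \<in> H_cap_L1 (l - real k). \<forall>u1 \<in> H_cap_L1 (l - 1). \<forall>v0 \<in> H_cap_L1 (l - 3). \<forall>t\<ge>0. \<forall>w.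
    w \<in> borel_measurable borel \<longrightarrow>
    (\<forall>\<xi>. \<xi> \<noteq> 0 \<longrightarrow> norm \<xi> \<le> 1 \<longrightarrow> cmod (w \<xi>) \<le> K * \<phi> (1 + t) \<xi> * transform_bound u0 u1 v0) \<longrightarrow>
    (\<forall>\<xi>. 1 < norm \<xi> \<longrightarrow> cmod (w \<xi>) \<le> K * exp (- (t / (16 * (norm \<xi>)\<^sup>2))) *
       (cmod (fourier u0 \<xi>) / norm \<xi> ^ k + cmod (fourier u1 \<xi>) / norm \<xi> + cmod (fourier v0 \<xi>) / norm \<xi> ^ 3)) \<longrightarrow>
    square_integrable w \<and> L2_norm w \<le> C * decay_majorant p l (l - real k) t u0 u1 v0"
proof -
  obtain Ch where Ch: "Ch > 0"
    "\<And>(f :: 'a \<Rightarrow> complex) \<xi> t k. norm \<xi> \<ge> 1 \<Longrightarrow> t \<ge> 0 \<Longrightarrow> k \<le> 3 \<Longrightarrow>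
       exp (- (t / (16 * (norm \<xi>)\<^sup>2))) * (cmod (fourier f \<xi>) / norm \<xi> ^ k) \<le>
       Ch * (1 + t) powr (- l / 2) * cmod (bessel_hat (l - real k) f \<xi>)"
    using high_frequency_bessel_bound[OF l, where 'a='a] by blast
  define c0 where "c0 = (2 * pi) powr (- real DIM('a) / 2)"
  have c0: "c0 > 0" by (simp add: c0_def)
  define M where "M = K * (1 + Ch)"
  have M: "M > 0" using K Ch(1) by (simp add: M_def)
  have KM: "K \<le> M" "K * Ch \<le> M" using K Ch(1) by (auto simp: M_def algebra_simps)
  show ?thesis
  proof (rule exI[of _ "2 * M * (Cl * c0 + 1)"], rule conjI[rotated], intro ballI allI impI)
    show "2 * M * (Cl * c0 + 1) > 0" using M Cl c0 by (simp add: add_pos_pos)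
    fix u0 u1 v0 w :: "'a \<Rightarrow> complex" and t
    assume data: "u0 \<in> H_cap_L1 (l - real k)" "u1 \<in> H_cap_L1 (l - 1)" "v0 \<in> H_cap_L1 (l - 3)" and t: "t \<ge> (0::real)"
      and wm: "w \<in> borel_measurable borel"
      and low: "\<forall>\<xi>. \<xi> \<noteq> 0 \<longrightarrow> norm \<xi> \<le> 1 \<longrightarrow> cmod (w \<xi>) \<le> K * \<phi> (1 + t) \<xi> * transform_bound u0 u1 v0"
      and high: "\<forall>\<xi>. 1 < norm \<xi> \<longrightarrow> cmod (w \<xi>) \<le> K * exp (- (t / (16 * (norm \<xi>)\<^sup>2))) *
        (cmod (fourier u0 \<xi>) / norm \<xi> ^ k + cmod (fourier u1 \<xi>) / norm \<xi> + cmod (fourier v0 \<xi>) / norm \<xi> ^ 3)"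
    define S where "S = L1_norm u0 + L1_norm u1 + L1_norm v0"
    have S: "S \<ge> 0" unfolding S_def by (intro add_nonneg_nonneg L1_norm_nonneg)
    define \<theta> where "\<theta> = (1 + t) powr (- l / 2)"
    define h1 h2 h3 where "h1 = bessel_hat (l - real k) u0" and "h2 = bessel_hat (l - 1) u1" and "h3 = bessel_hat (l - 3) v0"
    have nn: "M \<ge> 0" "c0 * S \<ge> 0" "\<theta> \<ge> 0" using M c0 S by (auto simp: \<theta>_def)
    have bd: "cmod (w \<xi>) \<le> M * (\<phi> (1 + t) \<xi> * (c0 * S) + \<theta> * (cmod (h1 \<xi>) + cmod (h2 \<xi>) + cmod (h3 \<xi>)))"
      if \<xi>: "\<xi> \<noteq> 0" for \<xi>
    proof -
      define X where "X = \<phi> (1 + t) \<xi> * (c0 * S)"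
      define Y where "Y = \<theta> * (cmod (h1 \<xi>) + cmod (h2 \<xi>) + cmod (h3 \<xi>))"
      have XY: "X \<ge> 0" "Y \<ge> 0" using nn \<phi>0[of "1 + t" \<xi>] by (auto simp: X_def Y_def)
      have "cmod (w \<xi>) \<le> M * (X + Y)"
      proof (cases "norm \<xi> \<le> 1")
        case True
        have "cmod (w \<xi>) \<le> K * X"
          using low \<xi> True by (simp add: X_def transform_bound_def c0_def S_def mult.assoc)
        also have "\<dots> \<le> M * (X + Y)" using XY KM M by (intro mult_mono) auto
        finally show ?thesis .
      next
        case False
        then have n1: "norm \<xi> \<ge> 1" "norm \<xi> > 1" by auto
        define e where "e = exp (- (t / (16 * (norm \<xi>)\<^sup>2)))"
        have "cmod (w \<xi>) \<le> K * (e * (cmod (fourier u0 \<xi>) / norm \<xi> ^ k) + e * (cmod (fourier u1 \<xi>) / norm \<xi> ^ 1) + e * (cmod (fourier v0 \<xi>) / norm \<xi> ^ 3))"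
          using high n1(2) by (simp add: e_def distrib_left mult.assoc)
        also have "\<dots> \<le> K * (Ch * \<theta> * cmod (bessel_hat (l - real k) u0 \<xi>) + Ch * \<theta> * cmod (bessel_hat (l - real 1) u1 \<xi>)
            + Ch * \<theta> * cmod (bessel_hat (l - real 3) v0 \<xi>))"
          unfolding \<theta>_def e_def using K k by (intro mult_left_mono add_mono Ch(2) n1 t) auto
        also have "\<dots> = K * Ch * Y" by (simp add: Y_def h1_def h2_def h3_def algebra_simps)
        also have "\<dots> \<le> M * (X + Y)" using XY KM M by (intro mult_mono) auto
        finally show ?thesis .
      qed
      then show ?thesis by (simp add: X_def Y_def)
    qed
    have AEbd: "AE \<xi> in lborel. cmod (w \<xi>) \<le> M * (\<phi> (1 + t) \<xi> * (c0 * S) + \<theta> * (cmod (h1 \<xi>) + cmod (h2 \<xi>) + cmod (h3 \<xi>)))"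
      using AE_nonzero by eventually_elim (rule bd)
    have hs: "square_integrable h1" "square_integrable h2" "square_integrable h3"
      unfolding h1_def h2_def h3_def using data by (auto intro: H_cap_L1D)
    have t1: "1 + t \<ge> 1" using t by simp
    note L2 = L2_norm_le_weighted_sum[OF wm AEbd \<phi>(1)[OF t1] hs nn]
    note L2(2)
    also have "2 * M * (sqrt (LINT \<xi>|lborel. (\<phi> (1 + t) \<xi>)\<^sup>2) * (c0 * S) + \<theta> * (L2_norm h1 + L2_norm h2 + L2_norm h3)) \<le>
      2 * M * ((Cl * (1 + t) powr (- p)) * (c0 * S) + \<theta> * (L2_norm h1 + L2_norm h2 + L2_norm h3))"
      using nn by (intro mult_left_mono add_mono mult_right_mono \<phi>(2)[OF t1]) auto
    also have "\<dots> = 2 * M * ((Cl * c0) * ((1 + t) powr (- p) * S) + 1 * (\<theta> * (L2_norm h1 + L2_norm h2 + L2_norm h3)))"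
      by (simp add: mult_ac)
    also have "\<dots> \<le> 2 * M * ((Cl * c0 + 1) * ((1 + t) powr (- p) * S) + (Cl * c0 + 1) * (\<theta> * (L2_norm h1 + L2_norm h2 + L2_norm h3)))"
      using nn Cl c0 S by (intro mult_left_mono add_mono mult_right_mono) (auto simp: L2_norm_nonneg)
    also have "\<dots> = 2 * M * (Cl * c0 + 1) * decay_majorant p l (l - real k) t u0 u1 v0"
      by (simp add: decay_majorant_def S_def \<theta>_def H_norm_def h1_def h2_def h3_def algebra_simps)
    finally show "square_integrable w \<and> L2_norm w \<le> 2 * M * (Cl * c0 + 1) * decay_majorant p l (l - real k) t u0 u1 v0"
      using L2(1) by blast
  qed
qed

lemma solution_L2_bound:
  assumes l: "l \<ge> (0::real)"
  shows "\<exists>C>0. \<forall>u0 \<in> H_cap_L1 l. \<forall>u1 \<in> H_cap_L1 (l - 1). \<forall>v0 \<in> H_cap_L1 (l - 3). \<forall>t\<ge>0. \<forall>W.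
    frequency_bounds (u0 :: 'a::euclidean_space \<Rightarrow> complex) u1 v0 t W \<longrightarrow>
    square_integrable W \<and> L2_norm W \<le> C * decay_majorant (real DIM('a) / 8) l l t u0 u1 v0"
proof -
  define \<phi> where "\<phi> \<tau> \<xi> = exp (- (norm \<xi> ^ 4 * \<tau> / 8))" for \<tau> and \<xi> :: 'a
  obtain Cl where Cl: "Cl > 0" "\<And>\<tau>. \<tau> \<ge> 1 \<Longrightarrow> integrable lborel (\<lambda>\<xi>. (\<phi> \<tau> \<xi>)\<^sup>2)"
    "\<And>\<tau>. \<tau> \<ge> 1 \<Longrightarrow> sqrt (LINT \<xi>|lborel. (\<phi> \<tau> \<xi>)\<^sup>2) \<le> Cl * \<tau> powr (- (real DIM('a) / 8))"
    using L2_decay_exp_power4[where 'a='a, folded \<phi>_def] by auto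
  obtain C where C: "C > 0"
    and bound: "\<forall>u0 \<in> H_cap_L1 (l - real 0). \<forall>u1 \<in> H_cap_L1 (l - 1). \<forall>v0 \<in> H_cap_L1 (l - 3). \<forall>t\<ge>0. \<forall>w.
      w \<in> borel_measurable borel \<longrightarrow>
      (\<forall>\<xi>. \<xi> \<noteq> 0 \<longrightarrow> norm \<xi> \<le> 1 \<longrightarrow> cmod (w \<xi>) \<le> 501 * \<phi> (1 + t) \<xi> * transform_bound u0 u1 v0) \<longrightarrow>
      (\<forall>\<xi>. 1 < norm \<xi> \<longrightarrow> cmod (w \<xi>) \<le> 501 * exp (- (t / (16 * (norm \<xi>)\<^sup>2))) *
         (cmod (fourier u0 \<xi>) / norm \<xi> ^ 0 + cmod (fourier u1 \<xi>) / norm \<xi> + cmod (fourier v0 \<xi>) / norm \<xi> ^ 3)) \<longrightarrow>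
      square_integrable w \<and> L2_norm w \<le> C * decay_majorant (real DIM('a) / 8) l (l - real 0) t u0 u1 v0"
    using frequency_split_L2_bound[OF l le0 Cl(1) _ _ Cl(2,3), of 501] by (auto simp: \<phi>_def)
  show ?thesis
  proof (rule exI[of _ C], intro conjI[OF C] ballI allI impI)
    fix u0 u1 v0 W :: "'a \<Rightarrow> complex" and t
    assume data: "u0 \<in> H_cap_L1 l" "u1 \<in> H_cap_L1 (l - 1)" "v0 \<in> H_cap_L1 (l - 3)" and t: "t \<ge> (0::real)"
      and W: "frequency_bounds u0 u1 v0 t W"
    have Wm: "W \<in> borel_measurable borel" using W by (simp add: frequency_bounds_def)
    have low: "cmod (W \<xi>) \<le> 501 * \<phi> (1 + t) \<xi> * transform_bound u0 u1 v0" if "\<xi> \<noteq> 0" "norm \<xi> \<le> 1" for \<xi>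
    proof -
      have "cmod (W \<xi>) \<le> 129 * \<phi> (1 + t) \<xi> * transform_bound u0 u1 v0"
        unfolding \<phi>_def by (rule frequency_bounds_low(2)[OF W t that])
      also have "\<dots> \<le> 501 * \<phi> (1 + t) \<xi> * transform_bound u0 u1 v0"
        by (intro mult_right_mono transform_bound_nonneg) (auto simp: \<phi>_def)
      finally show ?thesis .
    qed
    have high: "cmod (W \<xi>) \<le> 501 * exp (- (t / (16 * (norm \<xi>)\<^sup>2))) *
         (cmod (fourier u0 \<xi>) / norm \<xi> ^ 0 + cmod (fourier u1 \<xi>) / norm \<xi> + cmod (fourier v0 \<xi>) / norm \<xi> ^ 3)"
      if "1 < norm \<xi>" for \<xi>
    proof -
      define e where "e = exp (- (t / (16 * (norm \<xi>)\<^sup>2)))"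
      define g where "g = of_real (cos (norm \<xi> * t) * exp (- (t / (2 * (norm \<xi>)\<^sup>2)))) * fourier u0 \<xi>"
      have n1: "norm \<xi> \<ge> 1" using that by simp
      have g: "cmod g \<le> e * cmod (fourier u0 \<xi>)"
        unfolding g_def e_def norm_mult norm_of_real
        by (intro mult_right_mono oscillating_factor_le n1 t) auto
      have "cmod (W \<xi>) \<le> cmod (W \<xi> - g) + cmod g"
        using norm_triangle_ineq[of "W \<xi> - g" g] by simp
      also have "\<dots> \<le> 500 * e * (cmod (fourier u0 \<xi>) / norm \<xi> + cmod (fourier u1 \<xi>) / norm \<xi> + cmod (fourier v0 \<xi>) / norm \<xi> ^ 3)
          + e * cmod (fourier u0 \<xi>)"
        using W n1 g unfolding frequency_bounds_def g_def e_def by (intro add_mono) auto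
      also have "\<dots> \<le> 500 * e * (cmod (fourier u0 \<xi>) / 1 + cmod (fourier u1 \<xi>) / norm \<xi> + cmod (fourier v0 \<xi>) / norm \<xi> ^ 3)
          + e * cmod (fourier u0 \<xi>)"
        using n1 by (intro add_mono mult_left_mono divide_left_mono order_refl) (auto simp: e_def)
      also have "\<dots> \<le> 501 * e * (cmod (fourier u0 \<xi>) / norm \<xi> ^ 0 + cmod (fourier u1 \<xi>) / norm \<xi> + cmod (fourier v0 \<xi>) / norm \<xi> ^ 3)"
      proof -
        have *: "500 * e * (a + b + c) + e * a \<le> 501 * e * (a + b + c)" if "0 \<le> b" "0 \<le> c" for a b c
          using mult_nonneg_nonneg[of e b] mult_nonneg_nonneg[of e c] that by (simp add: e_def algebra_simps)
        show ?thesis unfolding div_by_1 power_0 by (rule *) auto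
      qed
      finally show ?thesis unfolding e_def .
    qed
    show "square_integrable W \<and> L2_norm W \<le> C * decay_majorant (real DIM('a) / 8) l l t u0 u1 v0"
      using bound[rule_format, of u0 u1 v0 t W] data t Wm low high by simp
  qed
qed

text \<open>If \<open>W\<close> is the transform of the solution at time \<open>t\<close>, this is that of its difference from the two
  profiles.\<close>

definition profile_error ::
  "('a::euclidean_space \<Rightarrow> real) \<Rightarrow> ('a \<Rightarrow> real) \<Rightarrow> ('a \<Rightarrow> complex) \<Rightarrow> ('a \<Rightarrow> complex) \<Rightarrow> real \<Rightarrow> ('a \<Rightarrow> complex) \<Rightarrow> 'a \<Rightarrow> complex"
  where "profile_error \<chi>int \<chi>ext u0 v0 t W \<xi> = W \<xi>
    - of_real (\<chi>int \<xi> * exp (- (norm \<xi> ^ 4 * t))) * (fourier u0 \<xi> - fourier v0 \<xi>)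
    - of_real (\<chi>ext \<xi> * cos (norm \<xi> * t) * exp (- (t / (2 * (norm \<xi>)\<^sup>2)))) * fourier u0 \<xi>"

text \<open>For \<open>|\<xi>| \<le> 1\<close> only the low-frequency profile is present, for \<open>|\<xi>| > 1\<close> only the other one, since
  \<open>\<epsilon>0 < 1 < N0\<close>.  There the cut-offs differ from \<open>1\<close> only at frequencies bounded below by \<open>\<epsilon>0/2\<close>,
  respectively above by \<open>2 N0\<close>; hence \<open>1 - \<chi>int \<le> 4 |\<xi>|\<^sup>2 / \<epsilon>0\<^sup>2\<close> and \<open>1 - \<chi>ext \<le> 2 N0 / |\<xi>|\<close>, and
  the errors made by cutting off have the same form as those of the pointwise bounds.\<close>

lemma profile_L2_bound:
  fixes \<chi>int \<chi>ext :: "'a::euclidean_space \<Rightarrow> real"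
  assumes l: "l \<ge> (0::real)"
    and \<epsilon>: "0 < \<epsilon>0" "\<epsilon>0 < 1" and N0: "1 < N0" and cut: "cutoffs \<epsilon>0 N0 \<chi>int \<chi>ext"
  shows "\<exists>C>0. \<forall>u0 \<in> H_cap_L1 (l - 1). \<forall>u1 \<in> H_cap_L1 (l - 1). \<forall>v0 \<in> H_cap_L1 (l - 3). \<forall>t\<ge>0. \<forall>W.
    frequency_bounds u0 u1 v0 t W \<longrightarrow>
    square_integrable (profile_error \<chi>int \<chi>ext u0 v0 t W) \<and>
    L2_norm (profile_error \<chi>int \<chi>ext u0 v0 t W) \<le>
      C * decay_majorant (min (real DIM('a) / 8 + 1 / 2) (real DIM('a) / 4)) l (l - 1) t u0 u1 v0"
proof -
  define m where "m = min (real DIM('a) / 8 + 1 / 2) (real DIM('a) / 4)"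
  define K where "K = 63 + 12 / \<epsilon>0\<^sup>2 + (500 + 2 * N0)"
  have K: "K > 0" "63 + 12 / \<epsilon>0\<^sup>2 \<le> K" "500 + 2 * N0 \<le> K" using N0 \<epsilon> by (auto simp: K_def add_pos_nonneg)
  obtain Cl where Cl: "Cl > 0" "\<And>\<tau>. \<tau> \<ge> 1 \<Longrightarrow> integrable lborel (\<lambda>\<xi>::'a. (low_frequency_error \<tau> \<xi>)\<^sup>2)"
    "\<And>\<tau>. \<tau> \<ge> 1 \<Longrightarrow> sqrt (LINT \<xi>|lborel. (low_frequency_error \<tau> (\<xi>::'a))\<^sup>2) \<le> Cl * \<tau> powr (- m)"
    using L2_decay_low_frequency_error[where 'a='a, folded m_def] by blast
  obtain C where C: "C > 0"
    and bound: "\<forall>u0 \<in> H_cap_L1 (l - real 1). \<forall>u1 \<in> H_cap_L1 (l - 1). \<forall>v0 \<in> H_cap_L1 (l - 3). \<forall>t\<ge>0. \<forall>w.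
      w \<in> borel_measurable borel \<longrightarrow>
      (\<forall>\<xi>. \<xi> \<noteq> 0 \<longrightarrow> norm \<xi> \<le> 1 \<longrightarrow> cmod (w \<xi>) \<le> K * low_frequency_error (1 + t) (\<xi>::'a) * transform_bound u0 u1 v0) \<longrightarrow>
      (\<forall>\<xi>. 1 < norm \<xi> \<longrightarrow> cmod (w \<xi>) \<le> K * exp (- (t / (16 * (norm \<xi>)\<^sup>2))) *
         (cmod (fourier u0 \<xi>) / norm \<xi> ^ 1 + cmod (fourier u1 \<xi>) / norm \<xi> + cmod (fourier v0 \<xi>) / norm \<xi> ^ 3)) \<longrightarrow>
      square_integrable w \<and> L2_norm w \<le> C * decay_majorant m l (l - real 1) t u0 u1 v0"
    using frequency_split_L2_bound[OF l _ Cl(1) K(1) low_frequency_error_nonneg Cl(2,3), of 1] by auto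
  have \<chi>: "\<chi>int \<xi> \<in> {0..1}" "\<chi>ext \<xi> \<in> {0..1}" "\<chi>int \<xi> \<noteq> 0 \<longrightarrow> norm \<xi> \<le> \<epsilon>0" "\<chi>ext \<xi> \<noteq> 0 \<longrightarrow> N0 \<le> norm \<xi>"
    "1 - \<chi>int \<xi> - \<chi>ext \<xi> \<noteq> 0 \<longrightarrow> \<epsilon>0 / 2 \<le> norm \<xi> \<and> norm \<xi> \<le> 2 * N0" for \<xi>
    using cut unfolding cutoffs_def by blast+
  have [measurable]: "\<chi>int \<in> borel_measurable borel" "\<chi>ext \<in> borel_measurable borel"
    using cut by (auto simp: cutoffs_def intro: smooth_measurable)
  show ?thesis
  proof (rule exI[of _ C], intro conjI[OF C] ballI allI impI)
    fix u0 u1 v0 W :: "'a \<Rightarrow> complex" and t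
    assume data: "u0 \<in> H_cap_L1 (l - 1)" "u1 \<in> H_cap_L1 (l - 1)" "v0 \<in> H_cap_L1 (l - 3)" and t: "t \<ge> (0::real)"
      and W: "frequency_bounds u0 u1 v0 t W"
    define w where "w = profile_error \<chi>int \<chi>ext u0 v0 t W"
    have [measurable]: "W \<in> borel_measurable borel" using W by (simp add: frequency_bounds_def)
    have [measurable]: "u0 \<in> borel_measurable borel" "v0 \<in> borel_measurable borel"
      using H_cap_L1D(1)[OF data(1)] H_cap_L1D(1)[OF data(3)] by measurable
    have wm: "w \<in> borel_measurable borel" unfolding w_def profile_error_def[abs_def] by measurable
    have low: "cmod (w \<xi>) \<le> K * low_frequency_error (1 + t) \<xi> * transform_bound u0 u1 v0"
      if \<xi>: "\<xi> \<noteq> 0" "norm \<xi> \<le> 1" for \<xi>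
    proof -
      define X where "X = low_frequency_error (1 + t) \<xi> * transform_bound u0 u1 v0"
      have X: "X \<ge> 0" unfolding X_def by (intro mult_nonneg_nonneg low_frequency_error_nonneg transform_bound_nonneg)
      have ext0: "\<chi>ext \<xi> = 0" using \<chi>(4)[of \<xi>] N0 \<xi> by auto
      define M where "M = fourier u0 \<xi> - fourier v0 \<xi>"
      define e where "e = exp (- (norm \<xi> ^ 4 * t))"
      have "w \<xi> = (W \<xi> - of_real e * M) + of_real ((1 - \<chi>int \<xi>) * e) * M"
        by (simp add: w_def profile_error_def ext0 M_def e_def algebra_simps)
      then have "cmod (w \<xi>) \<le> cmod (W \<xi> - of_real e * M) + cmod (of_real ((1 - \<chi>int \<xi>) * e) * M)"
        by (metis norm_triangle_ineq)
      also have "\<dots> \<le> 63 * X + 12 / \<epsilon>0\<^sup>2 * X"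
      proof (rule add_mono)
        show "cmod (W \<xi> - of_real e * M) \<le> 63 * X"
          using frequency_bounds_low(1)[OF W t \<xi>] by (simp only: X_def e_def M_def mult.assoc)
        have 1: "1 - \<chi>int \<xi> \<le> 4 / \<epsilon>0\<^sup>2 * (norm \<xi>)\<^sup>2"
        proof (cases "\<chi>int \<xi> = 1")
          case False
          then have "\<epsilon>0 / 2 \<le> norm \<xi>" using \<chi>(5)[of \<xi>] ext0 by auto
          then have "(\<epsilon>0 / 2)\<^sup>2 \<le> (norm \<xi>)\<^sup>2" using \<epsilon> by (intro power_mono) auto
          then have "1 \<le> 4 / \<epsilon>0\<^sup>2 * (norm \<xi>)\<^sup>2" using \<epsilon> by (simp add: power_divide field_simps)
          then show ?thesis using \<chi>(1)[of \<xi>] by simp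
        qed simp
        have r4: "norm \<xi> ^ 4 \<le> 1" using \<xi> by (simp add: power_le_one)
        have 2: "e \<le> 3 * exp (- (norm \<xi> ^ 4 * (1 + t) / 4))"
        proof -
          have "e \<le> exp (- (norm \<xi> ^ 4 * t / 4))" using t by (simp add: e_def)
          also have "\<dots> \<le> 3 * exp (- (norm \<xi> ^ 4 * (1 + t) / 4))" using r4 by (intro exp_shift_le) auto
          finally show ?thesis .
        qed
        have 3: "cmod M \<le> transform_bound u0 u1 v0"
          using fourier_le_transform_bound[of u0 \<xi> u1 v0] norm_triangle_ineq4[of "fourier u0 \<xi>" "fourier v0 \<xi>"]
            norm_ge_zero[of "fourier u1 \<xi>"]
          unfolding M_def by linarith
        have "cmod (of_real ((1 - \<chi>int \<xi>) * e) * M) = (1 - \<chi>int \<xi>) * e * cmod M"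
          unfolding norm_mult norm_of_real using \<chi>(1)[of \<xi>] by (simp add: abs_mult e_def)
        also have "\<dots> \<le> (4 / \<epsilon>0\<^sup>2 * (norm \<xi>)\<^sup>2) * (3 * exp (- (norm \<xi> ^ 4 * (1 + t) / 4))) * transform_bound u0 u1 v0"
          using \<chi>(1)[of \<xi>] by (intro mult_mono 1 2 3) (auto simp: e_def)
        also have "\<dots> = 12 / \<epsilon>0\<^sup>2 * (((norm \<xi>)\<^sup>2 * exp (- (norm \<xi> ^ 4 * (1 + t) / 4))) * transform_bound u0 u1 v0)" by simp
        also have "\<dots> \<le> 12 / \<epsilon>0\<^sup>2 * X"
          unfolding X_def low_frequency_error_def by (intro mult_left_mono mult_right_mono transform_bound_nonneg) auto
        finally show "cmod (of_real ((1 - \<chi>int \<xi>) * e) * M) \<le> 12 / \<epsilon>0\<^sup>2 * X" .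
      qed
      also have "\<dots> = (63 + 12 / \<epsilon>0\<^sup>2) * X" by (simp add: algebra_simps)
      also have "\<dots> \<le> K * X" using X K by (intro mult_right_mono)
      finally show ?thesis by (simp add: X_def)
    qed
    have high: "cmod (w \<xi>) \<le> K * exp (- (t / (16 * (norm \<xi>)\<^sup>2))) *
         (cmod (fourier u0 \<xi>) / norm \<xi> ^ 1 + cmod (fourier u1 \<xi>) / norm \<xi> + cmod (fourier v0 \<xi>) / norm \<xi> ^ 3)"
      if "1 < norm \<xi>" for \<xi>
    proof -
      have n1: "norm \<xi> \<ge> 1" and n0: "0 < norm \<xi>" using that by linarith+
      have int0: "\<chi>int \<xi> = 0" using \<chi>(3)[of \<xi>] \<epsilon> that by auto
      define e where "e = exp (- (t / (16 * (norm \<xi>)\<^sup>2)))"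
      define g where "g = of_real (cos (norm \<xi> * t) * exp (- (t / (2 * (norm \<xi>)\<^sup>2)))) * fourier u0 \<xi>"
      define a b where "a = cmod (fourier u0 \<xi>) / norm \<xi>" and "b = cmod (fourier u1 \<xi>) / norm \<xi> + cmod (fourier v0 \<xi>) / norm \<xi> ^ 3"
      have nn: "e \<ge> 0" "a \<ge> 0" "b \<ge> 0" by (auto simp: e_def a_def b_def)
      have g: "cmod g \<le> e * cmod (fourier u0 \<xi>)"
        unfolding g_def e_def norm_mult norm_of_real
        by (intro mult_right_mono oscillating_factor_le n1 t) auto
      have 1: "1 - \<chi>ext \<xi> \<le> 2 * N0 / norm \<xi>"
      proof (cases "\<chi>ext \<xi> = 1")
        case False
        then have "norm \<xi> \<le> 2 * N0" using \<chi>(5)[of \<xi>] int0 by auto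
        then have "1 \<le> 2 * N0 / norm \<xi>" using n0 by (simp add: pos_le_divide_eq)
        then show ?thesis using \<chi>(2)[of \<xi>] by simp
      qed (use N0 in simp)
      have "w \<xi> = (W \<xi> - g) + of_real (1 - \<chi>ext \<xi>) * g"
        by (simp add: w_def profile_error_def int0 g_def algebra_simps)
      then have "cmod (w \<xi>) \<le> cmod (W \<xi> - g) + cmod (of_real (1 - \<chi>ext \<xi>) * g)"
        by (metis norm_triangle_ineq)
      also have "\<dots> \<le> 500 * e * (a + b) + 2 * N0 * e * (a + b)"
      proof (rule add_mono)
        have "cmod (W \<xi> - g) \<le> 500 * e *
            (cmod (fourier u0 \<xi>) / norm \<xi> + cmod (fourier u1 \<xi>) / norm \<xi> + cmod (fourier v0 \<xi>) / norm \<xi> ^ 3)"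
          using W n1 unfolding frequency_bounds_def g_def e_def by blast
        then show "cmod (W \<xi> - g) \<le> 500 * e * (a + b)" unfolding a_def b_def add.assoc .
        have "cmod (of_real (1 - \<chi>ext \<xi>) * g) = (1 - \<chi>ext \<xi>) * cmod g"
          unfolding norm_mult norm_of_real using \<chi>(2)[of \<xi>] by simp
        also have "\<dots> \<le> (2 * N0 / norm \<xi>) * (e * cmod (fourier u0 \<xi>))"
          using N0 by (intro mult_mono 1 g) auto
        also have "\<dots> = 2 * N0 * e * a" by (simp add: a_def)
        also have "\<dots> \<le> 2 * N0 * e * (a + b)" using nn N0 by (intro mult_left_mono) auto
        finally show "cmod (of_real (1 - \<chi>ext \<xi>) * g) \<le> 2 * N0 * e * (a + b)" .
      qed
      also have "\<dots> = (500 + 2 * N0) * (e * (a + b))" by (simp add: algebra_simps)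
      also have "\<dots> \<le> K * (e * (a + b))" using nn K by (intro mult_right_mono) auto
      finally show ?thesis by (simp add: a_def b_def e_def add.assoc mult.assoc)
    qed
    show "square_integrable (profile_error \<chi>int \<chi>ext u0 v0 t W) \<and> L2_norm (profile_error \<chi>int \<chi>ext u0 v0 t W) \<le>
      C * decay_majorant (min (real DIM('a) / 8 + 1 / 2) (real DIM('a) / 4)) l (l - 1) t u0 u1 v0"
      using bound[rule_format, of u0 u1 v0 t w] data t wm low high unfolding w_def m_def by simp
  qed
qed

text \<open>On the ball of radius \<open>t\<^sup>-\<^sup>1\<^sup>/\<^sup>4\<close> the leading term has modulus at least a fixed multiple \<open>k\<close> of
  the modulus \<open>P\<close> of the mean of \<open>u\<^sub>0 - v\<^sub>0\<close>, once the ball is so small that the continuous transform of \<open>u\<^sub>0 - v\<^sub>0\<close> is close to its value at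
  \<open>0\<close>.  The ball has volume of order \<open>t\<^sup>-\<^sup>n\<^sup>/\<^sup>4\<close>, and the squared norm of the error is of smaller order.
  Only the time from which this holds depends on the data.\<close>

lemma solution_L2_lower_bound:
  "\<exists>C>0. \<forall>(u0 :: 'a::euclidean_space \<Rightarrow> complex) u1 v0 U. integrable lborel u0 \<longrightarrow> integrable lborel v0 \<longrightarrow>
       (\<forall>t\<ge>0. frequency_bounds u0 u1 v0 t (U t)) \<longrightarrow> (\<forall>t\<ge>0. square_integrable (U t)) \<longrightarrow>
       P_int (\<lambda>x. u0 x - v0 x) \<noteq> 0 \<longrightarrow>
       (\<exists>t0>0. \<forall>t\<ge>t0. t powr (- real DIM('a) / 8) * cmod (P_int (\<lambda>x. u0 x - v0 x)) \<le> C * L2_norm (U t))"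
proof -
  let ?\<phi> = "low_frequency_error :: real \<Rightarrow> 'a \<Rightarrow> real"
  define m where "m = min (real DIM('a) / 8 + 1 / 2) (real DIM('a) / 4)"
  obtain Cl where Cl: "Cl > 0"
    "\<And>\<tau>. \<tau> \<ge> 1 \<Longrightarrow> integrable lborel (\<lambda>\<xi>. (?\<phi> \<tau> \<xi>)\<^sup>2)"
    "\<And>\<tau>. \<tau> \<ge> 1 \<Longrightarrow> sqrt (LINT \<xi>|lborel. (?\<phi> \<tau> \<xi>)\<^sup>2) \<le> Cl * \<tau> powr (- m)"
    using L2_decay_low_frequency_error[where 'a='a, folded m_def] by blast
  define n where "n = real DIM('a)"
  have n: "n \<ge> 1" by (simp add: n_def Suc_leI)
  define c0 where "c0 = (2 * pi) powr (- real DIM('a) / 2)"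
  have c0: "c0 > 0" by (simp add: c0_def)
  define B where "B = unit_ball_vol n"
  have B: "B > 0" unfolding B_def n_def by (rule unit_ball_vol_pos) simp
  show ?thesis
  proof (rule exI[of _ "12 / (c0 * sqrt B)"], rule conjI[rotated], intro allI impI)
    show "12 / (c0 * sqrt B) > 0" using c0 B by simp
    fix u0 u1 v0 :: "'a \<Rightarrow> complex" and U
    assume i: "integrable lborel u0" "integrable lborel v0"
      and U': "\<forall>t\<ge>0. frequency_bounds u0 u1 v0 t (U t)" and U2': "\<forall>t\<ge>0. square_integrable (U t)"
      and P0: "P_int (\<lambda>x. u0 x - v0 x) \<noteq> 0"
    note U = U'[rule_format] and U2 = U2'[rule_format]
    define P where "P = cmod (P_int (\<lambda>x. u0 x - v0 x))"
    have P: "P > 0" using P0 by (simp add: P_def)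
    define k where "k = c0 * P / 6"
    have k: "k > 0" using c0 P by (simp add: k_def)
    define M where "M = 63 * transform_bound u0 u1 v0"
    define f where "f = fourier (\<lambda>x. u0 x - v0 x)"
    have fe: "f \<xi> = fourier u0 \<xi> - fourier v0 \<xi>" for \<xi> unfolding f_def by (rule fourier_diff[OF i])
    have f0: "cmod (f 0) = c0 * P" using c0 by (simp add: f_def fourier_0 P_def c0_def)
    have "isCont f 0" unfolding f_def using i by (intro fourier_isCont_0 Bochner_Integration.integrable_diff)
    then obtain d where d: "d > 0" "\<And>\<xi>. dist \<xi> 0 < d \<Longrightarrow> dist (f \<xi>) (f 0) < c0 * P / 2"
      unfolding continuous_at_eps_delta using c0 P by (metis half_gt_zero mult_pos_pos)
    have flow: "cmod (f \<xi>) \<ge> 3 * k" if "norm \<xi> < d" for \<xi>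
    proof -
      have "cmod (f 0 - f \<xi>) < c0 * P / 2" using d(2)[of \<xi>] that by (simp add: dist_norm norm_minus_commute)
      then show ?thesis using norm_triangle_ineq2[of "f 0" "f \<xi>"] unfolding f0 k_def by linarith
    qed
    have lim1: "((\<lambda>t::real. t powr (- (1 / 4))) \<longlongrightarrow> 0) at_top"
      by (rule tendsto_neg_powr) (auto intro: filterlim_ident)
    have lim2: "((\<lambda>t::real. t powr (- (2 * m - n / 4))) \<longlongrightarrow> 0) at_top"
      using n by (intro tendsto_neg_powr) (auto simp: m_def n_def min_def intro: filterlim_ident)
    have lim3: "((\<lambda>t. 2 * M\<^sup>2 * Cl\<^sup>2 * t powr (- (2 * m - n / 4))) \<longlongrightarrow> 0) at_top"
      using tendsto_mult_right_zero[OF lim2] by simp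
    have "\<forall>\<^sub>F t in at_top. t powr (- (1 / 4)) < d \<and> 2 * M\<^sup>2 * Cl\<^sup>2 * t powr (- (2 * m - n / 4)) < k\<^sup>2 * B / 2"
      using order_tendstoD(2)[OF lim1 d(1)] order_tendstoD(2)[OF lim3, of "k\<^sup>2 * B / 2"] k B
      by (intro eventually_conj) auto
    then obtain t1 where t1: "\<And>t. t \<ge> t1 \<Longrightarrow> t powr (- (1 / 4)) < d"
      "\<And>t. t \<ge> t1 \<Longrightarrow> 2 * M\<^sup>2 * Cl\<^sup>2 * t powr (- (2 * m - n / 4)) < k\<^sup>2 * B / 2"
      unfolding eventually_at_top_linorder by blast
    have "t powr (- n / 8) * P \<le> 12 / (c0 * sqrt B) * L2_norm (U t)" if t: "t \<ge> max 1 t1" for t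
    proof -
      have t1': "t \<ge> 1" "t \<ge> t1" "t \<ge> 0" "t \<noteq> 0" using t by auto
      define \<rho> where "\<rho> = t powr (- (1 / 4))"
      have \<rho>: "0 < \<rho>" "\<rho> < d" using t1(1)[OF t1'(2)] t1' by (auto simp: \<rho>_def)
      have \<rho>1: "\<rho> \<le> 1" using t1' powr_mono[of "- (1 / 4)" 0 t] by (simp add: \<rho>_def)
      have \<rho>4: "\<rho> ^ 4 * t = 1"
      proof -
        have "\<rho> ^ 4 = t powr (- 1)" using t1'(4) by (simp add: \<rho>_def powr_power)
        then show ?thesis using t1' by (simp add: powr_minus)
      qed
      have \<rho>n: "\<rho> ^ DIM('a) = t powr (- n / 4)" using t1'(4) by (simp add: \<rho>_def powr_power n_def)
      note Ui = U2[OF t1'(3)]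
      have pt: "k\<^sup>2 * indicator (cball 0 \<rho>) \<xi> \<le> 2 * (cmod (U t \<xi>))\<^sup>2 + 2 * M\<^sup>2 * (?\<phi> (1 + t) \<xi>)\<^sup>2" if \<xi>: "\<xi> \<noteq> 0" for \<xi>
      proof (cases "norm \<xi> \<le> \<rho>")
        case True
        define e where "e = exp (- (norm \<xi> ^ 4 * t))"
        have "norm \<xi> ^ 4 * t \<le> \<rho> ^ 4 * t" using True t1' by (intro mult_right_mono power_mono) auto
        then have "exp (- 1) \<le> e" unfolding e_def \<rho>4 by simp
        moreover have "1 / 3 \<le> exp (- 1 :: real)" using exp_le by (simp add: exp_minus field_simps)
        ultimately have e3: "1 / 3 \<le> e" by simp
        have "k = 1 / 3 * (3 * k)" by simp
        also have "\<dots> \<le> e * cmod (f \<xi>)"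
          using e3 flow[of \<xi>] True \<rho> k by (intro mult_mono) auto
        also have "\<dots> = cmod (of_real e * f \<xi>)" by (simp add: norm_mult e_def)
        also have "\<dots> \<le> cmod (U t \<xi>) + cmod (U t \<xi> - of_real e * f \<xi>)"
          using norm_triangle_ineq4[of "U t \<xi>" "U t \<xi> - of_real e * f \<xi>"] by simp
        also have "\<dots> \<le> cmod (U t \<xi>) + M * ?\<phi> (1 + t) \<xi>"
        proof -
          have "norm \<xi> \<le> 1" using True \<rho>1 by simp
          from frequency_bounds_low(1)[OF U[OF t1'(3)] t1'(3) \<xi> this]
          have "cmod (U t \<xi> - of_real e * f \<xi>) \<le> 63 * ?\<phi> (1 + t) \<xi> * transform_bound u0 u1 v0"
            unfolding fe e_def .
          also have "\<dots> = M * ?\<phi> (1 + t) \<xi>" by (simp add: M_def)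
          finally show ?thesis by simp
        qed
        finally have "k\<^sup>2 \<le> (cmod (U t \<xi>) + M * ?\<phi> (1 + t) \<xi>)\<^sup>2"
          using k by (intro power_mono) auto
        also have "\<dots> \<le> 2 * (cmod (U t \<xi>))\<^sup>2 + 2 * (M * ?\<phi> (1 + t) \<xi>)\<^sup>2"
          using sum_squares_bound[of "cmod (U t \<xi>)" "M * ?\<phi> (1 + t) \<xi>"] by (simp add: power2_sum)
        finally show ?thesis using True by (simp add: power_mult_distrib)
      qed (auto simp: indicator_def)
      have i1: "integrable lborel (\<lambda>\<xi>::'a. k\<^sup>2 * indicator (cball 0 \<rho>) \<xi>)" by (rule integrable_indicator_cball)
      have i2: "integrable lborel (\<lambda>\<xi>. 2 * (cmod (U t \<xi>))\<^sup>2 + 2 * M\<^sup>2 * (?\<phi> (1 + t) \<xi>)\<^sup>2)"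
        using Ui Cl(2)[of "1 + t"] t1' by (auto simp: square_integrable_def)
      have "k\<^sup>2 * (B * t powr (- n / 4)) = (LINT \<xi>|lborel. k\<^sup>2 * indicator (cball (0::'a) \<rho>) \<xi>)"
        using content_cball[of \<rho> "0::'a"] \<rho> unfolding \<rho>n B_def n_def by simp
      also have "\<dots> \<le> (LINT \<xi>|lborel. 2 * (cmod (U t \<xi>))\<^sup>2 + 2 * M\<^sup>2 * (?\<phi> (1 + t) \<xi>)\<^sup>2)"
        by (intro integral_mono_AE i1 i2 eventually_mono[OF AE_nonzero] pt)
      also have "\<dots> = 2 * (L2_norm (U t))\<^sup>2 + 2 * M\<^sup>2 * (LINT \<xi>|lborel. (?\<phi> (1 + t) \<xi>)\<^sup>2)"
        using Ui Cl(2)[of "1 + t"] t1' by (simp add: L2_norm_power2 square_integrable_def)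
      also have "\<dots> \<le> 2 * (L2_norm (U t))\<^sup>2 + 2 * M\<^sup>2 * (Cl\<^sup>2 * t powr (- 2 * m))"
      proof (intro add_mono mult_left_mono order_refl)
        have "sqrt (LINT \<xi>|lborel. (?\<phi> (1 + t) \<xi>)\<^sup>2) \<le> Cl * t powr (- m)"
        proof -
          have "(1 + t) powr (- m) \<le> t powr (- m)"
            using t1' by (intro powr_mono2') (auto simp: m_def)
          then show ?thesis
            using Cl(3)[of "1 + t"] Cl(1) t1' by (meson less_eq_real_def mult_left_mono order_trans add_increasing2 le_add_same_cancel1)
        qed
        then have "(sqrt (LINT \<xi>|lborel. (?\<phi> (1 + t) \<xi>)\<^sup>2))\<^sup>2 \<le> (Cl * t powr (- m))\<^sup>2"
          by (intro power_mono) auto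
        then show "(LINT \<xi>|lborel. (?\<phi> (1 + t) \<xi>)\<^sup>2) \<le> Cl\<^sup>2 * t powr (- 2 * m)"
          using t1'(4) by (simp add: power_mult_distrib powr_power)
      qed auto
      also have "2 * M\<^sup>2 * (Cl\<^sup>2 * t powr (- 2 * m)) = 2 * M\<^sup>2 * Cl\<^sup>2 * t powr (- (2 * m - n / 4)) * t powr (- n / 4)"
        using t1' by (simp flip: powr_add)
      also have "\<dots> \<le> k\<^sup>2 * B / 2 * t powr (- n / 4)"
        using t1(2)[OF t1'(2)] by (intro mult_right_mono) auto
      finally have "k\<^sup>2 * B * t powr (- n / 4) \<le> 4 * (L2_norm (U t))\<^sup>2" by (simp add: algebra_simps)
      moreover have "k\<^sup>2 * B * t powr (- n / 4) = (k * sqrt B * t powr (- n / 8))\<^sup>2"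
        using B t1'(4) by (simp add: power_mult_distrib powr_power)
      ultimately have "(k * sqrt B * t powr (- n / 8))\<^sup>2 \<le> (2 * L2_norm (U t))\<^sup>2"
        unfolding power_mult_distrib[of 2] by simp
      then have "k * sqrt B * t powr (- n / 8) \<le> 2 * L2_norm (U t)"
        by (rule power2_le_imp_le) (simp add: L2_norm_nonneg)
      then show ?thesis using c0 B by (simp add: k_def field_simps)
    qed
    then show "\<exists>t0>0. \<forall>t\<ge>t0. t powr (- real DIM('a) / 8) * cmod (P_int (\<lambda>x. u0 x - v0 x)) \<le> 12 / (c0 * sqrt B) * L2_norm (U t)"
      unfolding P_def n_def by (intro exI[of _ "max 1 t1"]) auto
  qed
qed

lemma has_fourier_distr_L2_norm:
  assumes "has_fourier T g" "square_integrable g"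
  shows "in_L2 T" "distr_L2_norm T = L2_norm g"
  using assms distr_L2_norm_eq[of g T] by (auto simp: has_fourier_def)

theorem theorem2p2:
  fixes l \<epsilon>0 N0 :: real
    and \<chi>int \<chi>ext :: "real ^ 'n \<Rightarrow> real"
  assumes l: "l \<ge> 0"
    and cut: "0 < \<epsilon>0" "\<epsilon>0 < 1" "1 < N0" "cutoffs \<epsilon>0 N0 \<chi>int \<chi>ext"
  shows
    "(\<exists>C>0. \<forall>(u0 :: real ^ 'n \<Rightarrow> complex) u1 v0 u v.
        u0 \<in> H_cap_L1 l \<longrightarrow> u1 \<in> H_cap_L1 (l - 1) \<longrightarrow> v0 \<in> H_cap_L1 (l - 3) \<longrightarrow>
        cauchy_solution u0 u1 v0 u v \<longrightarrow>
        (\<forall>t\<ge>0. in_L2 (u t) \<and>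
           distr_L2_norm (u t) \<le> C *
             ((1 + t) powr (- real CARD('n) / 8) * (L1_norm u0 + L1_norm u1 + L1_norm v0) +
              (1 + t) powr (- l / 2) * (H_norm l u0 + H_norm (l - 1) u1 + H_norm (l - 3) v0))))
     \<and>
     (l > real CARD('n) / 4 \<longrightarrow>
      (\<exists>C>0. \<forall>(u0 :: real ^ 'n \<Rightarrow> complex) u1 v0 u v.
        u0 \<in> H_cap_L1 l \<longrightarrow> u1 \<in> H_cap_L1 (l - 1) \<longrightarrow> v0 \<in> H_cap_L1 (l - 3) \<longrightarrow>
        cauchy_solution u0 u1 v0 u v \<longrightarrow>
        cmod (P_int (\<lambda>x. u0 x - v0 x)) \<noteq> 0 \<longrightarrow>
        (\<exists>t0>0. \<forall>t\<ge>t0. in_L2 (u t) \<and>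
           t powr (- real CARD('n) / 8) * cmod (P_int (\<lambda>x. u0 x - v0 x))
             \<le> C * distr_L2_norm (u t) \<and>
           distr_L2_norm (u t) \<le> C * (t powr (- real CARD('n) / 8) *
             (H_cap_L1_norm l u0 + H_cap_L1_norm (l - 1) u1 + H_cap_L1_norm (l - 3) v0)))))
     \<and>
     (\<exists>C>0. \<forall>(u0 :: real ^ 'n \<Rightarrow> complex) u1 v0 u v.
        u0 \<in> H_cap_L1 (l - 1) \<longrightarrow> u1 \<in> H_cap_L1 (l - 1) \<longrightarrow> v0 \<in> H_cap_L1 (l - 3) \<longrightarrow>
        cauchy_solution u0 u1 v0 u v \<longrightarrow>
        (\<forall>t\<ge>0.
           let w = (\<lambda>\<psi>. u t \<psi> - G_s \<chi>int t (\<lambda>x. u0 x - v0 x) \<psi> - G_l \<chi>ext t u0 \<psi>)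
           in in_L2 w \<and>
              distr_L2_norm w \<le> C *
                ((1 + t) powr (- min (real CARD('n) / 8 + 1 / 2) (real CARD('n) / 4)) *
                   (L1_norm u0 + L1_norm u1 + L1_norm v0) +
                 (1 + t) powr (- l / 2) *
                   (H_norm (l - 1) u0 + H_norm (l - 1) u1 + H_norm (l - 3) v0))))"
proof -
  have dim: "DIM(real ^ 'n) = CARD('n)" by simp
  obtain C1 where C1: "C1 > 0"
    and sol: "\<forall>u0 \<in> H_cap_L1 l. \<forall>u1 \<in> H_cap_L1 (l - 1). \<forall>v0 \<in> H_cap_L1 (l - 3). \<forall>t\<ge>0. \<forall>W.
      frequency_bounds (u0 :: real ^ 'n \<Rightarrow> complex) u1 v0 t W \<longrightarrow>
      square_integrable W \<and> L2_norm W \<le> C1 * decay_majorant (real CARD('n) / 8) l l t u0 u1 v0"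
    using solution_L2_bound[OF l, where 'a="real ^ 'n"] unfolding dim by blast
  obtain C2 where C2: "C2 > 0"
    "\<And>(u0 :: real ^ 'n \<Rightarrow> complex) u1 v0 U. integrable lborel u0 \<Longrightarrow> integrable lborel v0 \<Longrightarrow>
       \<forall>t\<ge>0. frequency_bounds u0 u1 v0 t (U t) \<Longrightarrow> \<forall>t\<ge>0. square_integrable (U t) \<Longrightarrow>
       P_int (\<lambda>x. u0 x - v0 x) \<noteq> 0 \<Longrightarrow>
       \<exists>t0>0. \<forall>t\<ge>t0. t powr (- real CARD('n) / 8) * cmod (P_int (\<lambda>x. u0 x - v0 x)) \<le> C2 * L2_norm (U t)"
    using solution_L2_lower_bound[where 'a="real ^ 'n"] unfolding dim by blast
  obtain C3 where C3: "C3 > 0"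
    and prof: "\<forall>u0 \<in> H_cap_L1 (l - 1). \<forall>u1 \<in> H_cap_L1 (l - 1). \<forall>v0 \<in> H_cap_L1 (l - 3). \<forall>t\<ge>0. \<forall>W.
      frequency_bounds u0 u1 v0 t W \<longrightarrow>
      square_integrable (profile_error \<chi>int \<chi>ext u0 v0 t W) \<and>
      L2_norm (profile_error \<chi>int \<chi>ext u0 v0 t W) \<le>
        C3 * decay_majorant (min (real CARD('n) / 8 + 1 / 2) (real CARD('n) / 4)) l (l - 1) t u0 u1 v0"
    using profile_L2_bound[OF l cut] unfolding dim by blast
  have upper: "in_L2 (u t)" "distr_L2_norm (u t) \<le> C1 * decay_majorant (real CARD('n) / 8) l l t u0 u1 v0"
    if data: "u0 \<in> H_cap_L1 l" "u1 \<in> H_cap_L1 (l - 1)" "v0 \<in> H_cap_L1 (l - 3)"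
      and cs: "cauchy_solution u0 u1 v0 u v" and t: "t \<ge> 0"
    for u0 u1 v0 :: "real ^ 'n \<Rightarrow> complex" and u v t
  proof -
    obtain U where U: "\<And>t. t \<ge> 0 \<Longrightarrow> has_fourier (u t) (U t)" "\<And>t. t \<ge> 0 \<Longrightarrow> frequency_bounds u0 u1 v0 t (U t)"
      using cauchy_solution_frequency_bounds[OF cs] by metis
    have "square_integrable (U t)" "L2_norm (U t) \<le> C1 * decay_majorant (real CARD('n) / 8) l l t u0 u1 v0"
      using sol data t U(2)[OF t] by blast+
    with has_fourier_distr_L2_norm[OF U(1)[OF t]]
    show "in_L2 (u t)" "distr_L2_norm (u t) \<le> C1 * decay_majorant (real CARD('n) / 8) l l t u0 u1 v0" by auto
  qed
  show ?thesis
  proof (intro conjI impI, goal_cases)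
    case 1
    show ?case
      using C1 upper unfolding decay_majorant_def by (intro exI[of _ C1]) simp
  next
    case 2
    note ln = this
    show ?case
    proof (rule exI[of _ "C1 + C2"], rule conjI[rotated], intro allI impI)
      show "C1 + C2 > 0" using C1 C2(1) by simp
      fix u0 u1 v0 :: "real ^ 'n \<Rightarrow> complex" and u v
      assume data: "u0 \<in> H_cap_L1 l" "u1 \<in> H_cap_L1 (l - 1)" "v0 \<in> H_cap_L1 (l - 3)"
        and cs: "cauchy_solution u0 u1 v0 u v" and P: "cmod (P_int (\<lambda>x. u0 x - v0 x)) \<noteq> 0"
      obtain U where U: "\<And>t. t \<ge> 0 \<Longrightarrow> has_fourier (u t) (U t)" "\<And>t. t \<ge> 0 \<Longrightarrow> frequency_bounds u0 u1 v0 t (U t)"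
        using cauchy_solution_frequency_bounds[OF cs] by metis
      have U2: "square_integrable (U t)" if "t \<ge> 0" for t using sol data that U(2)[OF that] by blast
      have "P_int (\<lambda>x. u0 x - v0 x) \<noteq> 0" using P by simp
      with C2(2)[OF H_cap_L1D(1)[OF data(1)] H_cap_L1D(1)[OF data(3)], of u1 U] U(2) U2
      obtain t0 where t0: "t0 > 0"
        "\<And>t. t \<ge> t0 \<Longrightarrow> t powr (- real CARD('n) / 8) * cmod (P_int (\<lambda>x. u0 x - v0 x)) \<le> C2 * L2_norm (U t)"
        by blast
      show "\<exists>t0>0. \<forall>t\<ge>t0. in_L2 (u t) \<and>
             t powr (- real CARD('n) / 8) * cmod (P_int (\<lambda>x. u0 x - v0 x))
               \<le> (C1 + C2) * distr_L2_norm (u t) \<and>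
             distr_L2_norm (u t) \<le> (C1 + C2) * (t powr (- real CARD('n) / 8) *
               (H_cap_L1_norm l u0 + H_cap_L1_norm (l - 1) u1 + H_cap_L1_norm (l - 3) v0))"
      proof (intro exI[of _ "max 1 t0"] conjI allI impI)
        fix t assume "max 1 t0 \<le> t"
        then have t: "t \<ge> 1" "t \<ge> t0" "t \<ge> 0" by auto
        show "in_L2 (u t)" by (rule upper(1)[OF data cs t(3)])
        have eq: "distr_L2_norm (u t) = L2_norm (U t)"
          by (rule has_fourier_distr_L2_norm(2)[OF U(1)[OF t(3)] U2[OF t(3)]])
        have "C2 * L2_norm (U t) \<le> (C1 + C2) * L2_norm (U t)"
          using C1 by (intro mult_right_mono) (auto simp: L2_norm_nonneg)
        with t0(2)[OF t(2)] show "t powr (- real CARD('n) / 8) * cmod (P_int (\<lambda>x. u0 x - v0 x))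
               \<le> (C1 + C2) * distr_L2_norm (u t)" unfolding eq by linarith
        define A where "A = L1_norm u0 + L1_norm u1 + L1_norm v0"
        define B where "B = H_norm l u0 + H_norm (l - 1) u1 + H_norm (l - 3) v0"
        have AB: "A \<ge> 0" "B \<ge> 0"
          unfolding A_def B_def H_norm_def by (intro add_nonneg_nonneg L1_norm_nonneg L2_norm_nonneg)+
        have 1: "(1 + t) powr (- real CARD('n) / 8) \<le> t powr (- real CARD('n) / 8)"
          using t by (intro powr_mono2') auto
        have "(1 + t) powr (- l / 2) \<le> t powr (- l / 2)"
          using t l by (intro powr_mono2') auto
        also have "\<dots> \<le> t powr (- real CARD('n) / 8)"
          using t ln by (intro powr_mono) auto
        finally have 2: "(1 + t) powr (- l / 2) \<le> t powr (- real CARD('n) / 8)" .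
        have "distr_L2_norm (u t) \<le> C1 * ((1 + t) powr (- real CARD('n) / 8) * A + (1 + t) powr (- l / 2) * B)"
          using upper(2)[OF data cs t(3)] by (simp add: decay_majorant_def A_def B_def)
        also have "\<dots> \<le> (C1 + C2) * (t powr (- real CARD('n) / 8) * A + t powr (- real CARD('n) / 8) * B)"
          using C1 C2(1) AB by (intro mult_mono add_mono mult_right_mono 1 2) auto
        finally show "distr_L2_norm (u t) \<le> (C1 + C2) * (t powr (- real CARD('n) / 8) *
               (H_cap_L1_norm l u0 + H_cap_L1_norm (l - 1) u1 + H_cap_L1_norm (l - 3) v0))"
          by (simp add: A_def B_def H_cap_L1_norm_def algebra_simps)
      qed auto
    qed
  next
    case 3
    show ?case
    proof (intro exI[of _ C3] conjI C3 allI impI, unfold Let_def, fold decay_majorant_def)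
      fix u0 u1 v0 :: "real ^ 'n \<Rightarrow> complex" and u v t
      assume data: "u0 \<in> H_cap_L1 (l - 1)" "u1 \<in> H_cap_L1 (l - 1)" "v0 \<in> H_cap_L1 (l - 3)"
        and cs: "cauchy_solution u0 u1 v0 u v" and t: "(t::real) \<ge> 0"
      obtain U where U: "\<And>t. t \<ge> 0 \<Longrightarrow> has_fourier (u t) (U t)" "\<And>\<xi>. U 0 \<xi> = fourier u0 \<xi>"
        "\<And>t. t \<ge> 0 \<Longrightarrow> frequency_bounds u0 u1 v0 t (U t)"
        using cauchy_solution_frequency_bounds[OF cs] by metis
      define m1 where "m1 \<xi> = complex_of_real (\<chi>int \<xi> * exp (- (norm \<xi> ^ 4 * t)))" for \<xi>
      define m2 where "m2 \<xi> = complex_of_real (\<chi>ext \<xi> * cos (norm \<xi> * t) * exp (- (t / (2 * (norm \<xi>)\<^sup>2))))" for \<xi>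
      define W where "W = profile_error \<chi>int \<chi>ext u0 v0 t (U t)"
      have W_eq: "W \<xi> = U t \<xi> - m1 \<xi> * (fourier u0 \<xi> - fourier v0 \<xi>) - m2 \<xi> * fourier u0 \<xi>" for \<xi>
        by (simp add: W_def profile_error_def m1_def m2_def)
      have W: "square_integrable W" "L2_norm W \<le> C3 * decay_majorant
          (min (real CARD('n) / 8 + 1 / 2) (real CARD('n) / 4)) l (l - 1) t u0 u1 v0"
        using prof data t U(3)[OF t] unfolding W_def by blast+
      define w where "w = (\<lambda>\<psi>. u t \<psi> - G_s \<chi>int t (\<lambda>x. u0 x - v0 x) \<psi> - G_l \<chi>ext t u0 \<psi>)"
      note iu = H_cap_L1D(1)[OF data(1)] and iv = H_cap_L1D(1)[OF data(3)]
      have [measurable]: "\<chi>ext \<in> borel_measurable borel"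
        using cut(4) by (auto simp: cutoffs_def intro: smooth_measurable)
      have m2m: "m2 \<in> borel_measurable lborel"
        unfolding m2_def[abs_def] by measurable
      have m2b: "cmod (m2 \<xi>) \<le> 1" for \<xi>
      proof -
        have "\<chi>ext \<xi> \<in> {0..1}" using cut(4) unfolding cutoffs_def by blast
        then have "\<bar>\<chi>ext \<xi>\<bar> * \<bar>cos (norm \<xi> * t)\<bar> * exp (- (t / (2 * (norm \<xi>)\<^sup>2))) \<le> 1 * 1 * 1"
          using t by (intro mult_mono) auto
        then show ?thesis by (simp add: m2_def norm_mult)
      qed
      have wW: "w \<psi> = (LINT \<xi>|lborel. W \<xi> * inverse_fourier \<psi> \<xi>)" if \<psi>: "\<psi> \<in> schwartz" for \<psi>
      proof -
        have i0: "integrable lborel (\<lambda>\<xi>. U 0 \<xi> * inverse_fourier \<psi> \<xi>)"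
          and it: "integrable lborel (\<lambda>\<xi>. U t \<xi> * inverse_fourier \<psi> \<xi>)" "u t \<psi> = (LINT \<xi>|lborel. U t \<xi> * inverse_fourier \<psi> \<xi>)"
          using U(1)[of 0] U(1)[OF t] \<psi> by (auto simp: has_fourier_def)
        \<comment> \<open>the transform of \<open>u0\<close> is that of the solution at time \<open>0\<close>, so it can be paired with \<open>\<psi>\<close>\<close>
        have i2: "integrable lborel (\<lambda>\<xi>. m2 \<xi> * fourier u0 \<xi> * inverse_fourier \<psi> \<xi>)"
          using integrable_bounded_mult[OF i0 m2m m2b] by (simp add: U(2) mult.assoc)
        have "integrable lborel (\<lambda>\<xi>. W \<xi> * inverse_fourier \<psi> \<xi>)"
          by (intro Cauchy_Schwarz_integrable W Plancherel_L1_L2 schwartz_integrable \<psi>)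
        from Bochner_Integration.integrable_diff[OF Bochner_Integration.integrable_diff[OF it(1) i2] this]
        have i1: "integrable lborel (\<lambda>\<xi>. m1 \<xi> * (fourier u0 \<xi> - fourier v0 \<xi>) * inverse_fourier \<psi> \<xi>)"
          by (simp add: W_eq algebra_simps)
        have "(LINT \<xi>|lborel. W \<xi> * inverse_fourier \<psi> \<xi>) =
          (LINT \<xi>|lborel. U t \<xi> * inverse_fourier \<psi> \<xi>) - (LINT \<xi>|lborel. m1 \<xi> * (fourier u0 \<xi> - fourier v0 \<xi>) * inverse_fourier \<psi> \<xi>)
            - (LINT \<xi>|lborel. m2 \<xi> * fourier u0 \<xi> * inverse_fourier \<psi> \<xi>)"
          unfolding W_eq left_diff_distrib
          using it(1) i1 i2 by (simp add: left_diff_distrib)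
        then show ?thesis
          unfolding w_def G_s_def G_l_def fourier_multiplier_def it(2) fourier_diff[OF iu iv] m1_def m2_def by simp
      qed
      note w = distr_L2_norm_eq[OF W(1) wW]
      show "in_L2 (\<lambda>\<psi>. u t \<psi> - G_s \<chi>int t (\<lambda>x. u0 x - v0 x) \<psi> - G_l \<chi>ext t u0 \<psi>) \<and>
        distr_L2_norm (\<lambda>\<psi>. u t \<psi> - G_s \<chi>int t (\<lambda>x. u0 x - v0 x) \<psi> - G_l \<chi>ext t u0 \<psi>) \<le> C3 * decay_majorant
          (min (real CARD('n) / 8 + 1 / 2) (real CARD('n) / 4)) l (l - 1) t u0 u1 v0"
        using w W(2) unfolding w_def by simp
    qed
  qed
qed

end
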